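(* Assume $\mathcal M$ is pointed and let $X$ be any object of $\mathcal M$. Then $$\mathrm{Compl}(\Sigma X)\leq 2.$$
   Context: Setting. $\mathcal M$ is a closed model category satisfying the Cube axiom: in any homotopy commutative cube whose bottom face is a homotopy pushout and whose four vertical faces are homotopy pullbacks, the top face is a homotopy pushout. (Main example: the category of well-pointed topological spaces, i.e. pointed spaces whose base point inclusion is a closed cofibration.) Pointed means that $\mathcal M$ has a zero object $*$. Objects are taken cofibrant-fibrant (replacing them if necessary), and $\simeq$ denotes homotopy of maps. A homotopy commutative diagram includes a choice of mutually compatible homotopies. The suspension $\Sigma X$ is the homotopy pushout of $*\leftarrow X\to *$. For a map $\iota_X\colon A\to X$, $\mathrm{Relcat}(\iota_X)$ (strong relative category) is the least $n\ge0$ (or $\infty$) such that there are objects $X_0,\dots,X_n=X$ and maps $\iota_i\colon A\to X_i$ with: $\iota_0$ has a homotopy inverse; for each $0\le i<n$ there are maps $\rho_i\colon Z_i\to A$ and $\tau_i\colon Z_i\to X_i$ whose homotopy pushout is $X_{i+1}$ with structure maps $\iota_{i+1}\colon A\to X_{i+1}$ and $\chi_i\colon X_i\to X_{i+1}$, and a map $\sigma_i\colon A\to Z_i$ with $\rho_i\circ\sigma_i\simeq\mathrm{id}_A$ and $\tau_i\circ\sigma_i\simeq\iota_i$ (the whole diagram being homotopy commutative); and $\iota_n\simeq\iota_X$. The strong complexity of an object $Y$ is $\mathrm{Compl}(Y)=\mathrm{Relcat}(\Delta)$, where $\Delta\colon Y\to Y\times Y$ is the diagonal. *)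

theory Defs
  imports Main "HOL-Library.Extended_Nat"
begin

section \<open>Categories\<close>

record ('o, 'a) category =
  Obj :: "'o set"
  Arr :: "'a set"
  Dom :: "'a \<Rightarrow> 'o"
  Cod :: "'a \<Rightarrow> 'o"
  Id :: "'o \<Rightarrow> 'a"
  Comp :: "'a \<Rightarrow> 'a \<Rightarrow> 'a" (infixr "\<cdot>\<index>" 70)

definition hom :: "('o, 'a, 'm) category_scheme \<Rightarrow> 'o \<Rightarrow> 'o \<Rightarrow> 'a set" where
  "hom C A B = {f \<in> Arr C. Dom C f = A \<and> Cod C f = B}"

locale category =
  fixes C :: "('o, 'a, 'm) category_scheme" (structure)
  assumes dom_obj: "f \<in> Arr C \<Longrightarrow> Dom C f \<in> Obj C"
    and cod_obj: "f \<in> Arr C \<Longrightarrow> Cod C f \<in> Obj C"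
    and id_hom: "A \<in> Obj C \<Longrightarrow> Id C A \<in> hom C A A"
    and comp_hom: "f \<in> hom C A B \<Longrightarrow> g \<in> hom C B D \<Longrightarrow> g \<cdot> f \<in> hom C A D"
    and comp_id: "f \<in> hom C A B \<Longrightarrow> f \<cdot> Id C A = f"
    and id_comp: "f \<in> hom C A B \<Longrightarrow> Id C B \<cdot> f = f"
    and comp_assoc: "f \<in> hom C A B \<Longrightarrow> g \<in> hom C B D \<Longrightarrow> h \<in> hom C D E \<Longrightarrow>
      (h \<cdot> g) \<cdot> f = h \<cdot> (g \<cdot> f)"

definition op_category :: "('o, 'a, 'm) category_scheme \<Rightarrow> ('o, 'a) category" where
  "op_category C = \<lparr>Obj = Obj C, Arr = Arr C, Dom = Cod C, Cod = Dom C, Id = Id C,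
     Comp = (\<lambda>f g. Comp C g f)\<rparr>"

context
  fixes C :: "('o, 'a, 'm) category_scheme" (structure)
begin

definition is_terminal :: "'o \<Rightarrow> bool" where
  "is_terminal T \<longleftrightarrow> T \<in> Obj C \<and> (\<forall>A \<in> Obj C. \<exists>!f. f \<in> hom C A T)"

definition is_product :: "'a \<Rightarrow> 'a \<Rightarrow> bool" where
  "is_product p q \<longleftrightarrow> p \<in> Arr C \<and> q \<in> Arr C \<and> Dom C p = Dom C q \<and>
     (\<forall>x \<in> Arr C. \<forall>y \<in> Arr C.
        Dom C x = Dom C y \<and> Cod C x = Cod C p \<and> Cod C y = Cod C q \<longrightarrow>
        (\<exists>!u. u \<in> hom C (Dom C x) (Dom C p) \<and> p \<cdot> u = x \<and> q \<cdot> u = y))"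

definition is_pullback :: "'a \<Rightarrow> 'a \<Rightarrow> 'a \<Rightarrow> 'a \<Rightarrow> bool" where
  "is_pullback f g p q \<longleftrightarrow> f \<in> Arr C \<and> g \<in> Arr C \<and> Cod C f = Cod C g \<and>
     p \<in> Arr C \<and> q \<in> Arr C \<and> Dom C p = Dom C q \<and>
     Cod C p = Dom C f \<and> Cod C q = Dom C g \<and> f \<cdot> p = g \<cdot> q \<and>
     (\<forall>x \<in> Arr C. \<forall>y \<in> Arr C.
        Dom C x = Dom C y \<and> Cod C x = Dom C f \<and> Cod C y = Dom C g \<and> f \<cdot> x = g \<cdot> y \<longrightarrow>
        (\<exists>!u. u \<in> hom C (Dom C x) (Dom C p) \<and> p \<cdot> u = x \<and> q \<cdot> u = y))"

text \<open>A finite diagram is indexed by a finite directed graph: \<open>V\<close> is its set of vertices, \<open>D\<close>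
  assigns objects to them, and \<open>(i, a, j) \<in> E\<close> is an edge from \<open>i\<close> to \<open>j\<close> carrying the arrow \<open>a\<close>.
  Cones over it are the same as cones over the functor generated by it.\<close>

definition is_cone :: "nat set \<Rightarrow> (nat \<times> 'a \<times> nat) set \<Rightarrow> (nat \<Rightarrow> 'o) \<Rightarrow> 'o \<Rightarrow> (nat \<Rightarrow> 'a) \<Rightarrow> bool" where
  "is_cone V E D L p \<longleftrightarrow> L \<in> Obj C \<and> (\<forall>i \<in> V. p i \<in> hom C L (D i)) \<and>
     (\<forall>(i, a, j) \<in> E. a \<cdot> p i = p j)"

definition is_limit :: "nat set \<Rightarrow> (nat \<times> 'a \<times> nat) set \<Rightarrow> (nat \<Rightarrow> 'o) \<Rightarrow> 'o \<Rightarrow> (nat \<Rightarrow> 'a) \<Rightarrow> bool" where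
  "is_limit V E D L p \<longleftrightarrow> is_cone V E D L p \<and>
     (\<forall>L' p'. is_cone V E D L' p' \<longrightarrow> (\<exists>!u. u \<in> hom C L' L \<and> (\<forall>i \<in> V. p i \<cdot> u = p' i)))"

definition has_finite_limits :: bool where
  "has_finite_limits \<longleftrightarrow> (\<forall>V E D. finite V \<and> finite E \<and> (\<forall>i \<in> V. D i \<in> Obj C) \<and>
     (\<forall>(i, a, j) \<in> E. i \<in> V \<and> j \<in> V \<and> a \<in> hom C (D i) (D j)) \<longrightarrow>
     (\<exists>L p. is_limit V E D L p))"

definition is_retract :: "'a \<Rightarrow> 'a \<Rightarrow> bool" where
  "is_retract f g \<longleftrightarrow> f \<in> Arr C \<and> g \<in> Arr C \<and>
     (\<exists>i r j s. i \<in> hom C (Dom C f) (Dom C g) \<and> r \<in> hom C (Dom C g) (Dom C f) \<and>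
        j \<in> hom C (Cod C f) (Cod C g) \<and> s \<in> hom C (Cod C g) (Cod C f) \<and>
        r \<cdot> i = Id C (Dom C f) \<and> s \<cdot> j = Id C (Cod C f) \<and>
        g \<cdot> i = j \<cdot> f \<and> f \<cdot> r = s \<cdot> g)"

definition has_lifting :: "'a \<Rightarrow> 'a \<Rightarrow> bool" where
  "has_lifting i p \<longleftrightarrow>
     (\<forall>u v. u \<in> hom C (Dom C i) (Dom C p) \<and> v \<in> hom C (Cod C i) (Cod C p) \<and> p \<cdot> u = v \<cdot> i \<longrightarrow>
        (\<exists>l. l \<in> hom C (Cod C i) (Dom C p) \<and> l \<cdot> i = u \<and> p \<cdot> l = v))"

end

context
  fixes C :: "('o, 'a, 'm) category_scheme"
begin

definition is_initial :: "'o \<Rightarrow> bool" where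
  "is_initial = is_terminal (op_category C)"

definition is_coproduct :: "'a \<Rightarrow> 'a \<Rightarrow> bool" where
  "is_coproduct = is_product (op_category C)"

text \<open>\<open>is_pushout C f g u v\<close>: the arrows \<open>f\<close> and \<open>g\<close> have a common domain, and the pushout square
  is \<open>u \<cdot> f = v \<cdot> g\<close>.\<close>

definition is_pushout :: "'a \<Rightarrow> 'a \<Rightarrow> 'a \<Rightarrow> 'a \<Rightarrow> bool" where
  "is_pushout = is_pullback (op_category C)"

definition has_finite_colimits :: bool where
  "has_finite_colimits \<longleftrightarrow> has_finite_limits (op_category C)"

definition is_zero :: "'o \<Rightarrow> bool" where
  "is_zero Z \<longleftrightarrow> is_initial Z \<and> is_terminal C Z"

definition pointed :: bool where
  "pointed \<longleftrightarrow> (\<exists>Z. is_zero Z)"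

end

section \<open>Closed model categories\<close>

record ('o, 'a) model_category = "('o, 'a) category" +
  Fib :: "'a set"
  Cof :: "'a set"
  Weq :: "'a set"

text \<open>Quillen's axioms CM1--CM5. Closure of the three classes under composition and the presence
  of all isomorphisms in them are consequences.\<close>

locale closed_model_category = category M
  for M :: "('o, 'a) model_category" (structure) +
  assumes classes_arr: "Fib M \<subseteq> Arr M" "Cof M \<subseteq> Arr M" "Weq M \<subseteq> Arr M"
    and finite_limits: "has_finite_limits M"
    and finite_colimits: "has_finite_colimits M"
    and two_of_three:
      "f \<in> hom M A B \<Longrightarrow> g \<in> hom M B D \<Longrightarrow> f \<in> Weq M \<Longrightarrow> g \<in> Weq M \<Longrightarrow> g \<cdot> f \<in> Weq M"
      "f \<in> hom M A B \<Longrightarrow> g \<in> hom M B D \<Longrightarrow> f \<in> Weq M \<Longrightarrow> g \<cdot> f \<in> Weq M \<Longrightarrow> g \<in> Weq M"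
      "f \<in> hom M A B \<Longrightarrow> g \<in> hom M B D \<Longrightarrow> g \<in> Weq M \<Longrightarrow> g \<cdot> f \<in> Weq M \<Longrightarrow> f \<in> Weq M"
    and retract_closed:
      "is_retract M f g \<Longrightarrow> g \<in> Fib M \<Longrightarrow> f \<in> Fib M"
      "is_retract M f g \<Longrightarrow> g \<in> Cof M \<Longrightarrow> f \<in> Cof M"
      "is_retract M f g \<Longrightarrow> g \<in> Weq M \<Longrightarrow> f \<in> Weq M"
    and lifting:
      "i \<in> Cof M \<Longrightarrow> p \<in> Fib M \<inter> Weq M \<Longrightarrow> has_lifting M i p"
      "i \<in> Cof M \<inter> Weq M \<Longrightarrow> p \<in> Fib M \<Longrightarrow> has_lifting M i p"
    and factorization:
      "f \<in> hom M A B \<Longrightarrow>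
         \<exists>E i p. i \<in> hom M A E \<inter> Cof M \<and> p \<in> hom M E B \<inter> (Fib M \<inter> Weq M) \<and> f = p \<cdot> i"
      "f \<in> hom M A B \<Longrightarrow>
         \<exists>E i p. i \<in> hom M A E \<inter> (Cof M \<inter> Weq M) \<and> p \<in> hom M E B \<inter> Fib M \<and> f = p \<cdot> i"

section \<open>Homotopies and homotopy commutative diagrams\<close>

text \<open>A homotopy on an object \<open>A\<close> consists of a cylinder \<open>Cyl\<close> with its two end inclusions
  \<open>A \<rightarrow> Cyl\<close> and its projection \<open>Cyl \<rightarrow> A\<close>, together with an arrow out of \<open>Cyl\<close>.\<close>

record 'a homotopy =
  end0 :: 'a
  end1 :: 'a
  proj :: 'a
  hmap :: 'a

context
  fixes M :: "('o, 'a) model_category" (structure)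
begin

definition cofibrant :: "'o \<Rightarrow> bool" where
  "cofibrant A \<longleftrightarrow> (\<exists>f \<in> Cof M. is_initial M (Dom M f) \<and> Cod M f = A)"

definition fibrant :: "'o \<Rightarrow> bool" where
  "fibrant A \<longleftrightarrow> (\<exists>f \<in> Fib M. is_terminal M (Cod M f) \<and> Dom M f = A)"

definition bifibrant :: "'o \<Rightarrow> bool" where
  "bifibrant A \<longleftrightarrow> cofibrant A \<and> fibrant A"

text \<open>The projection is required to be a trivial fibration, not merely a weak equivalence. For maps
  with cofibrant domain and fibrant codomain this does not change the homotopy relation (factor
  the projection as a trivial cofibration followed by a fibration and extend the homotopy), and
  it guarantees that homotopies can be precomposed with maps.\<close>

definition is_cylinder :: "'o \<Rightarrow> 'a \<Rightarrow> 'a \<Rightarrow> 'a \<Rightarrow> bool" where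
  "is_cylinder A i0 i1 p \<longleftrightarrow>
     (\<exists>j0 j1 c. is_coproduct M j0 j1 \<and> Dom M j0 = A \<and> Dom M j1 = A \<and>
        c \<in> hom M (Cod M j0) (Dom M p) \<inter> Cof M \<and> c \<cdot> j0 = i0 \<and> c \<cdot> j1 = i1 \<and>
        p \<in> Fib M \<inter> Weq M \<and> Cod M p = A \<and> p \<cdot> i0 = Id M A \<and> p \<cdot> i1 = Id M A)"

definition is_homotopy :: "'a homotopy \<Rightarrow> 'a \<Rightarrow> 'a \<Rightarrow> bool" where
  "is_homotopy h f g \<longleftrightarrow> f \<in> Arr M \<and> g \<in> Arr M \<and> Dom M f = Dom M g \<and> Cod M f = Cod M g \<and>
     is_cylinder (Dom M f) (end0 h) (end1 h) (proj h) \<and>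
     hmap h \<in> hom M (Dom M (proj h)) (Cod M f) \<and>
     hmap h \<cdot> end0 h = f \<and> hmap h \<cdot> end1 h = g"

definition homotopic :: "'a \<Rightarrow> 'a \<Rightarrow> bool" where
  "homotopic f g \<longleftrightarrow> (\<exists>h. is_homotopy h f g)"

definition has_homotopy_inverse :: "'a \<Rightarrow> bool" where
  "has_homotopy_inverse f \<longleftrightarrow> (\<exists>g \<in> hom M (Cod M f) (Dom M f).
     homotopic (g \<cdot> f) (Id M (Dom M f)) \<and> homotopic (f \<cdot> g) (Id M (Cod M f)))"

text \<open>All the squares below have the shape
    \<open>f : S \<rightarrow> A\<close>, \<open>g : S \<rightarrow> B\<close>, \<open>a : A \<rightarrow> T\<close>, \<open>b : B \<rightarrow> T\<close>,
  and \<open>h\<close> is a homotopy from \<open>a \<cdot> f\<close> to \<open>b \<cdot> g\<close>.\<close>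

definition hcomm_square :: "'a \<Rightarrow> 'a \<Rightarrow> 'a \<Rightarrow> 'a \<Rightarrow> 'a homotopy \<Rightarrow> bool" where
  "hcomm_square f g a b h \<longleftrightarrow> {f, g, a, b} \<subseteq> Arr M \<and>
     Dom M f = Dom M g \<and> Dom M a = Cod M f \<and> Dom M b = Cod M g \<and> Cod M a = Cod M b \<and>
     bifibrant (Dom M f) \<and> bifibrant (Cod M f) \<and> bifibrant (Cod M g) \<and> bifibrant (Cod M a) \<and>
     is_homotopy h (a \<cdot> f) (b \<cdot> g)"

text \<open>Here \<open>Cod M m\<close> is the double mapping cylinder of \<open>A \<leftarrow> S \<rightarrow> B\<close>: the cylinder of \<open>h\<close> is
  glued to \<open>A\<close> along \<open>f\<close> at one end (first pushout) and to \<open>B\<close> along \<open>g\<close> at the other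
  (second pushout). The arrow \<open>u\<close> is the map to \<open>T\<close> induced by \<open>a\<close>, \<open>b\<close> and \<open>h\<close>.\<close>

definition homotopy_pushout :: "'a \<Rightarrow> 'a \<Rightarrow> 'a \<Rightarrow> 'a \<Rightarrow> 'a homotopy \<Rightarrow> bool" where
  "homotopy_pushout f g a b h \<longleftrightarrow> hcomm_square f g a b h \<and>
     (\<exists>k l m n u. is_pushout M (end0 h) f k l \<and> is_pushout M (k \<cdot> end1 h) g m n \<and>
        u \<in> hom M (Cod M m) (Cod M a) \<inter> Weq M \<and>
        u \<cdot> m \<cdot> l = a \<and> u \<cdot> n = b \<and> u \<cdot> m \<cdot> k = hmap h)"

text \<open>Replace \<open>b\<close> by a fibration \<open>b'\<close>, with \<open>b = b' \<cdot> j\<close>. Lifting \<open>h\<close> along \<open>b'\<close> from \<open>j \<cdot> g\<close> at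
  its end 1 deforms \<open>j \<cdot> g\<close> into a map \<open>G \<cdot> end0 h\<close> that makes the square strictly commutative.
  The arrow \<open>u\<close> is the induced map from \<open>S\<close> to the pullback of \<open>a\<close> and \<open>b'\<close>.
  Being a weak equivalence does not depend on the choices.\<close>

definition homotopy_pullback :: "'a \<Rightarrow> 'a \<Rightarrow> 'a \<Rightarrow> 'a \<Rightarrow> 'a homotopy \<Rightarrow> bool" where
  "homotopy_pullback f g a b h \<longleftrightarrow> hcomm_square f g a b h \<and>
     (\<exists>j b' G p q u. b' \<in> Fib M \<and> Cod M b' = Cod M b \<and>
        j \<in> hom M (Dom M b) (Dom M b') \<inter> Weq M \<and> b' \<cdot> j = b \<and>
        G \<in> hom M (Dom M (proj h)) (Dom M b') \<and> b' \<cdot> G = hmap h \<and> G \<cdot> end1 h = j \<cdot> g \<and>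
        is_pullback M a b' p q \<and>
        u \<in> hom M (Dom M f) (Dom M p) \<inter> Weq M \<and> p \<cdot> u = f \<and> q \<cdot> u = G \<cdot> end0 h)"

definition postcompose :: "'a \<Rightarrow> 'a homotopy \<Rightarrow> 'a homotopy" where
  "postcompose u h = h\<lparr>hmap := u \<cdot> hmap h\<rparr>"

text \<open>\<open>k\<close> is the homotopy \<open>h\<close> precomposed with \<open>u : A' \<rightarrow> A\<close>, formed by means of a map of cylinders
  covering \<open>u\<close>.\<close>

definition is_precomposite :: "'a homotopy \<Rightarrow> 'a \<Rightarrow> 'a homotopy \<Rightarrow> bool" where
  "is_precomposite h u k \<longleftrightarrow> is_cylinder (Dom M u) (end0 k) (end1 k) (proj k) \<and>
     (\<exists>w \<in> hom M (Dom M (proj k)) (Dom M (proj h)).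
        w \<cdot> end0 k = end0 h \<cdot> u \<and> w \<cdot> end1 k = end1 h \<cdot> u \<and> proj h \<cdot> w = u \<cdot> proj k \<and>
        hmap k = hmap h \<cdot> w)"

text \<open>Think of a weak equivalence \<open>p : E \<rightarrow> A\<close> as \<open>A \<times> (contractible space) \<rightarrow> A\<close>, and of sections
  \<open>x\<close>, \<open>y\<close> of \<open>p\<close> as points of that space. Then \<open>traces p \<theta> h x y\<close> says that \<open>\<theta> : E \<rightarrow> Y\<close> restricts to
  the homotopy \<open>h\<close> along some path from \<open>x\<close> to \<open>y\<close>.\<close>

definition traces :: "'a \<Rightarrow> 'a \<Rightarrow> 'a homotopy \<Rightarrow> 'a \<Rightarrow> 'a \<Rightarrow> bool" where
  "traces p \<theta> h x y \<longleftrightarrow> (\<exists>c \<in> hom M (Dom M (proj h)) (Dom M p).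
     p \<cdot> c = proj h \<and> c \<cdot> end0 h = x \<and> c \<cdot> end1 h = y \<and> \<theta> \<cdot> c = hmap h)"

text \<open>The two chains of three homotopies, each from \<open>\<phi>\<^sub>1\<close> to \<open>\<phi>\<^sub>4\<close>, have homotopic composites
  relative to the ends: the loop that they form extends over a contractible \<open>E\<close> in the above sense.
  (When the common codomain is fibrant, it makes no difference whether \<open>E\<close> is a disc glued onto
  the loop of cylinders or an arbitrary object weakly equivalent to the domain.)\<close>

definition compatible_chains ::
  "'a homotopy \<Rightarrow> 'a homotopy \<Rightarrow> 'a homotopy \<Rightarrow> 'a homotopy \<Rightarrow> 'a homotopy \<Rightarrow> 'a homotopy \<Rightarrow> bool" where
  "compatible_chains h1 h2 h3 k1 k2 k3 \<longleftrightarrow>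
     (\<exists>p \<theta> x1 x2 x3 x4 y2 y3. p \<in> Weq M \<and> Cod M p = Cod M (proj h1) \<and>
        \<theta> \<in> hom M (Dom M p) (Cod M (hmap h1)) \<and>
        traces p \<theta> h1 x1 x2 \<and> traces p \<theta> h2 x2 x3 \<and> traces p \<theta> h3 x3 x4 \<and>
        traces p \<theta> k1 x1 y2 \<and> traces p \<theta> k2 y2 y3 \<and> traces p \<theta> k3 y3 x4)"

text \<open>A homotopy commutative cube. The top face has vertices \<open>T0, T1, T2, T3\<close> and edges
    \<open>t1 : T0 \<rightarrow> T1\<close>, \<open>t2 : T0 \<rightarrow> T2\<close>, \<open>t3 : T1 \<rightarrow> T3\<close>, \<open>t4 : T2 \<rightarrow> T3\<close>;
  the bottom face \<open>b1, b2, b3, b4\<close> on \<open>B0, B1, B2, B3\<close> has the same shape, and \<open>vi : Ti \<rightarrow> Bi\<close> are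
  the vertical edges. The vertical face over the edge from \<open>i\<close> to \<open>j\<close> carries the homotopy \<open>hij\<close>.
  The last conjunct compares the two ways round the hexagon formed by the six composite maps
  \<open>T0 \<rightarrow> B3\<close>, from \<open>v3 \<cdot> t3 \<cdot> t1\<close> to \<open>b4 \<cdot> b2 \<cdot> v0\<close>:
    via \<open>v3 \<cdot> t4 \<cdot> t2\<close> and \<open>b4 \<cdot> v2 \<cdot> t2\<close>, and via \<open>b3 \<cdot> v1 \<cdot> t1\<close> and \<open>b3 \<cdot> b1 \<cdot> v0\<close>.\<close>

definition hcomm_cube ::
  "'a \<Rightarrow> 'a \<Rightarrow> 'a \<Rightarrow> 'a \<Rightarrow> 'a homotopy \<Rightarrow> 'a \<Rightarrow> 'a \<Rightarrow> 'a \<Rightarrow> 'a \<Rightarrow> 'a homotopy \<Rightarrow>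
   'a \<Rightarrow> 'a \<Rightarrow> 'a \<Rightarrow> 'a \<Rightarrow> 'a homotopy \<Rightarrow> 'a homotopy \<Rightarrow> 'a homotopy \<Rightarrow> 'a homotopy \<Rightarrow> bool" where
  "hcomm_cube t1 t2 t3 t4 ht b1 b2 b3 b4 hb v0 v1 v2 v3 h01 h02 h13 h23 \<longleftrightarrow>
     hcomm_square t1 t2 t3 t4 ht \<and> hcomm_square b1 b2 b3 b4 hb \<and>
     hcomm_square t1 v0 v1 b1 h01 \<and> hcomm_square t2 v0 v2 b2 h02 \<and>
     hcomm_square t3 v1 v3 b3 h13 \<and> hcomm_square t4 v2 v3 b4 h23 \<and>
     (\<exists>k13 k23 kb. is_precomposite h13 t1 k13 \<and> is_precomposite h23 t2 k23 \<and>
        is_precomposite hb v0 kb \<and>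
        compatible_chains (postcompose v3 ht) k23 (postcompose b4 h02)
          k13 (postcompose b3 h01) kb)"

definition cube_axiom :: bool where
  "cube_axiom \<longleftrightarrow>
     (\<forall>t1 t2 t3 t4 ht b1 b2 b3 b4 hb v0 v1 v2 v3 h01 h02 h13 h23.
        hcomm_cube t1 t2 t3 t4 ht b1 b2 b3 b4 hb v0 v1 v2 v3 h01 h02 h13 h23 \<and>
        homotopy_pushout b1 b2 b3 b4 hb \<and>
        homotopy_pullback t1 v0 v1 b1 h01 \<and> homotopy_pullback t2 v0 v2 b2 h02 \<and>
        homotopy_pullback t3 v1 v3 b3 h13 \<and> homotopy_pullback t4 v2 v3 b4 h23 \<longrightarrow>
        homotopy_pushout t1 t2 t3 t4 ht)"

section \<open>Suspension, relative category and complexity\<close>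

definition is_bifibrant_replacement :: "'o \<Rightarrow> 'o \<Rightarrow> bool" where
  "is_bifibrant_replacement X R \<longleftrightarrow> bifibrant R \<and>
     (\<exists>Q. cofibrant Q \<and> hom M Q X \<inter> Weq M \<noteq> {} \<and> hom M Q R \<inter> Weq M \<noteq> {})"

text \<open>\<open>S\<close> is a (bifibrant) suspension of the arbitrary object \<open>X\<close>. It is determined up to homotopy
  equivalence.\<close>

definition is_suspension :: "'o \<Rightarrow> 'o \<Rightarrow> bool" where
  "is_suspension X S \<longleftrightarrow> (\<exists>R f g a b h. is_bifibrant_replacement X R \<and>
     homotopy_pushout f g a b h \<and> Dom M f = R \<and> is_zero M (Cod M f) \<and> is_zero M (Cod M g) \<and>
     Cod M a = S)"

text \<open>Each stage consists of \<open>\<sigma>\<close> and the three homotopies \<open>\<rho> \<cdot> \<sigma> \<simeq> id\<close>, \<open>\<tau> \<cdot> \<sigma> \<simeq> \<iota> i\<close> and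
  \<open>\<iota> (Suc i) \<cdot> \<rho> \<simeq> \<chi> \<cdot> \<tau>\<close>. They form no closed loop, so their compatibility is automatic; they
  induce the homotopy \<open>\<chi> \<cdot> \<iota> i \<simeq> \<iota> (Suc i)\<close>.\<close>

definition relcat_at_length :: "'a \<Rightarrow> nat \<Rightarrow> bool" where
  "relcat_at_length \<iota>X n \<longleftrightarrow>
     (\<exists>X \<iota>. \<iota>X \<in> Arr M \<and> bifibrant (Dom M \<iota>X) \<and>
        (\<forall>i \<le> n. bifibrant (X i) \<and> \<iota> i \<in> hom M (Dom M \<iota>X) (X i)) \<and>
        X n = Cod M \<iota>X \<and> has_homotopy_inverse (\<iota> 0) \<and>
        (\<forall>i < n. \<exists>Z \<rho> \<tau> \<chi> h \<sigma>.
           \<rho> \<in> hom M Z (Dom M \<iota>X) \<and> \<tau> \<in> hom M Z (X i) \<and> \<chi> \<in> hom M (X i) (X (Suc i)) \<and>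
           homotopy_pushout \<rho> \<tau> (\<iota> (Suc i)) \<chi> h \<and>
           \<sigma> \<in> hom M (Dom M \<iota>X) Z \<and>
           homotopic (\<rho> \<cdot> \<sigma>) (Id M (Dom M \<iota>X)) \<and> homotopic (\<tau> \<cdot> \<sigma>) (\<iota> i)) \<and>
        homotopic (\<iota> n) \<iota>X)"

definition Relcat :: "'a \<Rightarrow> enat" where
  "Relcat \<iota>X = Inf {enat n | n. relcat_at_length \<iota>X n}"

text \<open>The diagonal of \<open>Y\<close>, with \<open>Y \<times> Y\<close> replaced by a bifibrant \<open>W\<close> by means of a weak equivalence
  \<open>w : W \<rightarrow> Y \<times> Y\<close>; \<open>p\<close> and \<open>q\<close> are the projections of \<open>Y \<times> Y\<close>. (The product \<open>Y \<times> Y\<close> is fibrant, but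
  need not be cofibrant.)\<close>

definition is_diagonal :: "'o \<Rightarrow> 'a \<Rightarrow> bool" where
  "is_diagonal Y d \<longleftrightarrow> bifibrant Y \<and>
     (\<exists>p q w. is_product M p q \<and> Cod M p = Y \<and> Cod M q = Y \<and>
        w \<in> Weq M \<and> Cod M w = Dom M p \<and> bifibrant (Dom M w) \<and>
        d \<in> hom M Y (Dom M w) \<and> p \<cdot> w \<cdot> d = Id M Y \<and> q \<cdot> w \<cdot> d = Id M Y)"

text \<open>A diagonal in this sense exists for every bifibrant \<open>Y\<close>, and the value of \<open>Relcat\<close> does not
  depend on which one is chosen.\<close>

definition Compl :: "'o \<Rightarrow> enat" where
  "Compl Y = Relcat (SOME d. is_diagonal Y d)"

end

end

theory Submission
  imports Defs
begin

text \<open>Write \<open>S\<close> as the quotient of a contractible cone \<open>C\<close> by its base \<open>R\<close>, that is, as the union of \<open>C\<close>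
  and a point. Then \<open>S \<times> S\<close> is the union of the four corners \<open>C \<times> C\<close>, \<open>C \<times> pt\<close>, \<open>pt \<times> C\<close> and
  \<open>pt \<times> pt\<close>, and the diagonal does not meet the interior of the corner \<open>C \<times> pt\<close>. Let \<open>D\<close> be the
  complement of that corner and \<open>J\<close> its boundary. The diagonal thus factors through \<open>D\<close>, and
  \<open>S \<times> S\<close> arises from \<open>D\<close> by attaching a cone on \<open>J\<close>. In turn, \<open>D\<close> is a punctured torus: up to
  homotopy it is the wedge of the diagonal copy of \<open>S\<close> and of one axis, so it arises from the
  diagonal copy of \<open>S\<close> by attaching a cone on \<open>R\<close> by the zero map. Attaching a cone on \<open>K\<close> to \<open>Y\<close>
  is always a stage of the strong relative category, with \<open>Z\<close> the coproduct of \<open>A\<close> and \<open>K\<close>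
  (\<open>cone_stage\<close>). The two cones (\<open>first_cell\<close>, \<open>second_cell\<close>) therefore give the bound 2
  (\<open>relcat_diagonal\<close>).

  The cube axiom enters only through \<open>product_preserves_suspension\<close>: for bifibrant \<open>Y\<close>, the product
  \<open>S \<times> Y\<close> is the homotopy pushout of \<open>C \<times> Y\<close> and \<open>Y\<close> over \<open>R \<times> Y\<close>. It is applied with \<open>Y = S\<close>, to
  decompose \<open>S \<times> S\<close>, and with \<open>Y = R\<close>, to decompose the intersection \<open>S \<times> R\<close> of the two halves. All
  other steps are comparisons of strict pushouts along cofibrations of cofibrant objects. They
  rest on the gluing lemma (\<open>gluing\<close>), which also identifies the double mapping cylinders in the
  definition of homotopy pushouts with such strict pushouts (\<open>homotopy_pushout_iff_strict\<close>).\<close>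

section \<open>Categories and pushouts\<close>

context category
begin

lemma in_hom: "f \<in> hom C A B \<longleftrightarrow> f \<in> Arr C \<and> Dom C f = A \<and> Cod C f = B"
  by (auto simp: hom_def)

lemma hom_objs:
  assumes "f \<in> hom C A B"
  shows "A \<in> Obj C" "B \<in> Obj C"
  using assms dom_obj cod_obj by (auto simp: in_hom)

lemma comp_typing [simp]:
  assumes "f \<in> Arr C" "g \<in> Arr C" "Cod C f = Dom C g"
  shows "g \<cdot> f \<in> Arr C" "Dom C (g \<cdot> f) = Dom C f" "Cod C (g \<cdot> f) = Cod C g"
  using comp_hom[of f "Dom C f" "Cod C f" g "Cod C g"] assms by (auto simp: in_hom)

lemma id_typing [simp]:
  assumes "A \<in> Obj C"
  shows "Id C A \<in> Arr C" "Dom C (Id C A) = A" "Cod C (Id C A) = A"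
  using id_hom[OF assms] by (auto simp: in_hom)

lemma comp_id_arr [simp]: "f \<in> Arr C \<Longrightarrow> Dom C f = A \<Longrightarrow> f \<cdot> Id C A = f"
  using comp_id[of f A "Cod C f"] by (auto simp: in_hom)

lemma id_comp_arr [simp]: "f \<in> Arr C \<Longrightarrow> Cod C f = B \<Longrightarrow> Id C B \<cdot> f = f"
  using id_comp[of f "Dom C f" B] by (auto simp: in_hom)

lemma comp_assoc_arr [simp]:
  assumes "f \<in> Arr C" "g \<in> Arr C" "h \<in> Arr C" "Cod C f = Dom C g" "Cod C g = Dom C h"
  shows "(h \<cdot> g) \<cdot> f = h \<cdot> (g \<cdot> f)"
  using comp_assoc[of f "Dom C f" "Cod C f" g "Cod C g" h "Cod C h"] assms by (auto simp: in_hom)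

text \<open>Composites are normalised to the right by the simplifier. An equation \<open>g \<cdot> f = k\<close> therefore
  has to be available also in the form in which \<open>f\<close> is followed by a further factor.\<close>

lemma comp_reassoc:
  assumes "g \<cdot> f = k" "f \<in> hom C A B" "g \<in> hom C B D"
    and "x \<in> Arr C" "Cod C x = A"
  shows "g \<cdot> (f \<cdot> x) = k \<cdot> x"
proof -
  have "g \<cdot> (f \<cdot> x) = (g \<cdot> f) \<cdot> x"
    using assms(2-) by (simp add: in_hom)
  then show ?thesis by (simp add: assms(1))
qed

lemma pullback_exists:
  assumes lim: "has_finite_limits C" and f: "f \<in> hom C A T" and g: "g \<in> hom C B T"
  shows "\<exists>p q. is_pullback C f g p q"
proof -
  define V where "V = {0, 1, 2 :: nat}"
  define E where "E = {(0 :: nat, f, 2 :: nat), (1, g, 2)}"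
  define D where "D = (\<lambda>i :: nat. if i = 0 then A else if i = 1 then B else T)"
  have "finite V" "finite E" "\<forall>i\<in>V. D i \<in> Obj C"
    and "\<forall>(i, a, j) \<in> E. i \<in> V \<and> j \<in> V \<and> a \<in> hom C (D i) (D j)"
    using f g hom_objs[OF f] hom_objs[OF g] by (auto simp: V_def E_def D_def)
  then obtain L p where L: "is_limit C V E D L p"
    using lim unfolding has_finite_limits_def by meson
  have p: "p 0 \<in> hom C L A" "p 1 \<in> hom C L B" "p 2 \<in> hom C L T"
    "f \<cdot> p 0 = p 2" "g \<cdot> p 1 = p 2"
    using L by (auto simp: is_limit_def is_cone_def V_def E_def D_def)
  have "\<exists>!u. u \<in> hom C (Dom C x) L \<and> p 0 \<cdot> u = x \<and> p 1 \<cdot> u = y"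
    if x: "x \<in> Arr C" "Cod C x = A" and y: "y \<in> Arr C" "Dom C x = Dom C y" "Cod C y = B"
      and xy: "f \<cdot> x = g \<cdot> y" for x y
  proof -
    define p' where "p' = (\<lambda>i :: nat. if i = 0 then x else if i = 1 then y else f \<cdot> x)"
    have "is_cone C V E D (Dom C x) p'"
      using x y xy f g dom_obj[of x] by (auto simp: is_cone_def p'_def V_def E_def D_def in_hom)
    then have ex1: "\<exists>!u. u \<in> hom C (Dom C x) L \<and> (\<forall>i \<in> V. p i \<cdot> u = p' i)"
      using L by (auto simp: is_limit_def)
    have "(\<forall>i \<in> V. p i \<cdot> u = p' i) \<longleftrightarrow> p 0 \<cdot> u = x \<and> p 1 \<cdot> u = y"
      if u: "u \<in> hom C (Dom C x) L" for u
    proof -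
      have "f \<cdot> (p 0 \<cdot> u) = p 2 \<cdot> u"
        using p u f comp_assoc[OF u p(1) f] by simp
      then show ?thesis by (auto simp: V_def p'_def)
    qed
    then show ?thesis using ex1 by (metis (no_types, lifting))
  qed
  then have "is_pullback C f g (p 0) (p 1)"
    using f g p unfolding is_pullback_def by (auto simp: in_hom)
  then show ?thesis by blast
qed

lemma op_simps [simp]:
  "Obj (op_category C) = Obj C" "Arr (op_category C) = Arr C" "Dom (op_category C) = Cod C"
  "Cod (op_category C) = Dom C" "Id (op_category C) = Id C"
  "Comp (op_category C) g f = f \<cdot> g" "hom (op_category C) A B = hom C B A"
  by (auto simp: op_category_def hom_def)

lemma op_category: "category (op_category C)"
  by unfold_locales (auto simp: in_hom dom_obj cod_obj)

lemma is_pushout_iff: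
  "is_pushout C f g u v \<longleftrightarrow> f \<in> Arr C \<and> g \<in> Arr C \<and> Dom C f = Dom C g \<and>
     u \<in> Arr C \<and> v \<in> Arr C \<and> Cod C u = Cod C v \<and>
     Dom C u = Cod C f \<and> Dom C v = Cod C g \<and> u \<cdot> f = v \<cdot> g \<and>
     (\<forall>x \<in> Arr C. \<forall>y \<in> Arr C.
        Cod C x = Cod C y \<and> Dom C x = Cod C f \<and> Dom C y = Cod C g \<and> x \<cdot> f = y \<cdot> g \<longrightarrow>
        (\<exists>!w. w \<in> hom C (Cod C u) (Cod C x) \<and> w \<cdot> u = x \<and> w \<cdot> v = y))"
  by (simp add: is_pushout_def is_pullback_def)

lemma pushout_typing:
  assumes "is_pushout C f g u v" "f \<in> hom C Z A" "g \<in> hom C Z B"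
  shows "u \<in> hom C A (Cod C u)" "v \<in> hom C B (Cod C u)"
  using assms by (simp_all add: is_pushout_iff in_hom)

lemma pushout_exists:
  assumes lim: "has_finite_colimits C" and f: "f \<in> hom C Z A" and g: "g \<in> hom C Z B"
  obtains P u v where "is_pushout C f g u v" "u \<in> hom C A P" "v \<in> hom C B P" "u \<cdot> f = v \<cdot> g"
proof -
  obtain u v where uv: "is_pushout C f g u v"
    using category.pullback_exists[OF op_category, of f A Z g B] assms
    by (auto simp: is_pushout_def has_finite_colimits_def)
  then have "u \<in> hom C A (Cod C u)" "v \<in> hom C B (Cod C u)" "u \<cdot> f = v \<cdot> g"
    using f g by (auto simp: is_pushout_iff in_hom)
  with uv show thesis by (rule that)
qed

lemma pushout_comm: "is_pushout C f g u v \<Longrightarrow> u \<cdot> f = v \<cdot> g"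
  by (simp add: is_pushout_iff)

lemma pushout_sym: "is_pushout C f g u v \<Longrightarrow> is_pushout C g f v u"
  by (simp add: is_pushout_iff) metis

lemma pushout_ex1:
  assumes po: "is_pushout C f g u v" and t: "u \<in> hom C A P" "v \<in> hom C B P"
    and xy: "x \<in> hom C A T" "y \<in> hom C B T" "x \<cdot> f = y \<cdot> g"
  shows "\<exists>!w. w \<in> hom C P T \<and> w \<cdot> u = x \<and> w \<cdot> v = y"
proof -
  have o: "Cod C u = P" "Cod C x = T" "x \<in> Arr C" "y \<in> Arr C" "Cod C x = Cod C y"
    "Dom C x = Cod C f" "Dom C y = Cod C g"
    using po t xy by (simp_all add: in_hom is_pushout_iff)
  have "\<forall>x \<in> Arr C. \<forall>y \<in> Arr C.
        Cod C x = Cod C y \<and> Dom C x = Cod C f \<and> Dom C y = Cod C g \<and> x \<cdot> f = y \<cdot> g \<longrightarrow>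
        (\<exists>!w. w \<in> hom C (Cod C u) (Cod C x) \<and> w \<cdot> u = x \<and> w \<cdot> v = y)"
    using po unfolding is_pushout_iff by blast
  from this[rule_format, of x y] show ?thesis using o xy(3) by simp
qed

lemma pushout_induced:
  assumes "is_pushout C f g u v" "u \<in> hom C A P" "v \<in> hom C B P"
    and "x \<in> hom C A T" "y \<in> hom C B T" "x \<cdot> f = y \<cdot> g"
  obtains w where "w \<in> hom C P T" "w \<cdot> u = x" "w \<cdot> v = y"
  using pushout_ex1[OF assms] that by blast

lemma pushout_ext:
  assumes po: "is_pushout C f g u v"
    and w: "w \<in> hom C P T" "w' \<in> hom C P T" and P: "u \<in> hom C A P"
    and eq: "w \<cdot> u = w' \<cdot> u" "w \<cdot> v = w' \<cdot> v"
  shows "w = w'"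
proof -
  have t: "f \<in> Arr C" "g \<in> Arr C" "Dom C f = Dom C g" "u \<in> Arr C" "v \<in> Arr C"
    "Cod C u = Cod C v" "Dom C u = Cod C f" "Dom C v = Cod C g" and uv: "u \<cdot> f = v \<cdot> g"
    and P': "Cod C u = P" "Cod C f = A"
    using po P by (auto simp: is_pushout_iff in_hom)
  have "w \<cdot> (u \<cdot> f) = w \<cdot> (v \<cdot> g)" by (simp add: uv)
  then have "(w \<cdot> u) \<cdot> f = (w \<cdot> v) \<cdot> g"
    using t w P' by (simp add: in_hom)
  then have "\<exists>!z. z \<in> hom C P T \<and> z \<cdot> u = w \<cdot> u \<and> z \<cdot> v = w \<cdot> v"
    by (intro pushout_ex1[OF po P, of "Cod C g"]) (use t w P' in \<open>auto simp: in_hom\<close>)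
  then show ?thesis using w eq by metis
qed

lemma pushoutI:
  assumes f: "f \<in> hom C Z A" and g: "g \<in> hom C Z B" and u: "u \<in> hom C A P" and v: "v \<in> hom C B P"
    and eq: "u \<cdot> f = v \<cdot> g"
    and ex: "\<And>T x y. x \<in> hom C A T \<Longrightarrow> y \<in> hom C B T \<Longrightarrow> x \<cdot> f = y \<cdot> g \<Longrightarrow>
      \<exists>w \<in> hom C P T. w \<cdot> u = x \<and> w \<cdot> v = y"
    and uniq: "\<And>T w w'. w \<in> hom C P T \<Longrightarrow> w' \<in> hom C P T \<Longrightarrow> w \<cdot> u = w' \<cdot> u \<Longrightarrow> w \<cdot> v = w' \<cdot> v \<Longrightarrow> w = w'"
  shows "is_pushout C f g u v"
proof -
  have "\<exists>!w. w \<in> hom C P (Cod C x) \<and> w \<cdot> u = x \<and> w \<cdot> v = y"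
    if "x \<in> Arr C" "y \<in> Arr C" "Cod C x = Cod C y" "Dom C x = A" "Dom C y = B" "x \<cdot> f = y \<cdot> g" for x y
    using ex[of x "Cod C x" y] uniq[of _ "Cod C x"] that by (metis in_hom)
  then show ?thesis
    using f g u v eq unfolding is_pushout_iff by (auto simp: in_hom)
qed

text \<open>Pasting: the left square is \<open>u \<cdot> f = v \<cdot> g\<close> and the right one is \<open>w \<cdot> v = x \<cdot> h\<close>.\<close>

lemma pushout_paste:
  assumes l: "is_pushout C f g u v" and r: "is_pushout C v h w x"
    and t: "f \<in> hom C Z A" "g \<in> hom C Z B" "u \<in> hom C A P" "v \<in> hom C B P"
      "h \<in> hom C B D" "w \<in> hom C P Q" "x \<in> hom C D Q"
  shows "is_pushout C f (h \<cdot> g) (w \<cdot> u) x"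
proof (rule pushoutI)
  note lc = pushout_comm[OF l] and rc = pushout_comm[OF r]
  show "(w \<cdot> u) \<cdot> f = x \<cdot> (h \<cdot> g)"
    using t lc comp_reassoc[OF rc t(4) t(6), of g] by (simp add: in_hom)
  fix T y z assume y: "y \<in> hom C A T" and z: "z \<in> hom C D T" and yz: "y \<cdot> f = z \<cdot> (h \<cdot> g)"
  obtain a where a: "a \<in> hom C P T" "a \<cdot> u = y" "a \<cdot> v = z \<cdot> h"
    using pushout_induced[OF l t(3,4) y, of "z \<cdot> h"] z yz t by (auto simp: in_hom)
  obtain b where b: "b \<in> hom C Q T" "b \<cdot> w = a" "b \<cdot> x = z"
    using pushout_induced[OF r t(6,7) a(1) z a(3)] by auto
  have "b \<cdot> (w \<cdot> u) = y"
    using comp_reassoc[OF b(2) t(6) b(1)] a t by (simp add: in_hom)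
  with b show "\<exists>b \<in> hom C Q T. b \<cdot> (w \<cdot> u) = y \<and> b \<cdot> x = z" by blast
next
  note rc = pushout_comm[OF r]
  fix T b b' assume b: "b \<in> hom C Q T" "b' \<in> hom C Q T"
    and eq: "b \<cdot> (w \<cdot> u) = b' \<cdot> (w \<cdot> u)" "b \<cdot> x = b' \<cdot> x"
  have "(b \<cdot> w) \<cdot> u = (b' \<cdot> w) \<cdot> u"
    using eq b t by (simp add: in_hom)
  moreover have "(b \<cdot> w) \<cdot> v = (b' \<cdot> w) \<cdot> v"
    using rc b t comp_reassoc[OF eq(2) t(7) b(1)] by (simp add: in_hom)
  ultimately have "b \<cdot> w = b' \<cdot> w"
    by (rule pushout_ext[OF l comp_hom[OF t(6) b(1)] comp_hom[OF t(6) b(2)] t(3)])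
  then show "b = b'"
    using pushout_ext[OF r b t(6)] eq by blast
qed (use t in \<open>auto simp: in_hom\<close>)

lemma pushout_cancel:
  assumes l: "is_pushout C f g u v" and o: "is_pushout C f (h \<cdot> g) (w \<cdot> u) x" and rc: "w \<cdot> v = x \<cdot> h"
    and t: "f \<in> hom C Z A" "g \<in> hom C Z B" "u \<in> hom C A P" "v \<in> hom C B P"
      "h \<in> hom C B D" "w \<in> hom C P Q" "x \<in> hom C D Q"
  shows "is_pushout C v h w x"
proof (rule pushoutI[OF t(4,5,6,7) rc])
  note lc = pushout_comm[OF l]
  fix T y z assume y: "y \<in> hom C P T" and z: "z \<in> hom C D T" and yz: "y \<cdot> v = z \<cdot> h"
  have "(y \<cdot> u) \<cdot> f = z \<cdot> (h \<cdot> g)"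
    using t y z lc comp_reassoc[OF yz t(4) y, of g] by (simp add: in_hom)
  then obtain b where b: "b \<in> hom C Q T" "b \<cdot> (w \<cdot> u) = y \<cdot> u" "b \<cdot> x = z"
    using pushout_induced[OF o, of A Q D "y \<cdot> u" T z] t y z by (auto simp: in_hom)
  have "b \<cdot> w = y"
  proof (rule pushout_ext[OF l _ y t(3)])
    show "(b \<cdot> w) \<cdot> u = y \<cdot> u" using b t by (simp add: in_hom)
    show "(b \<cdot> w) \<cdot> v = y \<cdot> v"
      using b(1) t rc yz comp_reassoc[OF b(3) t(7) b(1), of h] by (simp add: in_hom)
  qed (use b t in \<open>auto simp: in_hom\<close>)
  with b show "\<exists>b \<in> hom C Q T. b \<cdot> w = y \<and> b \<cdot> x = z" by blast
next
  fix T b b' assume b: "b \<in> hom C Q T" "b' \<in> hom C Q T"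
    and eq: "b \<cdot> w = b' \<cdot> w" "b \<cdot> x = b' \<cdot> x"
  have "b \<cdot> (w \<cdot> u) = b' \<cdot> (w \<cdot> u)"
    using comp_reassoc[OF eq(1) t(6) b(1), of u] t b by (simp add: in_hom)
  then show "b = b'"
    using pushout_ext[OF o b, of A] eq t by (auto simp: in_hom)
qed

lemma pullback_iff_op: "is_pullback C f g p q \<longleftrightarrow> is_pushout (op_category C) f g p q"
proof -
  have "op_category (op_category C) = \<lparr>Obj = Obj C, Arr = Arr C, Dom = Dom C, Cod = Cod C,
      Id = Id C, Comp = Comp C\<rparr>"
    by (simp add: op_category_def)
  then show ?thesis
    by (simp add: is_pushout_def is_pullback_def hom_def)
qed

lemma pullback_comm: "is_pullback C f g p q \<Longrightarrow> f \<cdot> p = g \<cdot> q"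
  by (simp add: is_pullback_def)

lemma pullback_induced:
  assumes "is_pullback C f g p q" "p \<in> hom C P A" "q \<in> hom C P B"
    and "x \<in> hom C T A" "y \<in> hom C T B" "f \<cdot> x = g \<cdot> y"
  obtains w where "w \<in> hom C T P" "p \<cdot> w = x" "q \<cdot> w = y"
  using category.pushout_induced[OF op_category, of f g p q A P B x T y] assms
  by (auto simp: pullback_iff_op)

lemma pullback_ext:
  assumes "is_pullback C f g p q" "w \<in> hom C T P" "w' \<in> hom C T P" "p \<in> hom C P A"
    and "p \<cdot> w = p \<cdot> w'" "q \<cdot> w = q \<cdot> w'"
  shows "w = w'"
  using category.pushout_ext[OF op_category, of f g p q w P T w' A] assms
  by (simp add: pullback_iff_op)

lemma productI:
  assumes p: "p \<in> hom C P A" and q: "q \<in> hom C P B"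
    and ex1: "\<And>T x y. x \<in> hom C T A \<Longrightarrow> y \<in> hom C T B \<Longrightarrow> \<exists>!u. u \<in> hom C T P \<and> p \<cdot> u = x \<and> q \<cdot> u = y"
  shows "is_product C p q"
proof -
  have "\<exists>!u. u \<in> hom C (Dom C x) P \<and> p \<cdot> u = x \<and> q \<cdot> u = y"
    if "x \<in> Arr C" "y \<in> Arr C" "Dom C x = Dom C y" "Cod C x = A" "Cod C y = B" for x y
    using ex1[of x "Dom C x" y] that by (metis in_hom)
  then show ?thesis
    using p q unfolding is_product_def by (auto simp: in_hom)
qed

lemma product_ex1:
  assumes pr: "is_product C p q" and t: "p \<in> hom C P A" "q \<in> hom C P B"
    and xy: "x \<in> hom C T A" "y \<in> hom C T B"
  shows "\<exists>!w. w \<in> hom C T P \<and> p \<cdot> w = x \<and> q \<cdot> w = y"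
proof -
  have "\<forall>x \<in> Arr C. \<forall>y \<in> Arr C. Dom C x = Dom C y \<and> Cod C x = Cod C p \<and> Cod C y = Cod C q \<longrightarrow>
        (\<exists>!w. w \<in> hom C (Dom C x) (Dom C p) \<and> p \<cdot> w = x \<and> q \<cdot> w = y)"
    using pr unfolding is_product_def by blast
  from this[rule_format, of x y] show ?thesis using t xy by (simp add: in_hom)
qed

lemma product_induced:
  assumes "is_product C p q" "p \<in> hom C P A" "q \<in> hom C P B" "x \<in> hom C T A" "y \<in> hom C T B"
  obtains w where "w \<in> hom C T P" "p \<cdot> w = x" "q \<cdot> w = y"
  using product_ex1[OF assms] that by blast

lemma product_ext:
  assumes pr: "is_product C p q" "p \<in> hom C P A" "q \<in> hom C P B"
    and w: "w \<in> hom C T P" "w' \<in> hom C T P" and eq: "p \<cdot> w = p \<cdot> w'" "q \<cdot> w = q \<cdot> w'"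
  shows "w = w'"
proof -
  have "\<exists>!z. z \<in> hom C T P \<and> p \<cdot> z = p \<cdot> w \<and> q \<cdot> z = q \<cdot> w"
    by (rule product_ex1[OF pr]) (use pr w in \<open>auto simp: in_hom\<close>)
  then show ?thesis using w eq by metis
qed

lemma product_sym: "is_product C p q \<Longrightarrow> is_product C q p"
  by (simp add: is_product_def) metis

lemma coproduct_induced:
  assumes "is_coproduct C p q" "p \<in> hom C A P" "q \<in> hom C B P" "x \<in> hom C A T" "y \<in> hom C B T"
  obtains w where "w \<in> hom C P T" "w \<cdot> p = x" "w \<cdot> q = y"
  using category.product_induced[OF op_category, of p q P A B x T y] assms
  by (auto simp: is_coproduct_def)

lemma coproduct_ext:
  assumes "is_coproduct C p q" "p \<in> hom C A P" "q \<in> hom C B P" "w \<in> hom C P T" "w' \<in> hom C P T"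
    and "w \<cdot> p = w' \<cdot> p" "w \<cdot> q = w' \<cdot> q"
  shows "w = w'"
  using category.product_ext[OF op_category, of p q P A B w T w'] assms
  by (auto simp: is_coproduct_def)

lemma coproductI:
  assumes p: "p \<in> hom C A P" and q: "q \<in> hom C B P"
    and ex: "\<And>T x y. x \<in> hom C A T \<Longrightarrow> y \<in> hom C B T \<Longrightarrow> \<exists>w \<in> hom C P T. w \<cdot> p = x \<and> w \<cdot> q = y"
    and uniq: "\<And>T w w'. w \<in> hom C P T \<Longrightarrow> w' \<in> hom C P T \<Longrightarrow> w \<cdot> p = w' \<cdot> p \<Longrightarrow> w \<cdot> q = w' \<cdot> q \<Longrightarrow> w = w'"
  shows "is_coproduct C p q"
proof -
  have "\<exists>!w. w \<in> hom C P (Cod C x) \<and> w \<cdot> p = x \<and> w \<cdot> q = y"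
    if "x \<in> Arr C" "y \<in> Arr C" "Cod C x = Cod C y" "Dom C x = A" "Dom C y = B" for x y
    using ex[of x "Cod C x" y] uniq[of _ "Cod C x"] that by (metis in_hom)
  then show ?thesis
    using p q unfolding is_coproduct_def is_product_def by (auto simp: in_hom)
qed

end

section \<open>Model categories with a zero object\<close>

context closed_model_category
begin

abbreviation tfib :: "'a set" where "tfib \<equiv> Fib M \<inter> Weq M"

abbreviation tcof :: "'a set" where "tcof \<equiv> Cof M \<inter> Weq M"

lemma pushout_obtain:
  assumes "f \<in> hom M Z A" "g \<in> hom M Z B"
  obtains P u v where "is_pushout M f g u v" "u \<in> hom M A P" "v \<in> hom M B P" "u \<cdot> f = v \<cdot> g"
  by (rule pushout_exists[OF finite_colimits assms])

lemma pullback_obtain: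
  assumes f: "f \<in> hom M A T" and g: "g \<in> hom M B T"
  obtains P p q where "is_pullback M f g p q" "p \<in> hom M P A" "q \<in> hom M P B" "f \<cdot> p = g \<cdot> q"
proof -
  obtain p q where pq: "is_pullback M f g p q"
    using pullback_exists[OF finite_limits assms] by blast
  then have "p \<in> hom M (Dom M p) A" "q \<in> hom M (Dom M p) B" "f \<cdot> p = g \<cdot> q"
    using f g by (auto simp: is_pullback_def in_hom)
  with pq show thesis by (rule that)
qed

lemma factor_cof_tfib:
  assumes "f \<in> hom M A B"
  obtains E i p where "i \<in> hom M A E" "i \<in> Cof M" "p \<in> hom M E B" "p \<in> tfib" "p \<cdot> i = f"
  using factorization(1)[OF assms] by blast

lemma factor_tcof_fib:
  assumes "f \<in> hom M A B"
  obtains E i p where "i \<in> hom M A E" "i \<in> tcof" "p \<in> hom M E B" "p \<in> Fib M" "p \<cdot> i = f"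
  using factorization(2)[OF assms] by blast

lemma lift_tfib:
  assumes "i \<in> hom M A B" "i \<in> Cof M" "p \<in> hom M E F" "p \<in> tfib"
    and "u \<in> hom M A E" "v \<in> hom M B F" "p \<cdot> u = v \<cdot> i"
  obtains l where "l \<in> hom M B E" "l \<cdot> i = u" "p \<cdot> l = v"
  using lifting(1)[of i p] assms by (auto simp: has_lifting_def in_hom)

lemma lift_tcof:
  assumes "i \<in> hom M A B" "i \<in> tcof" "p \<in> hom M E F" "p \<in> Fib M"
    and "u \<in> hom M A E" "v \<in> hom M B F" "p \<cdot> u = v \<cdot> i"
  obtains l where "l \<in> hom M B E" "l \<cdot> i = u" "p \<cdot> l = v"
  using lifting(2)[of i p] assms by (auto simp: has_lifting_def in_hom)

text \<open>The retract argument: an arrow that lifts against the second factor of one of its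
  factorizations is a retract of the first factor, and dually.\<close>

lemma retract_of_first_factor:
  assumes j: "j \<in> hom M A E" and p: "p \<in> hom M E B" "p \<cdot> j = i"
    and lift: "\<And>u v. u \<in> hom M A E \<Longrightarrow> v \<in> hom M B B \<Longrightarrow> p \<cdot> u = v \<cdot> i \<Longrightarrow>
      \<exists>l \<in> hom M B E. l \<cdot> i = u \<and> p \<cdot> l = v"
  shows "is_retract M i j"
proof -
  have i: "i \<in> hom M A B" using comp_hom[OF j p(1)] p(2) by simp
  have "p \<cdot> j = Id M B \<cdot> i" unfolding p(2) using i by (simp add: in_hom)
  then obtain l where l: "l \<in> hom M B E" "l \<cdot> i = j" "p \<cdot> l = Id M B"
    using lift[OF j id_hom] hom_objs[OF i] by blast
  show ?thesis
    unfolding is_retract_def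
  proof (intro conjI exI)
    show "Id M A \<in> hom M (Dom M i) (Dom M j)" "Id M A \<in> hom M (Dom M j) (Dom M i)"
      "l \<in> hom M (Cod M i) (Cod M j)" "p \<in> hom M (Cod M j) (Cod M i)"
      using i j p(1) l(1) hom_objs[OF j] by (auto simp: in_hom)
  qed (use i j l(2,3) p(2) hom_objs[OF i] in \<open>simp_all add: in_hom\<close>)
qed

lemma retract_of_second_factor:
  assumes j: "j \<in> hom M A E" and q: "q \<in> hom M E B" "q \<cdot> j = p"
    and lift: "\<And>u v. u \<in> hom M A A \<Longrightarrow> v \<in> hom M E B \<Longrightarrow> p \<cdot> u = v \<cdot> j \<Longrightarrow>
      \<exists>l \<in> hom M E A. l \<cdot> j = u \<and> p \<cdot> l = v"
  shows "is_retract M p q"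
proof -
  have p: "p \<in> hom M A B" using comp_hom[OF j q(1)] q(2) by simp
  have "p \<cdot> Id M A = q \<cdot> j" unfolding q(2) using p by (simp add: in_hom)
  then obtain l where l: "l \<in> hom M E A" "l \<cdot> j = Id M A" "p \<cdot> l = q"
    using lift[OF id_hom q(1)] hom_objs[OF p] by blast
  show ?thesis
    unfolding is_retract_def
  proof (intro conjI exI)
    show "Id M B \<in> hom M (Cod M p) (Cod M q)" "Id M B \<in> hom M (Cod M q) (Cod M p)"
      "j \<in> hom M (Dom M p) (Dom M q)" "l \<in> hom M (Dom M q) (Dom M p)"
      using p q(1) j l(1) hom_objs[OF p] by (auto simp: in_hom)
  qed (use p q j l(2,3) hom_objs[OF p] in \<open>simp_all add: in_hom\<close>)
qed

lemma cofI:
  assumes i: "i \<in> hom M A B"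
    and lift: "\<And>E F p u v. p \<in> hom M E F \<Longrightarrow> p \<in> tfib \<Longrightarrow> u \<in> hom M A E \<Longrightarrow> v \<in> hom M B F \<Longrightarrow>
      p \<cdot> u = v \<cdot> i \<Longrightarrow> \<exists>l \<in> hom M B E. l \<cdot> i = u \<and> p \<cdot> l = v"
  shows "i \<in> Cof M"
proof -
  obtain E j p where f: "j \<in> hom M A E" "j \<in> Cof M" "p \<in> hom M E B" "p \<in> tfib" "p \<cdot> j = i"
    using factor_cof_tfib[OF i] .
  show ?thesis
    using retract_closed(2,3)[OF retract_of_first_factor[OF f(1,3,5) lift[OF f(3,4)]]] f(2) by blast
qed

lemma tcofI:
  assumes i: "i \<in> hom M A B"
    and lift: "\<And>E F p u v. p \<in> hom M E F \<Longrightarrow> p \<in> Fib M \<Longrightarrow> u \<in> hom M A E \<Longrightarrow> v \<in> hom M B F \<Longrightarrow>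
      p \<cdot> u = v \<cdot> i \<Longrightarrow> \<exists>l \<in> hom M B E. l \<cdot> i = u \<and> p \<cdot> l = v"
  shows "i \<in> tcof"
proof -
  obtain E j p where f: "j \<in> hom M A E" "j \<in> tcof" "p \<in> hom M E B" "p \<in> Fib M" "p \<cdot> j = i"
    using factor_tcof_fib[OF i] .
  show ?thesis
    using retract_closed(2,3)[OF retract_of_first_factor[OF f(1,3,5) lift[OF f(3,4)]]] f(2) by blast
qed

lemma fibI:
  assumes p: "p \<in> hom M A B"
    and lift: "\<And>E F i u v. i \<in> hom M E F \<Longrightarrow> i \<in> tcof \<Longrightarrow> u \<in> hom M E A \<Longrightarrow> v \<in> hom M F B \<Longrightarrow>
      p \<cdot> u = v \<cdot> i \<Longrightarrow> \<exists>l \<in> hom M F A. l \<cdot> i = u \<and> p \<cdot> l = v"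
  shows "p \<in> Fib M"
proof -
  obtain E j q where f: "j \<in> hom M A E" "j \<in> tcof" "q \<in> hom M E B" "q \<in> Fib M" "q \<cdot> j = p"
    using factor_tcof_fib[OF p] .
  show ?thesis
    using retract_closed(1,3)[OF retract_of_second_factor[OF f(1,3,5) lift[OF f(1,2)]]] f(4) by blast
qed

lemma tfibI:
  assumes p: "p \<in> hom M A B"
    and lift: "\<And>E F i u v. i \<in> hom M E F \<Longrightarrow> i \<in> Cof M \<Longrightarrow> u \<in> hom M E A \<Longrightarrow> v \<in> hom M F B \<Longrightarrow>
      p \<cdot> u = v \<cdot> i \<Longrightarrow> \<exists>l \<in> hom M F A. l \<cdot> i = u \<and> p \<cdot> l = v"
  shows "p \<in> tfib"
proof -
  obtain E j q where f: "j \<in> hom M A E" "j \<in> Cof M" "q \<in> hom M E B" "q \<in> tfib" "q \<cdot> j = p"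
    using factor_cof_tfib[OF p] .
  show ?thesis
    using retract_closed(1,3)[OF retract_of_second_factor[OF f(1,3,5) lift[OF f(1,2)]]] f(4) by blast
qed

lemma id_tcof: "A \<in> Obj M \<Longrightarrow> Id M A \<in> tcof"
  by (rule tcofI[OF id_hom]) (auto simp: in_hom)

lemma id_tfib: "A \<in> Obj M \<Longrightarrow> Id M A \<in> tfib"
  by (rule tfibI[OF id_hom]) (auto simp: in_hom)

lemma cof_comp:
  assumes "i \<in> hom M A B" "j \<in> hom M B D" "i \<in> Cof M" "j \<in> Cof M"
  shows "j \<cdot> i \<in> Cof M"
proof (rule cofI[OF comp_hom[OF assms(1,2)]])
  fix E F p u v assume p: "p \<in> hom M E F" "p \<in> tfib" and u: "u \<in> hom M A E" and v: "v \<in> hom M D F"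
    and eq: "p \<cdot> u = v \<cdot> (j \<cdot> i)"
  obtain l where l: "l \<in> hom M B E" "l \<cdot> i = u" "p \<cdot> l = v \<cdot> j"
    using lift_tfib[OF assms(1,3) p u comp_hom[OF assms(2) v]] eq assms(1,2) v
    by (auto simp: in_hom)
  obtain k where k: "k \<in> hom M D E" "k \<cdot> j = l" "p \<cdot> k = v"
    using lift_tfib[OF assms(2,4) p l(1) v l(3)] .
  have "k \<cdot> (j \<cdot> i) = u"
    using comp_reassoc[OF k(2) assms(2) k(1), of i] assms l by (simp add: in_hom)
  with k show "\<exists>k \<in> hom M D E. k \<cdot> (j \<cdot> i) = u \<and> p \<cdot> k = v" by blast
qed

lemma fib_comp:
  assumes "q \<in> hom M A B" "p \<in> hom M B D" "q \<in> Fib M" "p \<in> Fib M"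
  shows "p \<cdot> q \<in> Fib M"
proof (rule fibI[OF comp_hom[OF assms(1,2)]])
  fix E F i u v assume i: "i \<in> hom M E F" "i \<in> tcof" and u: "u \<in> hom M E A" and v: "v \<in> hom M F D"
    and eq: "(p \<cdot> q) \<cdot> u = v \<cdot> i"
  obtain l where l: "l \<in> hom M F B" "l \<cdot> i = q \<cdot> u" "p \<cdot> l = v"
    using lift_tcof[OF i assms(2,4) comp_hom[OF u assms(1)] v] eq assms(1,2) u
    by (auto simp: in_hom)
  obtain k where k: "k \<in> hom M F A" "k \<cdot> i = u" "q \<cdot> k = l"
    using lift_tcof[OF i assms(1,3) u l(1) l(2)[symmetric]] .
  have "(p \<cdot> q) \<cdot> k = v"
    using k l assms by (simp add: in_hom)
  with k show "\<exists>k \<in> hom M F A. k \<cdot> i = u \<and> (p \<cdot> q) \<cdot> k = v" by blast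
qed

lemma tfib_comp:
  assumes "q \<in> hom M A B" "p \<in> hom M B D" "q \<in> tfib" "p \<in> tfib"
  shows "p \<cdot> q \<in> tfib"
  using fib_comp[of q A B p D] two_of_three(1)[of q A B p D] assms by blast

lemma iso_tfib:
  assumes t: "\<theta> \<in> hom M A B" and e: "\<eta> \<in> hom M B A" and 1: "\<theta> \<cdot> \<eta> = Id M B" and 2: "\<eta> \<cdot> \<theta> = Id M A"
  shows "\<theta> \<in> tfib"
proof (rule tfibI[OF t])
  fix E F i u v assume i: "i \<in> hom M E F" and u: "u \<in> hom M E A" and v: "v \<in> hom M F B" and eq: "\<theta> \<cdot> u = v \<cdot> i"
  have "(\<eta> \<cdot> v) \<cdot> i = u"
    using comp_assoc[OF i v e] comp_assoc[OF u t e] id_comp[OF u] eq 2 by simp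
  moreover have "\<theta> \<cdot> (\<eta> \<cdot> v) = v"
    using comp_assoc[OF v e t] id_comp[OF v] 1 by simp
  ultimately show "\<exists>l \<in> hom M F A. l \<cdot> i = u \<and> \<theta> \<cdot> l = v"
    using comp_hom[OF v e] by blast
qed

text \<open>The first arrow of the span or cospan carries the property in question, and the arrow opposite to
  it inherits it.\<close>

lemma pushout_lift:
  assumes po: "is_pushout M f g u v"
    and t: "f \<in> hom M Z A" "g \<in> hom M Z B" "u \<in> hom M A P" "v \<in> hom M B P"
    and p: "p \<in> hom M E F" "has_lifting M f p"
    and x: "x \<in> hom M B E" and y: "y \<in> hom M P F" and eq: "p \<cdot> x = y \<cdot> v"
  shows "\<exists>k \<in> hom M P E. k \<cdot> v = x \<and> p \<cdot> k = y"
proof -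
  have "p \<cdot> (x \<cdot> g) = (y \<cdot> u) \<cdot> f"
    using comp_reassoc[OF eq x p(1), of g] pushout_comm[OF po] t y by (simp add: in_hom)
  then obtain l where l: "l \<in> hom M A E" "l \<cdot> f = x \<cdot> g" "p \<cdot> l = y \<cdot> u"
    using p comp_hom[OF t(2) x] comp_hom[OF t(3) y] t(1) unfolding has_lifting_def in_hom by metis
  obtain k where k: "k \<in> hom M P E" "k \<cdot> u = l" "k \<cdot> v = x"
    using pushout_induced[OF po t(3,4) l(1) x l(2)] .
  have "p \<cdot> k = y"
    by (rule pushout_ext[OF po comp_hom[OF k(1) p(1)] y t(3)]) (use k l p t eq in \<open>auto simp: in_hom\<close>)
  with k show ?thesis by blast
qed

lemma cof_pushout:
  assumes po: "is_pushout M f g u v"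
    and t: "f \<in> hom M Z A" "g \<in> hom M Z B" "u \<in> hom M A P" "v \<in> hom M B P" and f: "f \<in> Cof M"
  shows "v \<in> Cof M"
  by (rule cofI[OF t(4)], rule pushout_lift[OF po t _ lifting(1)[OF f]])

lemma tcof_pushout:
  assumes po: "is_pushout M f g u v"
    and t: "f \<in> hom M Z A" "g \<in> hom M Z B" "u \<in> hom M A P" "v \<in> hom M B P" and f: "f \<in> tcof"
  shows "v \<in> tcof"
  by (rule tcofI[OF t(4)], rule pushout_lift[OF po t _ lifting(2)[OF f]])

lemma tfib_pullback:
  assumes pb: "is_pullback M f g p q"
    and t: "f \<in> hom M A T" "g \<in> hom M B T" "p \<in> hom M P A" "q \<in> hom M P B" and f: "f \<in> tfib"
  shows "q \<in> tfib"
proof (rule tfibI[OF t(4)])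
  fix E F i x y assume i: "i \<in> hom M E F" "i \<in> Cof M" and x: "x \<in> hom M E P" and y: "y \<in> hom M F B"
    and eq: "q \<cdot> x = y \<cdot> i"
  have "f \<cdot> (p \<cdot> x) = (g \<cdot> y) \<cdot> i"
    using comp_reassoc[OF pullback_comm[OF pb] t(3,1), of x] eq t x y i by (simp add: in_hom)
  then obtain l where l: "l \<in> hom M F A" "l \<cdot> i = p \<cdot> x" "f \<cdot> l = g \<cdot> y"
    using lift_tfib[OF i t(1) f comp_hom[OF x t(3)] comp_hom[OF y t(2)]] by blast
  obtain k where k: "k \<in> hom M F P" "p \<cdot> k = l" "q \<cdot> k = y"
    using pullback_induced[OF pb t(3,4) l(1) y l(3)] .
  have "k \<cdot> i = x"
  proof (rule pullback_ext[OF pb comp_hom[OF i(1) k(1)] x t(3)])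
    show "p \<cdot> (k \<cdot> i) = p \<cdot> x"
      using comp_reassoc[OF k(2) k(1) t(3), of i] i l by (simp add: in_hom)
    show "q \<cdot> (k \<cdot> i) = q \<cdot> x"
      using comp_reassoc[OF k(3) k(1) t(4), of i] i eq by (simp add: in_hom)
  qed
  with k show "\<exists>k \<in> hom M F P. k \<cdot> i = x \<and> q \<cdot> k = y" by blast
qed

lemma weq_section:
  assumes "s \<in> hom M A B" "r \<in> hom M B A" "r \<cdot> s = Id M A"
  shows "s \<in> Weq M \<longleftrightarrow> r \<in> Weq M"
  using two_of_three(2)[OF assms(1,2)] two_of_three(3)[OF assms(1,2)] id_tcof[of A]
    hom_objs[OF assms(1)] assms(3) by auto

end

locale pointed_model_category = closed_model_category M
  for M :: "('o, 'a) model_category" (structure) +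
  fixes pt :: 'o
  assumes is_zero_pt: "is_zero M pt"
begin

definition zmap :: "'o \<Rightarrow> 'o \<Rightarrow> 'a" where
  "zmap A B = (THE f. f \<in> hom M pt B) \<cdot> (THE f. f \<in> hom M A pt)"

lemma pt_obj [simp]: "pt \<in> Obj M"
  using is_zero_pt by (simp add: is_zero_def is_terminal_def)

lemma to_pt: "A \<in> Obj M \<Longrightarrow> \<exists>!f. f \<in> hom M A pt"
  using is_zero_pt by (simp add: is_zero_def is_terminal_def)

lemma from_pt: "A \<in> Obj M \<Longrightarrow> \<exists>!f. f \<in> hom M pt A"
  using is_zero_pt by (simp add: is_zero_def is_initial_def is_terminal_def)

lemma zmap_hom: "A \<in> Obj M \<Longrightarrow> B \<in> Obj M \<Longrightarrow> zmap A B \<in> hom M A B"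
  unfolding zmap_def by (rule comp_hom[OF theI'[OF to_pt] theI'[OF from_pt]])

lemma zmap_typing [simp]:
  assumes "A \<in> Obj M" "B \<in> Obj M"
  shows "zmap A B \<in> Arr M" "Dom M (zmap A B) = A" "Cod M (zmap A B) = B"
  using zmap_hom[OF assms] by (auto simp: in_hom)

lemma zmap_pt_unique:
  "f \<in> hom M A pt \<Longrightarrow> g \<in> hom M A pt \<Longrightarrow> f = g"
  "f \<in> hom M pt A \<Longrightarrow> g \<in> hom M pt A \<Longrightarrow> f = g"
  using to_pt from_pt hom_objs by (metis, metis)

lemma comp_zmap [simp]:
  assumes "g \<in> Arr M" "Dom M g = B" "A \<in> Obj M"
  shows "g \<cdot> zmap A B = zmap A (Cod M g)"
proof -
  let ?f = "THE f. f \<in> hom M pt B" and ?t = "THE f. f \<in> hom M A pt"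
  have B: "B \<in> Obj M" using assms dom_obj by auto
  have t: "?f \<in> hom M pt B" "?t \<in> hom M A pt" "g \<in> hom M B (Cod M g)"
    using theI'[OF from_pt[OF B]] theI'[OF to_pt[OF assms(3)]] assms by (auto simp: in_hom)
  have "g \<cdot> ?f = (THE f. f \<in> hom M pt (Cod M g))"
    using zmap_pt_unique(2) comp_hom[OF t(1,3)] theI'[OF from_pt[of "Cod M g"]] assms cod_obj by blast
  then show ?thesis
    unfolding zmap_def using comp_assoc[OF t(2,1,3)] by simp
qed

lemma zmap_comp [simp]:
  assumes "f \<in> Arr M" "Cod M f = A" "B \<in> Obj M"
  shows "zmap A B \<cdot> f = zmap (Dom M f) B"
proof -
  let ?f = "THE f. f \<in> hom M pt B" and ?t = "THE f. f \<in> hom M A pt"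
  have A: "A \<in> Obj M" using assms cod_obj by auto
  have t: "?f \<in> hom M pt B" "?t \<in> hom M A pt" "f \<in> hom M (Dom M f) A"
    using theI'[OF from_pt[OF assms(3)]] theI'[OF to_pt[OF A]] assms by (auto simp: in_hom)
  have "?t \<cdot> f = (THE g. g \<in> hom M (Dom M f) pt)"
    using zmap_pt_unique(1) comp_hom[OF t(3,2)] theI'[OF to_pt[of "Dom M f"]] assms dom_obj by blast
  then show ?thesis
    unfolding zmap_def using comp_assoc[OF t(3,2,1)] by simp
qed

lemma eq_zmap:
  "f \<in> hom M A pt \<Longrightarrow> f = zmap A pt"
  "f \<in> hom M pt A \<Longrightarrow> f = zmap pt A"
  using zmap_pt_unique zmap_hom hom_objs by (metis, metis)

lemma cofibrant_iff: "cofibrant M A \<longleftrightarrow> A \<in> Obj M \<and> zmap pt A \<in> Cof M"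
proof
  assume "cofibrant M A"
  then obtain f where f: "f \<in> Cof M" "is_initial M (Dom M f)" "Cod M f = A"
    by (auto simp: cofibrant_def)
  let ?I = "Dom M f"
  have fh: "f \<in> hom M ?I A" using f classes_arr by (auto simp: in_hom)
  have o: "?I \<in> Obj M" "A \<in> Obj M" using hom_objs[OF fh] .
  have ini: "x = y" if "x \<in> hom M ?I B" "y \<in> hom M ?I B" for x y B
    using f(2) that hom_objs[OF that(1)] unfolding is_initial_def is_terminal_def by auto
  have "zmap pt A \<in> Cof M"
  proof (rule cofI[OF zmap_hom[OF pt_obj o(2)]])
    fix E F p u v assume p: "p \<in> hom M E F" "p \<in> tfib" and u: "u \<in> hom M pt E" and v: "v \<in> hom M A F"
    have E: "E \<in> Obj M" using hom_objs[OF p(1)] by simp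
    have "p \<cdot> zmap ?I E = v \<cdot> f"
      by (rule ini[OF comp_hom[OF zmap_hom[OF o(1) E] p(1)] comp_hom[OF fh v]])
    then obtain l where "l \<in> hom M A E" "p \<cdot> l = v"
      using lift_tfib[OF fh f(1) p zmap_hom[OF o(1) E] v] by blast
    then show "\<exists>l \<in> hom M A E. l \<cdot> zmap pt A = u \<and> p \<cdot> l = v"
      using zmap_pt_unique(2)[OF u zmap_hom[OF pt_obj E]] by (auto simp: in_hom)
  qed
  with o show "A \<in> Obj M \<and> zmap pt A \<in> Cof M" by simp
next
  assume "A \<in> Obj M \<and> zmap pt A \<in> Cof M"
  then show "cofibrant M A"
    using is_zero_pt by (auto simp: cofibrant_def is_zero_def intro!: bexI[of _ "zmap pt A"])
qed

lemma fibrant_iff: "fibrant M A \<longleftrightarrow> A \<in> Obj M \<and> zmap A pt \<in> Fib M"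
proof
  assume "fibrant M A"
  then obtain f where f: "f \<in> Fib M" "is_terminal M (Cod M f)" "Dom M f = A"
    by (auto simp: fibrant_def)
  let ?I = "Cod M f"
  have fh: "f \<in> hom M A ?I" using f classes_arr by (auto simp: in_hom)
  have o: "?I \<in> Obj M" "A \<in> Obj M" using hom_objs[OF fh] by auto
  have ter: "x = y" if "x \<in> hom M B ?I" "y \<in> hom M B ?I" for x y B
    using f(2) that hom_objs[OF that(1)] unfolding is_terminal_def by auto
  have "zmap A pt \<in> Fib M"
  proof (rule fibI[OF zmap_hom[OF o(2) pt_obj]])
    fix E F i u v assume i: "i \<in> hom M E F" "i \<in> tcof" and u: "u \<in> hom M E A" and v: "v \<in> hom M F pt"
    have F: "F \<in> Obj M" using hom_objs[OF i(1)] by simp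
    have "f \<cdot> u = zmap F ?I \<cdot> i"
      by (rule ter[OF comp_hom[OF u fh] comp_hom[OF i(1) zmap_hom[OF F o(1)]]])
    then obtain l where "l \<in> hom M F A" "l \<cdot> i = u"
      using lift_tcof[OF i fh f(1) u zmap_hom[OF F o(1)]] by blast
    then show "\<exists>l \<in> hom M F A. l \<cdot> i = u \<and> zmap A pt \<cdot> l = v"
      using zmap_pt_unique(1)[OF v zmap_hom[OF F pt_obj]] by (auto simp: in_hom)
  qed
  with o show "A \<in> Obj M \<and> zmap A pt \<in> Fib M" by simp
next
  assume "A \<in> Obj M \<and> zmap A pt \<in> Fib M"
  then show "fibrant M A"
    using is_zero_pt by (auto simp: fibrant_def is_zero_def intro!: bexI[of _ "zmap A pt"])
qed

lemma contractible_tcof: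
  assumes "cofibrant M L" "zmap L pt \<in> Weq M"
  shows "zmap pt L \<in> tcof"
proof -
  have L: "L \<in> Obj M" "zmap pt L \<in> Cof M" using assms(1) by (auto simp: cofibrant_iff)
  note z = zmap_hom[OF pt_obj L(1)] zmap_hom[OF L(1) pt_obj]
  show ?thesis
    using weq_section[OF z zmap_pt_unique(1)[OF comp_hom[OF z] id_hom[OF pt_obj]]] assms(2) L(2) by simp
qed

lemma cofibrant_cof:
  assumes "i \<in> hom M A B" "i \<in> Cof M" "cofibrant M A"
  shows "cofibrant M B"
  using cof_comp[OF zmap_hom assms(1), of pt] assms hom_objs[OF assms(1)]
  by (auto simp: cofibrant_iff in_hom)

lemma fibrant_fib:
  assumes "p \<in> hom M A B" "p \<in> Fib M" "fibrant M B"
  shows "fibrant M A"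
  using fib_comp[OF assms(1) zmap_hom, of pt] assms hom_objs[OF assms(1)]
  by (auto simp: fibrant_iff in_hom)

lemma cofibrant_lift:
  assumes "cofibrant M A" and p: "p \<in> hom M E F" "p \<in> tfib" and v: "v \<in> hom M A F"
  obtains l where "l \<in> hom M A E" "p \<cdot> l = v"
proof -
  have o: "A \<in> Obj M" "E \<in> Obj M" "zmap pt A \<in> Cof M"
    using assms hom_objs[OF p(1)] by (auto simp: cofibrant_iff)
  have "p \<cdot> zmap pt E = v \<cdot> zmap pt A"
    using p v o by (simp add: in_hom)
  then show thesis
    using lift_tfib[OF zmap_hom[OF pt_obj o(1)] o(3) p zmap_hom[OF pt_obj o(2)] v] that by metis
qed

lemma fibrant_extend:
  assumes "fibrant M E" and i: "i \<in> hom M A B" "i \<in> tcof" and u: "u \<in> hom M A E"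
  obtains l where "l \<in> hom M B E" "l \<cdot> i = u"
proof -
  have o: "E \<in> Obj M" "B \<in> Obj M" "zmap E pt \<in> Fib M"
    using assms hom_objs[OF i(1)] by (auto simp: fibrant_iff)
  have "zmap E pt \<cdot> u = zmap B pt \<cdot> i"
    using i u o by (simp add: in_hom)
  then show thesis
    using lift_tcof[OF i zmap_hom[OF o(1) pt_obj] o(3) u zmap_hom[OF o(2) pt_obj]] that by metis
qed

section \<open>Cylinders and homotopies\<close>

lemma pushout_pt_coproduct:
  assumes po: "is_pushout M (zmap pt A) (zmap pt B) p q"
    and t: "p \<in> hom M A P" "q \<in> hom M B P"
  shows "is_coproduct M p q"
proof (rule coproductI[OF t])
  fix T x y assume x: "x \<in> hom M A T" and y: "y \<in> hom M B T"
  then have "x \<cdot> zmap pt A = y \<cdot> zmap pt B" by (simp add: in_hom)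
  then show "\<exists>w \<in> hom M P T. w \<cdot> p = x \<and> w \<cdot> q = y"
    using pushout_induced[OF po t x y] by blast
next
  fix T w w' assume "w \<in> hom M P T" "w' \<in> hom M P T" "w \<cdot> p = w' \<cdot> p" "w \<cdot> q = w' \<cdot> q"
  then show "w = w'" using pushout_ext[OF po _ _ t(1)] by blast
qed

lemma coproduct_obtain:
  assumes "A \<in> Obj M" "B \<in> Obj M"
  obtains P p q where "is_pushout M (zmap pt A) (zmap pt B) p q" "is_coproduct M p q"
    "p \<in> hom M A P" "q \<in> hom M B P"
proof -
  obtain P p q where "is_pushout M (zmap pt A) (zmap pt B) p q" "p \<in> hom M A P" "q \<in> hom M B P"
    using pushout_obtain[OF zmap_hom zmap_hom] assms pt_obj by metis
  with pushout_pt_coproduct that show thesis by blast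
qed

lemma coproduct_cof:
  assumes "is_pushout M (zmap pt A) (zmap pt B) p q" "p \<in> hom M A P" "q \<in> hom M B P"
  shows "cofibrant M A \<Longrightarrow> q \<in> Cof M" "cofibrant M B \<Longrightarrow> p \<in> Cof M"
  using cof_pushout[OF assms(1) zmap_hom zmap_hom assms(2,3)]
    cof_pushout[OF pushout_sym[OF assms(1)] zmap_hom zmap_hom assms(3,2)] assms hom_objs
  by (auto simp: cofibrant_iff)

lemma cylinder_exists:
  assumes A: "A \<in> Obj M"
  obtains i0 i1 c where "is_cylinder M A i0 i1 c"
proof -
  obtain P j0 j1 where j: "is_coproduct M j0 j1" "j0 \<in> hom M A P" "j1 \<in> hom M A P"
    using coproduct_obtain[OF A A] by metis
  obtain w where w: "w \<in> hom M P A" "w \<cdot> j0 = Id M A" "w \<cdot> j1 = Id M A"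
    using coproduct_induced[OF j id_hom id_hom] A by metis
  obtain E c p where f: "c \<in> hom M P E" "c \<in> Cof M" "p \<in> hom M E A" "p \<in> tfib" "p \<cdot> c = w"
    using factor_cof_tfib[OF w(1)] .
  have "p \<cdot> (c \<cdot> j0) = Id M A" "p \<cdot> (c \<cdot> j1) = Id M A"
    using comp_assoc[OF j(2) f(1,3)] comp_assoc[OF j(3) f(1,3)] w f(5) by simp_all
  then have "is_cylinder M A (c \<cdot> j0) (c \<cdot> j1) p"
    unfolding is_cylinder_def
    using j f(1-4) by (intro exI[of _ j0] exI[of _ j1] exI[of _ c]) (simp add: in_hom)
  then show thesis by (rule that)
qed

lemma cylinder_typing:
  assumes "is_cylinder M A i0 i1 c"
  shows "i0 \<in> hom M A (Dom M c)" "i1 \<in> hom M A (Dom M c)" "c \<in> hom M (Dom M c) A" "c \<in> tfib"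
    "c \<cdot> i0 = Id M A" "c \<cdot> i1 = Id M A"
proof -
  obtain j0 j1 b where b: "is_coproduct M j0 j1" "Dom M j0 = A" "Dom M j1 = A"
    "b \<in> hom M (Cod M j0) (Dom M c)" "b \<cdot> j0 = i0" "b \<cdot> j1 = i1" "c \<in> tfib" "Cod M c = A"
    "c \<cdot> i0 = Id M A" "c \<cdot> i1 = Id M A"
    using assms unfolding is_cylinder_def by auto
  then have "j0 \<in> hom M A (Cod M j0)" "j1 \<in> hom M A (Cod M j0)"
    by (auto simp: is_coproduct_def is_product_def in_hom)
  then show "i0 \<in> hom M A (Dom M c)" "i1 \<in> hom M A (Dom M c)"
    using b comp_hom by metis+
  show "c \<in> hom M (Dom M c) A" using b classes_arr by (auto simp: in_hom)
qed (use assms in \<open>auto simp: is_cylinder_def\<close>)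

lemma cylinder_lift:
  assumes cyl: "is_cylinder M A i0 i1 c" and p: "p \<in> hom M E F" "p \<in> tfib"
    and x: "x0 \<in> hom M A E" "x1 \<in> hom M A E" and v: "v \<in> hom M (Dom M c) F"
    and eq: "p \<cdot> x0 = v \<cdot> i0" "p \<cdot> x1 = v \<cdot> i1"
  obtains l where "l \<in> hom M (Dom M c) E" "l \<cdot> i0 = x0" "l \<cdot> i1 = x1" "p \<cdot> l = v"
proof -
  obtain j0 j1 b where b: "is_coproduct M j0 j1" "Dom M j0 = A" "Dom M j1 = A"
    "b \<in> hom M (Cod M j0) (Dom M c)" "b \<in> Cof M" "b \<cdot> j0 = i0" "b \<cdot> j1 = i1"
    using cyl unfolding is_cylinder_def by auto
  then have j: "j0 \<in> hom M A (Cod M j0)" "j1 \<in> hom M A (Cod M j0)"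
    by (auto simp: is_coproduct_def is_product_def in_hom)
  obtain w where w: "w \<in> hom M (Cod M j0) E" "w \<cdot> j0 = x0" "w \<cdot> j1 = x1"
    using coproduct_induced[OF b(1) j x] .
  have "p \<cdot> w = v \<cdot> b"
  proof (rule coproduct_ext[OF b(1) j comp_hom[OF w(1) p(1)] comp_hom[OF b(4) v]])
    show "(p \<cdot> w) \<cdot> j0 = (v \<cdot> b) \<cdot> j0" "(p \<cdot> w) \<cdot> j1 = (v \<cdot> b) \<cdot> j1"
      using j w b eq p v by (simp_all add: in_hom)
  qed
  then obtain l where l: "l \<in> hom M (Dom M c) E" "l \<cdot> b = w" "p \<cdot> l = v"
    using lift_tfib[OF b(4,5) p w(1) v] by metis
  have "l \<cdot> i0 = x0" "l \<cdot> i1 = x1"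
    using comp_reassoc[OF l(2) b(4) l(1), of j0] comp_reassoc[OF l(2) b(4) l(1), of j1] j w b
    by (simp_all add: in_hom)
  with l that show thesis by blast
qed

lemma is_homotopyI:
  assumes "is_cylinder M A i0 i1 c" and "h \<in> hom M (Dom M c) B"
    and "f \<in> hom M A B" "g \<in> hom M A B" "h \<cdot> i0 = f" "h \<cdot> i1 = g"
  shows "is_homotopy M \<lparr>end0 = i0, end1 = i1, proj = c, hmap = h\<rparr> f g"
  using assms by (auto simp: is_homotopy_def in_hom)

abbreviation const_homotopy :: "'a \<Rightarrow> 'a \<Rightarrow> 'a \<Rightarrow> 'a \<Rightarrow> 'a homotopy" where
  "const_homotopy i0 i1 c f \<equiv> \<lparr>end0 = i0, end1 = i1, proj = c, hmap = f \<cdot> c\<rparr>"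

lemma const_homotopy:
  assumes cyl: "is_cylinder M A i0 i1 c" and f: "f \<in> hom M A B"
  shows "is_homotopy M (const_homotopy i0 i1 c f) f f"
  by (rule is_homotopyI[OF cyl comp_hom[OF cylinder_typing(3)[OF cyl] f] f f])
    (use cylinder_typing[OF cyl] f in \<open>simp_all add: in_hom\<close>)

lemma homotopic_refl: "f \<in> hom M A B \<Longrightarrow> homotopic M f f"
  unfolding homotopic_def using const_homotopy cylinder_exists hom_objs by metis

lemma homotopic_lifts:
  assumes p: "p \<in> hom M E F" "p \<in> tfib" and x: "x0 \<in> hom M A E" "x1 \<in> hom M A E" and eq: "p \<cdot> x0 = p \<cdot> x1"
  shows "homotopic M x0 x1"
proof -
  obtain i0 i1 c where cyl: "is_cylinder M A i0 i1 c"
    using cylinder_exists hom_objs(1)[OF x(1)] by blast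
  note c = cylinder_typing[OF cyl]
  note px = comp_hom[OF x(1) p(1)]
  have "p \<cdot> x0 = ((p \<cdot> x0) \<cdot> c) \<cdot> i0" "p \<cdot> x1 = ((p \<cdot> x0) \<cdot> c) \<cdot> i1"
    using comp_assoc[OF c(1,3) px] comp_assoc[OF c(2,3) px] comp_id[OF px] c(5,6) eq by simp_all
  then obtain l where "l \<in> hom M (Dom M c) E" "l \<cdot> i0 = x0" "l \<cdot> i1 = x1"
    using cylinder_lift[OF cyl p x comp_hom[OF c(3) px]] by blast
  then show ?thesis
    unfolding homotopic_def using is_homotopyI[OF cyl _ x] by blast
qed

lemma homotopy_typing:
  assumes h: "is_homotopy M h f g" and f: "f \<in> hom M A B"
  shows "is_cylinder M A (end0 h) (end1 h) (proj h)" "hmap h \<in> hom M (Dom M (proj h)) B"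
    "hmap h \<cdot> end0 h = f" "hmap h \<cdot> end1 h = g" "g \<in> hom M A B"
proof -
  have AB: "Dom M f = A" "Cod M f = B" using f by (auto simp: in_hom)
  note h' = h[unfolded is_homotopy_def AB]
  show "is_cylinder M A (end0 h) (end1 h) (proj h)" "hmap h \<in> hom M (Dom M (proj h)) B"
    "hmap h \<cdot> end0 h = f" "hmap h \<cdot> end1 h = g" using h' by blast+
  show "g \<in> hom M A B" using h' unfolding in_hom by metis
qed

lemma homotopic_postcompose:
  assumes "homotopic M f g" and f: "f \<in> hom M A B" and k: "k \<in> hom M B D"
  shows "homotopic M (k \<cdot> f) (k \<cdot> g)"
proof -
  obtain h where h: "is_homotopy M h f g" using assms by (auto simp: homotopic_def)
  note cyl = homotopy_typing(1)[OF h f] and hm = homotopy_typing(2-4)[OF h f]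
    and g = homotopy_typing(5)[OF h f]
  show ?thesis
    unfolding homotopic_def
    by (rule exI, rule is_homotopyI[OF cyl comp_hom[OF hm(1) k] comp_hom[OF f k] comp_hom[OF g k]])
      (use comp_assoc[OF cylinder_typing(1)[OF cyl] hm(1) k] comp_assoc[OF cylinder_typing(2)[OF cyl] hm(1) k]
        hm(2,3) in simp_all)
qed

lemma cylinder_end0_tcof:
  assumes cyl: "is_cylinder M A i0 i1 c" and A: "cofibrant M A"
  shows "i0 \<in> tcof"
proof -
  note c = cylinder_typing[OF cyl]
  have "i0 \<in> Cof M"
  proof (rule cofI[OF c(1)])
    fix E F p u v assume p: "p \<in> hom M E F" "p \<in> tfib" and u: "u \<in> hom M A E"
      and v: "v \<in> hom M (Dom M c) F" and eq: "p \<cdot> u = v \<cdot> i0"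
    obtain x where x: "x \<in> hom M A E" "p \<cdot> x = v \<cdot> i1"
      using cofibrant_lift[OF A p comp_hom[OF c(2) v]] .
    show "\<exists>l \<in> hom M (Dom M c) E. l \<cdot> i0 = u \<and> p \<cdot> l = v"
      using cylinder_lift[OF cyl p u x(1) v eq x(2)] by blast
  qed
  moreover have "i0 \<in> Weq M"
    using weq_section[OF c(1,3,5)] c(4) by simp
  ultimately show ?thesis by simp
qed

text \<open>The mapping cylinder of \<open>\<rho> : Z \<rightarrow> A\<close>. Its front end \<open>k \<cdot> i1\<close> is a cofibration because the two
  ends of the cylinder together are one and \<open>A\<close> is cofibrant.\<close>

lemma mapping_cylinder:
  assumes cyl: "is_cylinder M Z i0 i1 c" and Z: "cofibrant M Z" and A: "cofibrant M A"
    and \<rho>: "\<rho> \<in> hom M Z A" and po: "is_pushout M i0 \<rho> k l"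
    and t: "k \<in> hom M (Dom M c) P" "l \<in> hom M A P"
  shows "k \<cdot> i1 \<in> Cof M" "l \<in> tcof"
proof -
  note c = cylinder_typing[OF cyl] and kl = pushout_comm[OF po]
  show "l \<in> tcof"
    using tcof_pushout[OF po c(1) \<rho> t cylinder_end0_tcof[OF cyl Z]] .
  show "k \<cdot> i1 \<in> Cof M"
  proof (rule cofI[OF comp_hom[OF c(2) t(1)]])
    fix E F p x y assume p: "p \<in> hom M E F" "p \<in> tfib" and x: "x \<in> hom M Z E" and y: "y \<in> hom M P F"
      and eq: "p \<cdot> x = y \<cdot> (k \<cdot> i1)"
    obtain a where a: "a \<in> hom M A E" "p \<cdot> a = y \<cdot> l"
      using cofibrant_lift[OF A p comp_hom[OF t(2) y]] .
    have "p \<cdot> (a \<cdot> \<rho>) = (y \<cdot> k) \<cdot> i0"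
      using comp_reassoc[OF a(2) a(1) p(1), of \<rho>] kl \<rho> t y c by (simp add: in_hom)
    moreover have "p \<cdot> x = (y \<cdot> k) \<cdot> i1"
      using eq y t c by (simp add: in_hom)
    ultimately obtain b where b: "b \<in> hom M (Dom M c) E" "b \<cdot> i0 = a \<cdot> \<rho>" "b \<cdot> i1 = x" "p \<cdot> b = y \<cdot> k"
      using cylinder_lift[OF cyl p comp_hom[OF \<rho> a(1)] x comp_hom[OF t(1) y]] by metis
    obtain w where w: "w \<in> hom M P E" "w \<cdot> k = b" "w \<cdot> l = a"
      using pushout_induced[OF po t b(1) a(1) b(2)] .
    have "p \<cdot> w = y"
      by (rule pushout_ext[OF po comp_hom[OF w(1) p(1)] y t(1)]) (use w b a t p in \<open>auto simp: in_hom\<close>)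
    moreover have "w \<cdot> (k \<cdot> i1) = x"
      using comp_reassoc[OF w(2) t(1) w(1), of i1] b c by (simp add: in_hom)
    ultimately show "\<exists>w \<in> hom M P E. w \<cdot> (k \<cdot> i1) = x \<and> p \<cdot> w = y"
      using w by blast
  qed
qed

section \<open>The gluing lemma\<close>

text \<open>Ken Brown's factorization: when \<open>a1\<close> is an identity and \<open>a0\<close> a weak equivalence, it writes \<open>a0\<close>
  as a trivial cofibration followed by a retraction of a trivial cofibration.\<close>

lemma joint_factorization:
  assumes X: "cofibrant M X0" "cofibrant M X1" and a: "a0 \<in> hom M X0 E" "a1 \<in> hom M X1 E"
  obtains N n0 n1 \<pi> where "n0 \<in> hom M X0 N" "n0 \<in> Cof M" "n1 \<in> hom M X1 N" "n1 \<in> Cof M"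
    "\<pi> \<in> hom M N E" "\<pi> \<in> tfib" "\<pi> \<cdot> n0 = a0" "\<pi> \<cdot> n1 = a1"
proof -
  have o: "X0 \<in> Obj M" "X1 \<in> Obj M" using X by (auto simp: cofibrant_iff)
  obtain P j0 j1 where po: "is_pushout M (zmap pt X0) (zmap pt X1) j0 j1"
    and co: "is_coproduct M j0 j1" and j: "j0 \<in> hom M X0 P" "j1 \<in> hom M X1 P"
    using coproduct_obtain[OF o] .
  obtain w where w: "w \<in> hom M P E" "w \<cdot> j0 = a0" "w \<cdot> j1 = a1"
    using coproduct_induced[OF co j a] .
  obtain N n \<pi> where f: "n \<in> hom M P N" "n \<in> Cof M" "\<pi> \<in> hom M N E" "\<pi> \<in> tfib" "\<pi> \<cdot> n = w"
    using factor_cof_tfib[OF w(1)] .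
  note jc = coproduct_cof[OF po j]
  show thesis
  proof (rule that)
    show "n \<cdot> j0 \<in> Cof M" "n \<cdot> j1 \<in> Cof M"
      using cof_comp[OF j(1) f(1)] cof_comp[OF j(2) f(1)] jc X f by auto
    show "\<pi> \<cdot> (n \<cdot> j0) = a0" "\<pi> \<cdot> (n \<cdot> j1) = a1"
      using comp_reassoc[OF f(5) f(1,3), of j0] comp_reassoc[OF f(5) f(1,3), of j1] j w
      by (auto simp: in_hom)
  qed (use comp_hom[OF j(1) f(1)] comp_hom[OF j(2) f(1)] f in auto)
qed

text \<open>A map of spans \<open>(B \<leftarrow> A \<rightarrow> C) \<rightarrow> (NB \<leftarrow> NA \<rightarrow> NC)\<close> that is a trivial cofibration at \<open>C\<close> and,
  relative to \<open>A \<rightarrow> NA\<close>, at \<open>B\<close> induces a trivial cofibration on pushouts: lift first on \<open>NC\<close>, which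
  determines the lift on \<open>NA\<close>, and then on \<open>NB\<close>.\<close>

lemma span_tcof_pushout:
  assumes po: "is_pushout M f g u v" and t: "f \<in> hom M A B" "g \<in> hom M A C" "u \<in> hom M B P" "v \<in> hom M C P"
    and po': "is_pushout M f' g' u' v'" and t': "f' \<in> hom M NA NB" "g' \<in> hom M NA NC"
      "u' \<in> hom M NB P'" "v' \<in> hom M NC P'"
    and L: "is_pushout M f a lB lN" "lB \<in> hom M B L" "lN \<in> hom M NA L"
    and a: "a \<in> hom M A NA" and c: "c \<in> hom M C NC" "c \<in> tcof" and k: "k \<in> hom M L NB" "k \<in> tcof"
    and eqs: "g' \<cdot> a = c \<cdot> g" "k \<cdot> lN = f'"
    and w: "w \<in> hom M P P'" "w \<cdot> u = u' \<cdot> (k \<cdot> lB)" "w \<cdot> v = v' \<cdot> c"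
  shows "w \<in> tcof"
proof (rule tcofI[OF w(1)])
  note comm = pushout_comm[OF po] and comm' = pushout_comm[OF po'] and commL = pushout_comm[OF L(1)]
  fix E F p x y assume p: "p \<in> hom M E F" "p \<in> Fib M" and x: "x \<in> hom M P E" and y: "y \<in> hom M P' F"
    and eq: "p \<cdot> x = y \<cdot> w"
  have "p \<cdot> (x \<cdot> v) = (y \<cdot> v') \<cdot> c"
    using comp_reassoc[OF eq x p(1), of v] w y t t' c by (simp add: in_hom)
  then obtain lC where lC: "lC \<in> hom M NC E" "lC \<cdot> c = x \<cdot> v" "p \<cdot> lC = y \<cdot> v'"
    using lift_tcof[OF c p comp_hom[OF t(4) x] comp_hom[OF t'(4) y]] by metis
  have "(x \<cdot> u) \<cdot> f = (lC \<cdot> g') \<cdot> a"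
    using comm eqs(1) comp_reassoc[OF lC(2) c(1) lC(1), of g] lC x t t' a c by (simp add: in_hom)
  then obtain b where b: "b \<in> hom M L E" "b \<cdot> lB = x \<cdot> u" "b \<cdot> lN = lC \<cdot> g'"
    using pushout_induced[OF L comp_hom[OF t(3) x] comp_hom[OF t'(2) lC(1)]] by metis
  have "p \<cdot> b = (y \<cdot> u') \<cdot> k"
  proof (rule pushout_ext[OF L(1) comp_hom[OF b(1) p(1)] comp_hom[OF k(1) comp_hom[OF t'(3) y]] L(2)])
    show "(p \<cdot> b) \<cdot> lB = ((y \<cdot> u') \<cdot> k) \<cdot> lB"
      using comp_reassoc[OF eq x p(1), of u] w b p y t t' k L by (simp add: in_hom)
    show "(p \<cdot> b) \<cdot> lN = ((y \<cdot> u') \<cdot> k) \<cdot> lN"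
      using comp_reassoc[OF lC(3) lC(1) p(1), of g'] eqs(2) comm' b p y t t' k L by (simp add: in_hom)
  qed
  then obtain lB' where lB': "lB' \<in> hom M NB E" "lB' \<cdot> k = b" "p \<cdot> lB' = y \<cdot> u'"
    using lift_tcof[OF k p b(1) comp_hom[OF t'(3) y]] by metis
  have "lB' \<cdot> f' = lC \<cdot> g'"
    using comp_reassoc[OF lB'(2) k(1) lB'(1), of lN] eqs(2) b L by (simp add: in_hom)
  then obtain l where l: "l \<in> hom M P' E" "l \<cdot> u' = lB'" "l \<cdot> v' = lC"
    using pushout_induced[OF po' t'(3,4) lB'(1) lC(1)] by metis
  have "p \<cdot> l = y"
    by (rule pushout_ext[OF po' comp_hom[OF l(1) p(1)] y t'(3)]) (use l lB' lC p t' in \<open>auto simp: in_hom\<close>)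
  moreover have "l \<cdot> w = x"
  proof (rule pushout_ext[OF po comp_hom[OF w(1) l(1)] x t(3)])
    show "(l \<cdot> w) \<cdot> u = x \<cdot> u"
      using comp_reassoc[OF l(2) t'(3) l(1), of "k \<cdot> lB"] comp_reassoc[OF lB'(2) k(1) lB'(1), of lB]
        w l b t L k by (simp add: in_hom)
    show "(l \<cdot> w) \<cdot> v = x \<cdot> v"
      using comp_reassoc[OF l(3) t'(4) l(1), of c] w l lC t c by (simp add: in_hom)
  qed
  ultimately show "\<exists>l \<in> hom M P' E. l \<cdot> w = x \<and> p \<cdot> l = y" using l by blast
qed

text \<open>Both spans map to a third one, obtained by factoring the two maps into the second span
  jointly, at \<open>C\<close>, at \<open>A\<close> over the pullback, and at \<open>B\<close> under the pushout. Both induce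
  trivial cofibrations on pushouts, and \<open>w\<close> is the first of these followed by a retraction of the second.\<close>

lemma gluing:
  assumes po: "is_pushout M f g u v"
    and t: "f \<in> hom M A B" "g \<in> hom M A C" "u \<in> hom M B P" "v \<in> hom M C P" and f: "f \<in> Cof M"
    and po': "is_pushout M f' g' u' v'"
    and t': "f' \<in> hom M A' B'" "g' \<in> hom M A' C'" "u' \<in> hom M B' P'" "v' \<in> hom M C' P'" and f': "f' \<in> Cof M"
    and cofs: "cofibrant M A" "cofibrant M C" "cofibrant M A'" "cofibrant M C'"
    and \<alpha>: "\<alpha> \<in> hom M A A'" "\<alpha> \<in> Weq M" and \<beta>: "\<beta> \<in> hom M B B'" "\<beta> \<in> Weq M"
    and \<gamma>: "\<gamma> \<in> hom M C C'" "\<gamma> \<in> Weq M"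
    and eqs: "\<beta> \<cdot> f = f' \<cdot> \<alpha>" "\<gamma> \<cdot> g = g' \<cdot> \<alpha>"
    and w: "w \<in> hom M P P'" "w \<cdot> u = u' \<cdot> \<beta>" "w \<cdot> v = v' \<cdot> \<gamma>"
  shows "w \<in> Weq M"
proof -
  have o: "A \<in> Obj M" "B \<in> Obj M" "C \<in> Obj M" "A' \<in> Obj M" "B' \<in> Obj M" "C' \<in> Obj M" "P' \<in> Obj M"
    using hom_objs[OF t(1)] hom_objs[OF t(4)] hom_objs[OF t'(1)] hom_objs[OF t'(4)] by auto
  obtain NC c0 c1 \<pi>C where C: "c0 \<in> hom M C NC" "c0 \<in> Cof M" "c1 \<in> hom M C' NC" "c1 \<in> Cof M"
    "\<pi>C \<in> hom M NC C'" "\<pi>C \<in> tfib" "\<pi>C \<cdot> c0 = \<gamma>" "\<pi>C \<cdot> c1 = Id M C'"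
    using joint_factorization[OF cofs(2,4) \<gamma>(1) id_hom[OF o(6)]] .
  have c01: "c0 \<in> tcof" "c1 \<in> tcof"
    using two_of_three(3)[OF C(1,5)] weq_section[OF C(3,5,8)] C \<gamma>(2) by auto
  obtain E p q where pb: "is_pullback M \<pi>C g' p q" and E: "p \<in> hom M E NC" "q \<in> hom M E A'" "\<pi>C \<cdot> p = g' \<cdot> q"
    using pullback_obtain[OF C(5) t'(2)] .
  have q: "q \<in> tfib" by (rule tfib_pullback[OF pb C(5) t'(2) E(1,2) C(6)])
  have "\<pi>C \<cdot> (c0 \<cdot> g) = g' \<cdot> \<alpha>"
    using comp_assoc[OF t(2) C(1,5)] eqs(2) C(7) by simp
  then obtain e0 where e0: "e0 \<in> hom M A E" "p \<cdot> e0 = c0 \<cdot> g" "q \<cdot> e0 = \<alpha>"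
    using pullback_induced[OF pb E(1,2) comp_hom[OF t(2) C(1)] \<alpha>(1)] by blast
  have "\<pi>C \<cdot> (c1 \<cdot> g') = g' \<cdot> Id M A'"
    using comp_assoc[OF t'(2) C(3,5)] t' C(8) by (simp add: in_hom)
  then obtain e1 where e1: "e1 \<in> hom M A' E" "p \<cdot> e1 = c1 \<cdot> g'" "q \<cdot> e1 = Id M A'"
    using pullback_induced[OF pb E(1,2) comp_hom[OF t'(2) C(3)] id_hom[OF o(4)]] by blast
  obtain NA a0 a1 \<pi>E where A: "a0 \<in> hom M A NA" "a0 \<in> Cof M" "a1 \<in> hom M A' NA" "a1 \<in> Cof M"
    "\<pi>E \<in> hom M NA E" "\<pi>E \<in> tfib" "\<pi>E \<cdot> a0 = e0" "\<pi>E \<cdot> a1 = e1"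
    using joint_factorization[OF cofs(1,3) e0(1) e1(1)] .
  define \<pi>A where "\<pi>A = q \<cdot> \<pi>E"
  define gN where "gN = p \<cdot> \<pi>E"
  have \<pi>A: "\<pi>A \<in> hom M NA A'" "\<pi>A \<in> tfib" and gN: "gN \<in> hom M NA NC"
    unfolding \<pi>A_def gN_def using comp_hom[OF A(5) E(2)] tfib_comp[OF A(5) E(2) A(6) q] comp_hom[OF A(5) E(1)]
    by auto
  have A_eqs: "\<pi>A \<cdot> a0 = \<alpha>" "\<pi>A \<cdot> a1 = Id M A'" "gN \<cdot> a0 = c0 \<cdot> g" "gN \<cdot> a1 = c1 \<cdot> g'"
    "\<pi>C \<cdot> gN = g' \<cdot> \<pi>A"
    unfolding \<pi>A_def gN_def
    using comp_assoc[OF A(1,5) E(2)] comp_assoc[OF A(3,5) E(2)] comp_assoc[OF A(1,5) E(1)] comp_assoc[OF A(3,5) E(1)]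
      comp_assoc[OF A(5) E(1) C(5)] comp_assoc[OF A(5) E(2) t'(2)] A(7,8) e0 e1 E(3) by auto
  have a01: "a0 \<in> tcof" "a1 \<in> tcof"
    using two_of_three(3)[OF A(1) \<pi>A(1)] weq_section[OF A(3) \<pi>A(1)] A_eqs A(2,4) \<pi>A(2) \<alpha>(2) by auto
  obtain L0 lB0 lN0 where L0: "is_pushout M f a0 lB0 lN0" "lB0 \<in> hom M B L0" "lN0 \<in> hom M NA L0" "lB0 \<cdot> f = lN0 \<cdot> a0"
    using pushout_obtain[OF t(1) A(1)] .
  obtain L1 lB1 lN1 where L1: "is_pushout M f' a1 lB1 lN1" "lB1 \<in> hom M B' L1" "lN1 \<in> hom M NA L1" "lB1 \<cdot> f' = lN1 \<cdot> a1"
    using pushout_obtain[OF t'(1) A(3)] .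
  have lB: "lB0 \<in> tcof" "lB1 \<in> tcof"
    using tcof_pushout[OF pushout_sym[OF L0(1)] A(1) t(1) L0(3,2) a01(1)]
      tcof_pushout[OF pushout_sym[OF L1(1)] A(3) t'(1) L1(3,2) a01(2)] .
  have lN: "lN0 \<in> Cof M" "lN1 \<in> Cof M"
    using cof_pushout[OF L0(1) t(1) A(1) L0(2,3) f] cof_pushout[OF L1(1) t'(1) A(3) L1(2,3) f'] .
  obtain L m0 m1 where L: "is_pushout M lN0 lN1 m0 m1" "m0 \<in> hom M L0 L" "m1 \<in> hom M L1 L" "m0 \<cdot> lN0 = m1 \<cdot> lN1"
    using pushout_obtain[OF L0(3) L1(3)] .
  have m: "m0 \<in> Cof M" "m1 \<in> Cof M"
    using cof_pushout[OF pushout_sym[OF L(1)] L1(3) L0(3) L(3,2) lN(2)] cof_pushout[OF L(1) L0(3) L1(3) L(2,3) lN(1)] .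
  have "\<beta> \<cdot> f = (f' \<cdot> \<pi>A) \<cdot> a0"
    using comp_assoc[OF A(1) \<pi>A(1) t'(1)] A_eqs eqs by simp
  then obtain b0 where b0: "b0 \<in> hom M L0 B'" "b0 \<cdot> lB0 = \<beta>" "b0 \<cdot> lN0 = f' \<cdot> \<pi>A"
    using pushout_induced[OF L0(1,2,3) \<beta>(1) comp_hom[OF \<pi>A(1) t'(1)]] by blast
  have "Id M B' \<cdot> f' = (f' \<cdot> \<pi>A) \<cdot> a1"
    using comp_assoc[OF A(3) \<pi>A(1) t'(1)] A_eqs t' by (simp add: in_hom)
  then obtain b1 where b1: "b1 \<in> hom M L1 B'" "b1 \<cdot> lB1 = Id M B'" "b1 \<cdot> lN1 = f' \<cdot> \<pi>A"
    using pushout_induced[OF L1(1,2,3) id_hom[OF o(5)] comp_hom[OF \<pi>A(1) t'(1)]] by blast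
  obtain b where b: "b \<in> hom M L B'" "b \<cdot> m0 = b0" "b \<cdot> m1 = b1"
    using pushout_induced[OF L(1,2,3) b0(1) b1(1)] b0(3) b1(3) by auto
  obtain NB n \<pi>B where B: "n \<in> hom M L NB" "n \<in> Cof M" "\<pi>B \<in> hom M NB B'" "\<pi>B \<in> tfib" "\<pi>B \<cdot> n = b"
    using factor_cof_tfib[OF b(1)] .
  define k0 k1 fN where "k0 = n \<cdot> m0" and "k1 = n \<cdot> m1" and "fN = k0 \<cdot> lN0"
  have k: "k0 \<in> hom M L0 NB" "k1 \<in> hom M L1 NB" "k0 \<in> Cof M" "k1 \<in> Cof M" and fN: "fN \<in> hom M NA NB"
    unfolding fN_def k0_def k1_def
    using comp_hom[OF L(2) B(1)] comp_hom[OF L(3) B(1)] cof_comp[OF L(2) B(1) m(1) B(2)] cof_comp[OF L(3) B(1) m(2) B(2)]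
      comp_hom[OF L0(3) comp_hom[OF L(2) B(1)]] by auto
  have \<pi>k: "\<pi>B \<cdot> k0 = b0" "\<pi>B \<cdot> k1 = b1" and fN1: "k1 \<cdot> lN1 = fN" and \<pi>f: "\<pi>B \<cdot> fN = f' \<cdot> \<pi>A"
  proof -
    show 1: "\<pi>B \<cdot> k0 = b0" "\<pi>B \<cdot> k1 = b1"
      unfolding k0_def k1_def using comp_assoc[OF L(2) B(1,3)] comp_assoc[OF L(3) B(1,3)] B(5) b by auto
    show "k1 \<cdot> lN1 = fN"
      unfolding fN_def k0_def k1_def using comp_assoc[OF L0(3) L(2) B(1)] comp_assoc[OF L1(3) L(3) B(1)] L(4) by auto
    show "\<pi>B \<cdot> fN = f' \<cdot> \<pi>A"
      unfolding fN_def using comp_assoc[OF L0(3) k(1) B(3)] b0 1 by auto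
  qed
  have \<pi>kl: "\<pi>B \<cdot> (k0 \<cdot> lB0) = \<beta>" "\<pi>B \<cdot> (k1 \<cdot> lB1) = Id M B'"
    using comp_assoc[OF L0(2) k(1) B(3)] comp_assoc[OF L1(2) k(2) B(3)] \<pi>k b0 b1 by auto
  have k_tcof: "k0 \<in> tcof" "k1 \<in> tcof"
  proof -
    have "k0 \<cdot> lB0 \<in> Weq M" "k1 \<cdot> lB1 \<in> Weq M"
      using two_of_three(3)[OF comp_hom[OF L0(2) k(1)] B(3)] two_of_three(3)[OF comp_hom[OF L1(2) k(2)] B(3)]
        \<pi>kl B(4) \<beta>(2) id_tcof[OF o(5)] by auto
    then show "k0 \<in> tcof" "k1 \<in> tcof"
      using two_of_three(2)[OF L0(2) k(1)] two_of_three(2)[OF L1(2) k(2)] lB k by auto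
  qed
  obtain PN uN vN where PN: "is_pushout M fN gN uN vN" "uN \<in> hom M NB PN" "vN \<in> hom M NC PN" "uN \<cdot> fN = vN \<cdot> gN"
    using pushout_obtain[OF fN gN] .
  have "(uN \<cdot> (k0 \<cdot> lB0)) \<cdot> f = (vN \<cdot> c0) \<cdot> g"
  proof -
    have "(uN \<cdot> (k0 \<cdot> lB0)) \<cdot> f = uN \<cdot> (k0 \<cdot> (lN0 \<cdot> a0))"
      using L0 k PN t by (simp add: in_hom)
    also have "\<dots> = uN \<cdot> (fN \<cdot> a0)"
      unfolding fN_def using comp_assoc[OF A(1) L0(3) k(1)] by simp
    also have "\<dots> = vN \<cdot> (gN \<cdot> a0)"
      using comp_reassoc[OF PN(4) fN PN(2), of a0] A gN PN by (simp add: in_hom)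
    also have "\<dots> = (vN \<cdot> c0) \<cdot> g"
      using A_eqs(3) comp_assoc[OF t(2) C(1) PN(3)] by simp
    finally show ?thesis .
  qed
  then obtain w0 where w0: "w0 \<in> hom M P PN" "w0 \<cdot> u = uN \<cdot> (k0 \<cdot> lB0)" "w0 \<cdot> v = vN \<cdot> c0"
    using pushout_induced[OF po t(3,4) comp_hom[OF comp_hom[OF L0(2) k(1)] PN(2)] comp_hom[OF C(1) PN(3)]] by blast
  have "(uN \<cdot> (k1 \<cdot> lB1)) \<cdot> f' = (vN \<cdot> c1) \<cdot> g'"
  proof -
    have "(uN \<cdot> (k1 \<cdot> lB1)) \<cdot> f' = uN \<cdot> (k1 \<cdot> (lN1 \<cdot> a1))"
      using L1 k PN t' by (simp add: in_hom)
    also have "\<dots> = uN \<cdot> (fN \<cdot> a1)"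
      unfolding fN1[symmetric] using comp_assoc[OF A(3) L1(3) k(2)] by simp
    also have "\<dots> = vN \<cdot> (gN \<cdot> a1)"
      using comp_reassoc[OF PN(4) fN PN(2), of a1] A gN PN by (simp add: in_hom)
    also have "\<dots> = (vN \<cdot> c1) \<cdot> g'"
      using A_eqs(4) comp_assoc[OF t'(2) C(3) PN(3)] by simp
    finally show ?thesis .
  qed
  then obtain w1 where w1: "w1 \<in> hom M P' PN" "w1 \<cdot> u' = uN \<cdot> (k1 \<cdot> lB1)" "w1 \<cdot> v' = vN \<cdot> c1"
    using pushout_induced[OF po' t'(3,4) comp_hom[OF comp_hom[OF L1(2) k(2)] PN(2)] comp_hom[OF C(3) PN(3)]] by blast
  have w0_tcof: "w0 \<in> tcof"
    by (rule span_tcof_pushout[OF po t PN(1) fN gN PN(2,3) L0(1,2,3) A(1) C(1) c01(1) k(1) k_tcof(1) A_eqs(3)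
          fN_def[symmetric] w0])
  have w1_tcof: "w1 \<in> tcof"
    by (rule span_tcof_pushout[OF po' t' PN(1) fN gN PN(2,3) L1(1,2,3) A(3) C(3) c01(2) k(2) k_tcof(2) A_eqs(4)
          fN1 w1])
  have "(u' \<cdot> \<pi>B) \<cdot> fN = (v' \<cdot> \<pi>C) \<cdot> gN"
    using comp_assoc[OF fN B(3) t'(3)] comp_assoc[OF gN C(5) t'(4)] \<pi>f A_eqs(5)
      comp_assoc[OF \<pi>A(1) t'(1,3)] comp_assoc[OF \<pi>A(1) t'(2,4)] pushout_comm[OF po'] by simp
  then obtain \<pi> where \<pi>: "\<pi> \<in> hom M PN P'" "\<pi> \<cdot> uN = u' \<cdot> \<pi>B" "\<pi> \<cdot> vN = v' \<cdot> \<pi>C"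
    using pushout_induced[OF PN(1,2,3) comp_hom[OF B(3) t'(3)] comp_hom[OF C(5) t'(4)]] by blast
  have "\<pi> \<cdot> w1 = Id M P'"
  proof (rule pushout_ext[OF po' comp_hom[OF w1(1) \<pi>(1)] id_hom[OF o(7)] t'(3)])
    show "(\<pi> \<cdot> w1) \<cdot> u' = Id M P' \<cdot> u'"
      using w1 comp_reassoc[OF \<pi>(2) PN(2) \<pi>(1), of "k1 \<cdot> lB1"] \<pi>kl(2) t' B k L1 \<pi>(1) by (simp add: in_hom)
    show "(\<pi> \<cdot> w1) \<cdot> v' = Id M P' \<cdot> v'"
      using w1 comp_reassoc[OF \<pi>(3) PN(3) \<pi>(1), of c1] t' C \<pi>(1) by (simp add: in_hom)
  qed
  then have "\<pi> \<in> Weq M"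
    using weq_section[OF w1(1) \<pi>(1)] w1_tcof by simp
  moreover have "\<pi> \<cdot> w0 = w"
  proof (rule pushout_ext[OF po comp_hom[OF w0(1) \<pi>(1)] w(1) t(3)])
    show "(\<pi> \<cdot> w0) \<cdot> u = w \<cdot> u"
      using w0 comp_reassoc[OF \<pi>(2) PN(2) \<pi>(1), of "k0 \<cdot> lB0"] \<pi>kl(1) t t' B k L0 \<pi>(1) w by (simp add: in_hom)
    show "(\<pi> \<cdot> w0) \<cdot> v = w \<cdot> v"
      using w0 comp_reassoc[OF \<pi>(3) PN(3) \<pi>(1), of c0] t t' C \<pi>(1) w by (simp add: in_hom)
  qed
  ultimately show ?thesis
    using two_of_three(1)[OF w0(1) \<pi>(1)] w0_tcof by simp
qed

section \<open>Homotopy pushouts as strict pushouts\<close>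

lemma bifibrant_obj: "bifibrant M A \<Longrightarrow> A \<in> Obj M"
  by (simp add: bifibrant_def cofibrant_iff)

text \<open>Let \<open>n : Z \<rightarrow> N\<close> be a cofibration and let \<open>s : A \<rightarrow> N\<close> be a section of a weak equivalence
  \<open>N \<rightarrow> A\<close>. A homotopy \<open>G\<close> from \<open>s \<cdot> \<rho>\<close> to \<open>n\<close> compares the mapping cylinder of \<open>\<rho>\<close> with \<open>N\<close>, so
  that by the gluing lemma the double mapping cylinder can be replaced by the strict pushout
  of \<open>n\<close> and \<open>\<tau>\<close>.\<close>

lemma homotopy_pushout_iff_strict:
  assumes cyl: "is_cylinder M Z i0 i1 c"
    and bif: "bifibrant M Z" "bifibrant M A" "bifibrant M Y" "bifibrant M T"
    and \<rho>: "\<rho> \<in> hom M Z A" and \<tau>: "\<tau> \<in> hom M Z Y" and n: "n \<in> hom M Z N" "n \<in> Cof M"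
    and \<pi>: "\<pi> \<in> hom M N A" "\<pi> \<in> Weq M" and s: "s \<in> hom M A N" "\<pi> \<cdot> s = Id M A"
    and G: "G \<in> hom M (Dom M c) N" "G \<cdot> i0 = s \<cdot> \<rho>" "G \<cdot> i1 = n"
    and e: "e \<in> hom M N T" and \<chi>: "\<chi> \<in> hom M Y T" and comm: "e \<cdot> n = \<chi> \<cdot> \<tau>"
    and Q: "is_pushout M n \<tau> x y" "x \<in> hom M N Q" "y \<in> hom M Y Q"
    and q: "q \<in> hom M Q T" "q \<cdot> x = e" "q \<cdot> y = \<chi>"
  shows "homotopy_pushout M \<rho> \<tau> (e \<cdot> s) \<chi> \<lparr>end0 = i0, end1 = i1, proj = c, hmap = e \<cdot> G\<rparr> \<longleftrightarrow> q \<in> Weq M"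
proof -
  let ?h = "\<lparr>end0 = i0, end1 = i1, proj = c, hmap = e \<cdot> G\<rparr>"
  note c = cylinder_typing[OF cyl]
  have cof: "cofibrant M Z" "cofibrant M A" "cofibrant M Y"
    using bif by (auto simp: bifibrant_def)
  have s_weq: "s \<in> Weq M" using weq_section[OF s(1) \<pi>(1) s(2)] \<pi>(2) by simp
  have "is_homotopy M ?h ((e \<cdot> s) \<cdot> \<rho>) (\<chi> \<cdot> \<tau>)"
  proof (rule is_homotopyI[OF cyl comp_hom[OF G(1) e] comp_hom[OF \<rho> comp_hom[OF s(1) e]] comp_hom[OF \<tau> \<chi>]])
    show "(e \<cdot> G) \<cdot> i0 = (e \<cdot> s) \<cdot> \<rho>"
      using comp_assoc[OF c(1) G(1) e] comp_assoc[OF \<rho> s(1) e] G(2) by simp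
    show "(e \<cdot> G) \<cdot> i1 = \<chi> \<cdot> \<tau>"
      using comp_assoc[OF c(2) G(1) e] G(3) comm by simp
  qed
  then have sq: "hcomm_square M \<rho> \<tau> (e \<cdot> s) \<chi> ?h"
    using bif \<rho> \<tau> s(1) e \<chi> by (auto simp: hcomm_square_def in_hom)
  have compare: "u \<in> Weq M \<longleftrightarrow> q \<in> Weq M"
    if k: "is_pushout M i0 \<rho> k l" and m: "is_pushout M (k \<cdot> i1) \<tau> m b" and u: "u \<in> hom M (Cod M m) T"
      and eqs: "u \<cdot> (m \<cdot> l) = e \<cdot> s" "u \<cdot> b = \<chi>" "u \<cdot> (m \<cdot> k) = e \<cdot> G" for k l m b u
  proof -
    note kt = pushout_typing[OF k c(1) \<rho>]
    have ki: "k \<cdot> i1 \<in> hom M Z (Cod M k)" by (rule comp_hom[OF c(2) kt(1)])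
    note mt = pushout_typing[OF m ki \<tau>]
    note mc = mapping_cylinder[OF cyl cof(1,2) \<rho> k kt]
    obtain g1 where g1: "g1 \<in> hom M (Cod M k) N" "g1 \<cdot> k = G" "g1 \<cdot> l = s"
      using pushout_induced[OF k kt G(1) s(1) G(2)] .
    have g1_weq: "g1 \<in> Weq M"
      using two_of_three(2)[OF kt(2) g1(1)] mc(2) g1(3) s_weq by simp
    have g1n: "g1 \<cdot> (k \<cdot> i1) = n"
      using comp_assoc[OF c(2) kt(1) g1(1)] g1(2) G(3) by simp
    have "(x \<cdot> g1) \<cdot> (k \<cdot> i1) = y \<cdot> \<tau>"
      using comp_assoc[OF ki g1(1) Q(2)] g1n pushout_comm[OF Q(1)] by simp
    then obtain g2 where g2: "g2 \<in> hom M (Cod M m) Q" "g2 \<cdot> m = x \<cdot> g1" "g2 \<cdot> b = y"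
      using pushout_induced[OF m mt comp_hom[OF g1(1) Q(2)] Q(3)] by blast
    have Z: "Id M Z \<in> hom M Z Z" "Id M Y \<in> hom M Y Y" "Id M Z \<in> Weq M" "Id M Y \<in> Weq M"
      using bif bifibrant_obj id_hom id_tcof by auto
    have "g2 \<in> Weq M"
      by (rule gluing[OF m ki \<tau> mt mc(1) Q(1) n(1) \<tau> Q(2,3) n(2) cof(1,3,1,3) Z(1,3) g1(1) g1_weq Z(2,4) _ _ g2(1,2)])
        (use g1n n \<tau> g2(3) Q(3) in \<open>simp_all add: in_hom\<close>)
    moreover have "q \<cdot> g2 = u"
    proof (rule pushout_ext[OF m comp_hom[OF g2(1) q(1)] u mt(1)])
      show "(q \<cdot> g2) \<cdot> b = u \<cdot> b"
        using comp_assoc[OF mt(2) g2(1) q(1)] g2(3) q(3) eqs by simp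
      have "(q \<cdot> g2) \<cdot> m = e \<cdot> g1"
        using comp_assoc[OF mt(1) g2(1) q(1)] comp_assoc[OF g1(1) Q(2) q(1)] g2(2) q(2) by simp
      moreover have "e \<cdot> g1 = u \<cdot> m"
        by (rule pushout_ext[OF k comp_hom[OF g1(1) e] comp_hom[OF mt(1) u] kt(1)])
         (use comp_assoc[OF kt(1) g1(1) e] comp_assoc[OF kt(2) g1(1) e]
            comp_assoc[OF kt(1) mt(1) u] comp_assoc[OF kt(2) mt(1) u] g1 eqs in simp_all)
      ultimately show "(q \<cdot> g2) \<cdot> m = u \<cdot> m" by simp
    qed
    ultimately show ?thesis
      using two_of_three(1,2)[OF g2(1) q(1)] by auto
  qed
  have T: "Cod M (e \<cdot> s) = T" using e s by (simp add: in_hom)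
  show ?thesis
  proof
    assume "homotopy_pushout M \<rho> \<tau> (e \<cdot> s) \<chi> ?h"
    then show "q \<in> Weq M" unfolding homotopy_pushout_def T using compare by auto
  next
    assume q': "q \<in> Weq M"
    obtain P k l where k: "is_pushout M i0 \<rho> k l" "k \<in> hom M (Dom M c) P" "l \<in> hom M A P" "k \<cdot> i0 = l \<cdot> \<rho>"
      using pushout_obtain[OF c(1) \<rho>] .
    obtain D m b where m: "is_pushout M (k \<cdot> i1) \<tau> m b" "m \<in> hom M P D" "b \<in> hom M Y D" "m \<cdot> (k \<cdot> i1) = b \<cdot> \<tau>"
      using pushout_obtain[OF comp_hom[OF c(2) k(2)] \<tau>] by metis
    have "(e \<cdot> G) \<cdot> i0 = (e \<cdot> s) \<cdot> \<rho>" "(e \<cdot> G) \<cdot> i1 = \<chi> \<cdot> \<tau>"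
      using comp_assoc[OF c(1) G(1) e] comp_assoc[OF c(2) G(1) e] comp_assoc[OF \<rho> s(1) e] G comm by simp_all
    then obtain u1 where u1: "u1 \<in> hom M P T" "u1 \<cdot> k = e \<cdot> G" "u1 \<cdot> l = e \<cdot> s"
      using pushout_induced[OF k(1,2,3) comp_hom[OF G(1) e] comp_hom[OF s(1) e]] by blast
    have "u1 \<cdot> (k \<cdot> i1) = \<chi> \<cdot> \<tau>"
      using comp_assoc[OF c(2) k(2) u1(1)] u1(2) \<open>(e \<cdot> G) \<cdot> i1 = \<chi> \<cdot> \<tau>\<close> by simp
    then obtain u where u: "u \<in> hom M D T" "u \<cdot> m = u1" "u \<cdot> b = \<chi>"
      using pushout_induced[OF m(1,2,3) u1(1) \<chi>] by blast
    have D: "Cod M m = D" using m by (simp add: in_hom)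
    have eqs: "u \<cdot> (m \<cdot> l) = e \<cdot> s" "u \<cdot> (m \<cdot> k) = e \<cdot> G"
      using comp_assoc[OF k(3) m(2) u(1)] comp_assoc[OF k(2) m(2) u(1)] u u1 by simp_all
    have "u \<in> Weq M" using compare[OF k(1) m(1)] u eqs q' D by simp
    then show "homotopy_pushout M \<rho> \<tau> (e \<cdot> s) \<chi> ?h"
      unfolding homotopy_pushout_def T
      by (intro conjI exI[of _ k] exI[of _ l] exI[of _ m] exI[of _ b] exI[of _ u])
        (simp_all add: sq k(1) m(1) u(1,3) eqs D)
  qed
qed

text \<open>The case \<open>N = A\<close>, \<open>s = id\<close>, with a constant homotopy.\<close>

lemma homotopy_pushout_const_iff:
  assumes cyl: "is_cylinder M Z i0 i1 c"
    and bif: "bifibrant M Z" "bifibrant M A" "bifibrant M Y" "bifibrant M T"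
    and f: "f \<in> hom M Z A" "f \<in> Cof M" and g: "g \<in> hom M Z Y"
    and ab: "a \<in> hom M A T" "b \<in> hom M Y T" "a \<cdot> f = b \<cdot> g"
    and Q: "is_pushout M f g x y" "x \<in> hom M A Q" "y \<in> hom M Y Q"
    and q: "q \<in> hom M Q T" "q \<cdot> x = a" "q \<cdot> y = b"
  shows "homotopy_pushout M f g a b (const_homotopy i0 i1 c (a \<cdot> f)) \<longleftrightarrow> q \<in> Weq M"
proof -
  note c = cylinder_typing[OF cyl]
  have A: "A \<in> Obj M" using bif bifibrant_obj by auto
  have s: "Id M A \<in> hom M A A" "Id M A \<in> Weq M" "Id M A \<cdot> Id M A = Id M A"
    using A id_hom id_tcof by auto
  have G: "f \<cdot> c \<in> hom M (Dom M c) A" "(f \<cdot> c) \<cdot> i0 = Id M A \<cdot> f" "(f \<cdot> c) \<cdot> i1 = f"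
    using comp_hom[OF c(3) f(1)] comp_assoc[OF c(1,3) f(1)] comp_assoc[OF c(2,3) f(1)] comp_id[OF f(1)] id_comp[OF f(1)]
      c(5,6) by auto
  have "a \<cdot> Id M A = a" "a \<cdot> (f \<cdot> c) = (a \<cdot> f) \<cdot> c"
    using comp_id[OF ab(1)] comp_assoc[OF c(3) f(1) ab(1)] by auto
  then show ?thesis
    using homotopy_pushout_iff_strict[OF cyl bif f(1) g f s(1,2,1,3) G ab Q q] by simp
qed

text \<open>Over a trivial fibration \<open>\<pi>\<close> the homotopy \<open>G\<close> is obtained by lifting the constant one.\<close>

lemma homotopy_pushoutI:
  assumes bif: "bifibrant M Z" "bifibrant M A" "bifibrant M Y" "bifibrant M T"
    and \<rho>: "\<rho> \<in> hom M Z A" and \<tau>: "\<tau> \<in> hom M Z Y" and n: "n \<in> hom M Z N" "n \<in> Cof M"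
    and \<pi>: "\<pi> \<in> hom M N A" "\<pi> \<in> tfib" "\<pi> \<cdot> n = \<rho>" and s: "s \<in> hom M A N" "\<pi> \<cdot> s = Id M A"
    and e: "e \<in> hom M N T" and \<chi>: "\<chi> \<in> hom M Y T" and comm: "e \<cdot> n = \<chi> \<cdot> \<tau>"
    and Q: "is_pushout M n \<tau> x y" "x \<in> hom M N Q" "y \<in> hom M Y Q"
    and q: "q \<in> hom M Q T" "q \<cdot> x = e" "q \<cdot> y = \<chi>" "q \<in> Weq M"
  shows "\<exists>h. homotopy_pushout M \<rho> \<tau> (e \<cdot> s) \<chi> h"
proof -
  obtain i0 i1 c where cyl: "is_cylinder M Z i0 i1 c"
    using cylinder_exists bif bifibrant_obj by blast
  note c = cylinder_typing[OF cyl]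
  have eq: "\<pi> \<cdot> (s \<cdot> \<rho>) = (\<rho> \<cdot> c) \<cdot> i0" "\<pi> \<cdot> n = (\<rho> \<cdot> c) \<cdot> i1"
    using comp_assoc[OF \<rho> s(1) \<pi>(1)] comp_assoc[OF c(1,3) \<rho>] comp_assoc[OF c(2,3) \<rho>] comp_id[OF \<rho>] id_comp[OF \<rho>]
      c(5,6) s(2) \<pi>(3) by simp_all
  obtain G where G: "G \<in> hom M (Dom M c) N" "G \<cdot> i0 = s \<cdot> \<rho>" "G \<cdot> i1 = n"
    using cylinder_lift[OF cyl \<pi>(1,2) comp_hom[OF \<rho> s(1)] n(1) comp_hom[OF c(3) \<rho>] eq] by blast
  show ?thesis
    using homotopy_pushout_iff_strict[OF cyl bif \<rho> \<tau> n \<pi>(1) _ s G e \<chi> comm Q q(1-3)] \<pi>(2) q(4) by blast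
qed

section \<open>Maps into products\<close>

text \<open>A map into \<open>A \<times> B\<close> is treated as the pair of its components, so that no choice of the
  product is involved.\<close>

definition pairing_in :: "'a set \<Rightarrow> 'a \<Rightarrow> 'a \<Rightarrow> bool" where
  "pairing_in K x y \<longleftrightarrow> (\<exists>p q m. is_product M p q \<and> m \<in> hom M (Dom M x) (Dom M p) \<and> m \<in> K \<and>
     p \<cdot> m = x \<and> q \<cdot> m = y)"

lemma product_obtain:
  assumes A: "A \<in> Obj M" and B: "B \<in> Obj M"
  obtains P p q where "is_product M p q" "p \<in> hom M P A" "q \<in> hom M P B"
proof -
  obtain P p q where pb: "is_pullback M (zmap A pt) (zmap B pt) p q" and t: "p \<in> hom M P A" "q \<in> hom M P B"
    using pullback_obtain[OF zmap_hom zmap_hom] A B pt_obj by metis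
  have "\<exists>!u. u \<in> hom M T P \<and> p \<cdot> u = x \<and> q \<cdot> u = y" if x: "x \<in> hom M T A" and y: "y \<in> hom M T B" for T x y
  proof -
    have "zmap A pt \<cdot> x = zmap B pt \<cdot> y" using x y by (simp add: in_hom)
    then obtain u where u: "u \<in> hom M T P" "p \<cdot> u = x" "q \<cdot> u = y"
      using pullback_induced[OF pb t x y] by blast
    show ?thesis
    proof (rule ex1I[of _ u])
      fix u' assume "u' \<in> hom M T P \<and> p \<cdot> u' = x \<and> q \<cdot> u' = y"
      then show "u' = u" using pullback_ext[OF pb _ u(1) t(1), of u'] u by simp
    qed (use u in simp)
  qed
  then have "is_product M p q" by (rule productI[OF t])
  with t that show thesis by blast
qed

lemma product_iso:
  assumes pr: "is_product M p q" "p \<in> hom M P A" "q \<in> hom M P B"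
    and pr': "is_product M p' q'" "p' \<in> hom M P' A" "q' \<in> hom M P' B"
  obtains \<theta> where "\<theta> \<in> hom M P P'" "p' \<cdot> \<theta> = p" "q' \<cdot> \<theta> = q" "\<theta> \<in> tfib"
proof -
  have P: "P \<in> Obj M" "P' \<in> Obj M" using hom_objs[OF pr(2)] hom_objs[OF pr'(2)] by auto
  obtain \<theta> where t: "\<theta> \<in> hom M P P'" "p' \<cdot> \<theta> = p" "q' \<cdot> \<theta> = q"
    using product_induced[OF pr' pr(2,3)] .
  obtain \<eta> where e: "\<eta> \<in> hom M P' P" "p \<cdot> \<eta> = p'" "q \<cdot> \<eta> = q'"
    using product_induced[OF pr pr'(2,3)] .
  have 1: "\<theta> \<cdot> \<eta> = Id M P'"
    by (rule product_ext[OF pr' comp_hom[OF e(1) t(1)] id_hom[OF P(2)]])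
     (use comp_assoc[OF e(1) t(1) pr'(2)] comp_assoc[OF e(1) t(1) pr'(3)] comp_id[OF pr'(2)] comp_id[OF pr'(3)] e t in simp_all)
  have 2: "\<eta> \<cdot> \<theta> = Id M P"
    by (rule product_ext[OF pr comp_hom[OF t(1) e(1)] id_hom[OF P(1)]])
     (use comp_assoc[OF t(1) e(1) pr(2)] comp_assoc[OF t(1) e(1) pr(3)] comp_id[OF pr(2)] comp_id[OF pr(3)] e t in simp_all)
  have "\<theta> \<in> tfib" by (rule iso_tfib[OF t(1) e(1) 1 2])
  with t that show thesis by blast
qed

lemma pairing_in_typed:
  assumes x: "x \<in> hom M T A" and y: "y \<in> hom M T B" and K: "pairing_in K x y"
  obtains P p q m where "is_product M p q" "p \<in> hom M P A" "q \<in> hom M P B" "m \<in> hom M T P" "m \<in> K"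
    "p \<cdot> m = x" "q \<cdot> m = y"
proof -
  obtain p q m where pr: "is_product M p q" and m: "m \<in> hom M (Dom M x) (Dom M p)" "m \<in> K"
    and pq: "p \<cdot> m = x" "q \<cdot> m = y"
    using K by (auto simp: pairing_in_def)
  have a: "p \<in> Arr M" "q \<in> Arr M" "Dom M q = Dom M p" using pr by (auto simp: is_product_def)
  have "Cod M (p \<cdot> m) = Cod M p" "Cod M (q \<cdot> m) = Cod M q"
    using a m(1) by (simp_all add: in_hom)
  then have t: "p \<in> hom M (Dom M p) A" "q \<in> hom M (Dom M p) B"
    using a x y unfolding pq by (simp_all add: in_hom)
  have "m \<in> hom M T (Dom M p)" using m(1) x by (simp add: in_hom)
  with pr t show thesis using that m(2) pq by blast
qed

lemma pairing_inI:
  assumes pr: "is_product M p q" "p \<in> hom M P A" "q \<in> hom M P B" and m: "m \<in> hom M T P" "m \<in> K"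
  shows "pairing_in K (p \<cdot> m) (q \<cdot> m)"
proof -
  have "Dom M (p \<cdot> m) = T" "Dom M p = P" using m pr by (simp_all add: in_hom)
  then show ?thesis unfolding pairing_in_def using pr m by metis
qed

lemma pairing_iff:
  assumes pr: "is_product M p q" "p \<in> hom M P A" "q \<in> hom M P B" and m: "m \<in> hom M T P"
  shows "pairing_in (Weq M) (p \<cdot> m) (q \<cdot> m) \<longleftrightarrow> m \<in> Weq M"
    "pairing_in (Fib M) (p \<cdot> m) (q \<cdot> m) \<longleftrightarrow> m \<in> Fib M"
    "pairing_in tfib (p \<cdot> m) (q \<cdot> m) \<longleftrightarrow> m \<in> tfib"
proof -
  have *: "\<exists>\<theta> P' m'. m' \<in> hom M T P' \<and> m' \<in> K \<and> \<theta> \<in> hom M P' P \<and> \<theta> \<in> tfib \<and> m = \<theta> \<cdot> m'"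
    if K: "pairing_in K (p \<cdot> m) (q \<cdot> m)" for K
  proof -
    obtain P' p' q' m' where pr': "is_product M p' q'" "p' \<in> hom M P' A" "q' \<in> hom M P' B"
      and m': "m' \<in> hom M T P'" "m' \<in> K" "p' \<cdot> m' = p \<cdot> m" "q' \<cdot> m' = q \<cdot> m"
      using pairing_in_typed[OF comp_hom[OF m pr(2)] comp_hom[OF m pr(3)] K] .
    obtain \<theta> where \<theta>: "\<theta> \<in> hom M P' P" "p \<cdot> \<theta> = p'" "q \<cdot> \<theta> = q'" "\<theta> \<in> tfib"
      using product_iso[OF pr' pr] .
    have "m = \<theta> \<cdot> m'"
      by (rule product_ext[OF pr m comp_hom[OF m'(1) \<theta>(1)]])
        (use comp_assoc[OF m'(1) \<theta>(1) pr(2)] comp_assoc[OF m'(1) \<theta>(1) pr(3)] \<theta> m' in simp_all)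
    with m' \<theta> show ?thesis by blast
  qed
  note ** = pairing_inI[OF pr m]
  show "pairing_in (Weq M) (p \<cdot> m) (q \<cdot> m) \<longleftrightarrow> m \<in> Weq M"
    using *[of "Weq M"] ** two_of_three(1) by (metis IntD2)
  show "pairing_in (Fib M) (p \<cdot> m) (q \<cdot> m) \<longleftrightarrow> m \<in> Fib M"
    using *[of "Fib M"] ** fib_comp by (metis IntD1)
  show "pairing_in tfib (p \<cdot> m) (q \<cdot> m) \<longleftrightarrow> m \<in> tfib"
    using *[of tfib] ** tfib_comp by metis
qed

lemma pairing_obtain:
  assumes x: "x \<in> hom M T A" and y: "y \<in> hom M T B"
  obtains P p q m where "is_product M p q" "p \<in> hom M P A" "q \<in> hom M P B" "m \<in> hom M T P"
    "p \<cdot> m = x" "q \<cdot> m = y"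
proof -
  obtain P p q where pr: "is_product M p q" "p \<in> hom M P A" "q \<in> hom M P B"
    using product_obtain[OF hom_objs(2)[OF x] hom_objs(2)[OF y]] .
  obtain m where "m \<in> hom M T P" "p \<cdot> m = x" "q \<cdot> m = y"
    using product_induced[OF pr x y] .
  then show thesis by (rule that[OF pr])
qed

lemma pairing_tfib_imp:
  assumes "pairing_in tfib x y"
  shows "pairing_in (Weq M) x y" "pairing_in (Fib M) x y"
  using assms unfolding pairing_in_def by blast+

lemma pairing_weq_comp:
  assumes x: "x \<in> hom M P A" and y: "y \<in> hom M P B" and f: "f \<in> hom M Z P"
  shows "pairing_in (Weq M) x y \<Longrightarrow> pairing_in (Weq M) (x \<cdot> f) (y \<cdot> f) \<longleftrightarrow> f \<in> Weq M"
    "f \<in> Weq M \<Longrightarrow> pairing_in (Weq M) (x \<cdot> f) (y \<cdot> f) \<longleftrightarrow> pairing_in (Weq M) x y"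
proof -
  obtain R p q m where pr: "is_product M p q" "p \<in> hom M R A" "q \<in> hom M R B" and m: "m \<in> hom M P R"
    and pq: "p \<cdot> m = x" "q \<cdot> m = y"
    using pairing_obtain[OF x y] .
  have eq: "x \<cdot> f = p \<cdot> (m \<cdot> f)" "y \<cdot> f = q \<cdot> (m \<cdot> f)"
    using comp_assoc[OF f m pr(2)] comp_assoc[OF f m pr(3)] pq by auto
  note 1 = pairing_iff(1)[OF pr comp_hom[OF f m]] and 2 = pairing_iff(1)[OF pr m, unfolded pq]
  show "pairing_in (Weq M) x y \<Longrightarrow> pairing_in (Weq M) (x \<cdot> f) (y \<cdot> f) \<longleftrightarrow> f \<in> Weq M"
    unfolding eq 1 2 using two_of_three[OF f m] by blast
  show "f \<in> Weq M \<Longrightarrow> pairing_in (Weq M) (x \<cdot> f) (y \<cdot> f) \<longleftrightarrow> pairing_in (Weq M) x y"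
    unfolding eq 1 2 using two_of_three[OF f m] by blast
qed

lemma pairing_sym:
  assumes x: "x \<in> hom M P A" and y: "y \<in> hom M P B" and "pairing_in K x y"
  shows "pairing_in K y x"
proof -
  obtain p q m where m: "is_product M p q" "m \<in> hom M (Dom M x) (Dom M p)" "m \<in> K" "p \<cdot> m = x" "q \<cdot> m = y"
    using assms(3) by (auto simp: pairing_in_def)
  then have "Dom M x = Dom M y" "Dom M p = Dom M q"
    using x y by (auto simp: in_hom is_product_def)
  with m product_sym show ?thesis unfolding pairing_in_def by metis
qed

lemma pairing_factor:
  assumes x: "x \<in> hom M P A" and y: "y \<in> hom M P B"
    and factor: "\<And>Q m. m \<in> hom M P Q \<Longrightarrow> \<exists>E i r. i \<in> hom M P E \<inter> I \<and> r \<in> hom M E Q \<inter> K \<and> m = r \<cdot> i"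
  obtains E i x' y' where "i \<in> hom M P E" "i \<in> I" "x' \<in> hom M E A" "y' \<in> hom M E B"
    "x' \<cdot> i = x" "y' \<cdot> i = y" "pairing_in K x' y'"
proof -
  obtain R p q m where pr: "is_product M p q" "p \<in> hom M R A" "q \<in> hom M R B" and m: "m \<in> hom M P R"
    and pq: "p \<cdot> m = x" "q \<cdot> m = y"
    using pairing_obtain[OF x y] .
  obtain E i r where f: "i \<in> hom M P E" "i \<in> I" "r \<in> hom M E R" "r \<in> K" "r \<cdot> i = m"
    using factor[OF m] by blast
  show thesis
    by (rule that[OF f(1,2) comp_hom[OF f(3) pr(2)] comp_hom[OF f(3) pr(3)]])
      (use comp_assoc[OF f(1,3) pr(2)] comp_assoc[OF f(1,3) pr(3)] f pq pairing_inI[OF pr f(3,4)] in simp_all)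
qed

lemmas pairing_factor_cof = pairing_factor[OF _ _ factorization(1)]

lemmas pairing_factor_tcof = pairing_factor[OF _ _ factorization(2)]

lemma pairing_lift:
  assumes x: "x \<in> hom M P A" and y: "y \<in> hom M P B" and K: "pairing_in K x y"
    and lift: "\<And>m. m \<in> K \<Longrightarrow> has_lifting M i m"
    and i: "i \<in> hom M E F" and u: "u \<in> hom M E P" and v: "v \<in> hom M F A" "w \<in> hom M F B"
    and eq: "x \<cdot> u = v \<cdot> i" "y \<cdot> u = w \<cdot> i"
  obtains l where "l \<in> hom M F P" "l \<cdot> i = u" "x \<cdot> l = v" "y \<cdot> l = w"
proof -
  obtain R p q m where pr: "is_product M p q" "p \<in> hom M R A" "q \<in> hom M R B"
    and m: "m \<in> hom M P R" "m \<in> K" and pq: "p \<cdot> m = x" "q \<cdot> m = y"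
    using pairing_in_typed[OF x y K] .
  obtain z where z: "z \<in> hom M F R" "p \<cdot> z = v" "q \<cdot> z = w"
    using product_induced[OF pr v] .
  have "m \<cdot> u = z \<cdot> i"
    by (rule product_ext[OF pr comp_hom[OF u m(1)] comp_hom[OF i(1) z(1)]])
      (use comp_assoc[OF u m(1) pr(2)] comp_assoc[OF u m(1) pr(3)] comp_assoc[OF i(1) z(1) pr(2)]
        comp_assoc[OF i(1) z(1) pr(3)] eq pq z in simp_all)
  then obtain l where l: "l \<in> hom M F P" "l \<cdot> i = u" "m \<cdot> l = z"
    using lift[OF m(2)] m(1) i u z(1) unfolding has_lifting_def in_hom by metis
  show thesis
    by (rule that[OF l(1,2)])
      (use comp_assoc[OF l(1) m(1) pr(2)] comp_assoc[OF l(1) m(1) pr(3)] l pq z in simp_all)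
qed

lemma pairing_tfib_lift:
  assumes "x \<in> hom M P A" "y \<in> hom M P B" "pairing_in tfib x y"
    and i: "i \<in> hom M E F" "i \<in> Cof M" and "u \<in> hom M E P" "v \<in> hom M F A" "w \<in> hom M F B"
    and "x \<cdot> u = v \<cdot> i" "y \<cdot> u = w \<cdot> i"
  obtains l where "l \<in> hom M F P" "l \<cdot> i = u" "x \<cdot> l = v" "y \<cdot> l = w"
  using pairing_lift[OF assms(1-3) lifting(1)[OF i(2)] i(1) assms(6-)] that by blast

lemma pairing_fib_lift:
  assumes "x \<in> hom M P A" "y \<in> hom M P B" "pairing_in (Fib M) x y"
    and i: "i \<in> hom M E F" "i \<in> tcof" and "u \<in> hom M E P" "v \<in> hom M F A" "w \<in> hom M F B"
    and "x \<cdot> u = v \<cdot> i" "y \<cdot> u = w \<cdot> i"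
  obtains l where "l \<in> hom M F P" "l \<cdot> i = u" "x \<cdot> l = v" "y \<cdot> l = w"
  using pairing_lift[OF assms(1-3) lifting(2)[OF i(2)] i(1) assms(6-)] that by blast

lemma pairing_tfibI:
  assumes x: "x \<in> hom M P A" and y: "y \<in> hom M P B"
    and lift: "\<And>E F i u v w. i \<in> hom M E F \<Longrightarrow> i \<in> Cof M \<Longrightarrow> u \<in> hom M E P \<Longrightarrow> v \<in> hom M F A \<Longrightarrow>
      w \<in> hom M F B \<Longrightarrow> x \<cdot> u = v \<cdot> i \<Longrightarrow> y \<cdot> u = w \<cdot> i \<Longrightarrow>
      \<exists>l \<in> hom M F P. l \<cdot> i = u \<and> x \<cdot> l = v \<and> y \<cdot> l = w"
  shows "pairing_in tfib x y"
proof -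
  obtain R p q m where pr: "is_product M p q" "p \<in> hom M R A" "q \<in> hom M R B" and m: "m \<in> hom M P R"
    and pq: "p \<cdot> m = x" "q \<cdot> m = y"
    using pairing_obtain[OF x y] .
  have "m \<in> tfib"
  proof (rule tfibI[OF m])
    fix E F i u z assume i: "i \<in> hom M E F" "i \<in> Cof M" and u: "u \<in> hom M E P" and z: "z \<in> hom M F R"
      and eq: "m \<cdot> u = z \<cdot> i"
    have "x \<cdot> u = (p \<cdot> z) \<cdot> i" "y \<cdot> u = (q \<cdot> z) \<cdot> i"
      using comp_assoc[OF u m pr(2)] comp_assoc[OF u m pr(3)] comp_assoc[OF i(1) z pr(2)] comp_assoc[OF i(1) z pr(3)]
        eq pq by simp_all
    then obtain l where l: "l \<in> hom M F P" "l \<cdot> i = u" "x \<cdot> l = p \<cdot> z" "y \<cdot> l = q \<cdot> z"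
      using lift[OF i u comp_hom[OF z pr(2)] comp_hom[OF z pr(3)]] by blast
    have "m \<cdot> l = z"
      by (rule product_ext[OF pr comp_hom[OF l(1) m] z])
        (use comp_assoc[OF l(1) m pr(2)] comp_assoc[OF l(1) m pr(3)] l pq in simp_all)
    with l show "\<exists>l \<in> hom M F P. l \<cdot> i = u \<and> m \<cdot> l = z" by blast
  qed
  then show ?thesis using pairing_iff(3)[OF pr m] pq by simp
qed

lemma pairing_fib_components:
  assumes x: "x \<in> hom M P A" and y: "y \<in> hom M P B" and tf: "pairing_in (Fib M) x y" and B: "fibrant M B"
  shows "x \<in> Fib M" "fibrant M A \<Longrightarrow> fibrant M P"
proof -
  show "x \<in> Fib M"
  proof (rule fibI[OF x])
    fix E F i u v assume i: "i \<in> hom M E F" "i \<in> tcof" and u: "u \<in> hom M E P" and v: "v \<in> hom M F A"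
      and eq: "x \<cdot> u = v \<cdot> i"
    obtain w where w: "w \<in> hom M F B" "w \<cdot> i = y \<cdot> u"
      using fibrant_extend[OF B i comp_hom[OF u y]] .
    show "\<exists>l \<in> hom M F P. l \<cdot> i = u \<and> x \<cdot> l = v"
      using pairing_fib_lift[OF x y tf i u v w(1) eq w(2)[symmetric]] by blast
  qed
  then show "fibrant M A \<Longrightarrow> fibrant M P"
    using fibrant_fib[OF x] by simp
qed

lemma pairing_contractible:
  assumes x: "x \<in> hom M P A" and y: "y \<in> hom M P B" and tf: "pairing_in tfib x y"
    and B: "zmap B pt \<in> tfib"
  shows "x \<in> tfib"
proof (rule tfibI[OF x])
  have o: "B \<in> Obj M" using hom_objs[OF y] by simp
  fix E F i u v assume i: "i \<in> hom M E F" "i \<in> Cof M" and u: "u \<in> hom M E P" and v: "v \<in> hom M F A"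
    and eq: "x \<cdot> u = v \<cdot> i"
  have F: "F \<in> Obj M" using hom_objs[OF i(1)] by simp
  have "zmap B pt \<cdot> (y \<cdot> u) = zmap F pt \<cdot> i"
    using u y i o F by (simp add: in_hom)
  then obtain w where w: "w \<in> hom M F B" "w \<cdot> i = y \<cdot> u"
    using lift_tfib[OF i zmap_hom[OF o pt_obj] B comp_hom[OF u y] zmap_hom[OF F pt_obj]] by blast
  show "\<exists>l \<in> hom M F P. l \<cdot> i = u \<and> x \<cdot> l = v"
    using pairing_tfib_lift[OF x y tf i u v w(1) eq w(2)[symmetric]] by blast
qed

lemma pairing_zero_id:
  assumes Y: "Y \<in> Obj M"
  shows "pairing_in tfib (zmap Y pt) (Id M Y)"
proof (rule pairing_tfibI[OF zmap_hom[OF Y pt_obj] id_hom[OF Y]])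
  fix E F i u v w assume i: "i \<in> hom M E F" and u: "u \<in> hom M E Y" and v: "v \<in> hom M F pt" and w: "w \<in> hom M F Y"
    and eq: "Id M Y \<cdot> u = w \<cdot> i"
  have "zmap Y pt \<cdot> w = v"
    using zmap_pt_unique(1)[OF v comp_hom[OF w zmap_hom[OF Y pt_obj]]] by simp
  then show "\<exists>l \<in> hom M F Y. l \<cdot> i = u \<and> zmap Y pt \<cdot> l = v \<and> Id M Y \<cdot> l = w"
    using w eq id_comp[OF w] id_comp[OF u] by auto
qed

section \<open>The cube axiom for products\<close>

lemma bifibrant_pt: "bifibrant M pt"
proof -
  have "zmap pt pt = Id M pt" using eq_zmap(1)[OF id_hom[OF pt_obj]] by simp
  then show ?thesis
    using id_tcof[OF pt_obj] id_tfib[OF pt_obj] by (simp add: bifibrant_def cofibrant_iff fibrant_iff)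
qed

lemma hcomm_square_const:
  assumes cyl: "is_cylinder M Z i0 i1 c"
    and bif: "bifibrant M Z" "bifibrant M A" "bifibrant M B" "bifibrant M T"
    and t: "f \<in> hom M Z A" "g \<in> hom M Z B" "a \<in> hom M A T" "b \<in> hom M B T" "a \<cdot> f = b \<cdot> g"
  shows "hcomm_square M f g a b (const_homotopy i0 i1 c (a \<cdot> f))"
proof -
  have "is_homotopy M (const_homotopy i0 i1 c (a \<cdot> f)) (a \<cdot> f) (b \<cdot> g)"
    using const_homotopy[OF cyl comp_hom[OF t(1,3)]] t(5) by simp
  then show ?thesis
    using bif t(1-4) by (simp add: hcomm_square_def in_hom)
qed

lemma precomposite_const:
  assumes cyl: "is_cylinder M A i0 i1 c" and cyl': "is_cylinder M A' i0' i1' c'"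
    and u: "u \<in> hom M A' A" and f: "f \<in> hom M A B"
  shows "is_precomposite M (const_homotopy i0 i1 c f) u (const_homotopy i0' i1' c' (f \<cdot> u))"
proof -
  note c = cylinder_typing[OF cyl] and c' = cylinder_typing[OF cyl']
  have "c \<cdot> (i0 \<cdot> u) = (u \<cdot> c') \<cdot> i0'" "c \<cdot> (i1 \<cdot> u) = (u \<cdot> c') \<cdot> i1'"
    using comp_assoc[OF u c(1,3)] comp_assoc[OF u c(2,3)] comp_assoc[OF c'(1,3) u] comp_assoc[OF c'(2,3) u]
      c(5,6) c'(5,6) id_comp[OF u] comp_id[OF u] by simp_all
  then obtain w where w: "w \<in> hom M (Dom M c') (Dom M c)" "w \<cdot> i0' = i0 \<cdot> u" "w \<cdot> i1' = i1 \<cdot> u" "c \<cdot> w = u \<cdot> c'"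
    using cylinder_lift[OF cyl' c(3,4) comp_hom[OF u c(1)] comp_hom[OF u c(2)] comp_hom[OF c'(3) u]] by blast
  have "(f \<cdot> u) \<cdot> c' = (f \<cdot> c) \<cdot> w"
    using comp_assoc[OF c'(3) u f] comp_assoc[OF w(1) c(3) f] w(4) by simp
  moreover have "Dom M u = A'" using u by (simp add: in_hom)
  ultimately show ?thesis
    unfolding is_precomposite_def using cyl' w by auto
qed

text \<open>In a strictly commutative cube all homotopies can be taken constant; the compatibility
  condition is then witnessed by the identity of the initial vertex.\<close>

lemma strict_cube:
  assumes cyl: "is_cylinder M T0 i0 i1 c" "is_cylinder M T1 j0 j1 d" "is_cylinder M T2 k0 k1 e"
      "is_cylinder M B0 l0 l1 g"
    and bif: "bifibrant M T0" "bifibrant M T1" "bifibrant M T2" "bifibrant M T3"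
      "bifibrant M B0" "bifibrant M B1" "bifibrant M B2" "bifibrant M B3"
    and t: "t1 \<in> hom M T0 T1" "t2 \<in> hom M T0 T2" "t3 \<in> hom M T1 T3" "t4 \<in> hom M T2 T3"
    and b: "b1 \<in> hom M B0 B1" "b2 \<in> hom M B0 B2" "b3 \<in> hom M B1 B3" "b4 \<in> hom M B2 B3"
    and v: "v0 \<in> hom M T0 B0" "v1 \<in> hom M T1 B1" "v2 \<in> hom M T2 B2" "v3 \<in> hom M T3 B3"
    and eqs: "t3 \<cdot> t1 = t4 \<cdot> t2" "b3 \<cdot> b1 = b4 \<cdot> b2" "v1 \<cdot> t1 = b1 \<cdot> v0" "v2 \<cdot> t2 = b2 \<cdot> v0"
      "v3 \<cdot> t3 = b3 \<cdot> v1" "v3 \<cdot> t4 = b4 \<cdot> v2"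
  shows "hcomm_cube M t1 t2 t3 t4 (const_homotopy i0 i1 c (t3 \<cdot> t1)) b1 b2 b3 b4 (const_homotopy l0 l1 g (b3 \<cdot> b1))
     v0 v1 v2 v3 (const_homotopy i0 i1 c (v1 \<cdot> t1)) (const_homotopy i0 i1 c (v2 \<cdot> t2))
     (const_homotopy j0 j1 d (v3 \<cdot> t3)) (const_homotopy k0 k1 e (v3 \<cdot> t4))"
proof -
  note c = cylinder_typing[OF cyl(1)]
  define \<theta> where "\<theta> = v3 \<cdot> (t3 \<cdot> t1)"
  have \<theta>: "\<theta> \<in> hom M T0 B3" unfolding \<theta>_def by (rule comp_hom[OF comp_hom[OF t(1,3)] v(4)])
  have T0: "T0 \<in> Obj M" "Id M T0 \<in> hom M T0 T0" "Id M T0 \<in> Weq M"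
    using bif bifibrant_obj id_hom id_tcof by auto
  have faces: "(v3 \<cdot> t4) \<cdot> t2 = \<theta>" "b4 \<cdot> (v2 \<cdot> t2) = \<theta>" "(v3 \<cdot> t3) \<cdot> t1 = \<theta>" "b3 \<cdot> (v1 \<cdot> t1) = \<theta>" "(b3 \<cdot> b1) \<cdot> v0 = \<theta>"
  proof -
    show 1: "(v3 \<cdot> t4) \<cdot> t2 = \<theta>" unfolding \<theta>_def eqs(1) by (rule comp_assoc[OF t(2,4) v(4)])
    show 2: "(v3 \<cdot> t3) \<cdot> t1 = \<theta>" unfolding \<theta>_def by (rule comp_assoc[OF t(1,3) v(4)])
    show "b4 \<cdot> (v2 \<cdot> t2) = \<theta>" using 1 comp_assoc[OF t(2) v(3) b(4)] eqs(6) by simp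
    show 3: "b3 \<cdot> (v1 \<cdot> t1) = \<theta>" using 2 comp_assoc[OF t(1) v(2) b(3)] eqs(5) by simp
    show "(b3 \<cdot> b1) \<cdot> v0 = \<theta>" using 3 comp_assoc[OF v(1) b(1,3)] eqs(3) by simp
  qed
  have tr: "traces M (Id M T0) \<theta> \<lparr>end0 = i0, end1 = i1, proj = c, hmap = \<theta> \<cdot> c\<rparr> (Id M T0) (Id M T0)"
    unfolding traces_def using c T0 id_comp[OF c(3)] by (intro bexI[of _ c]) (auto simp: in_hom)
  have hm: "v3 \<cdot> ((t3 \<cdot> t1) \<cdot> c) = \<theta> \<cdot> c" "((v3 \<cdot> t4) \<cdot> t2) \<cdot> c = \<theta> \<cdot> c" "b4 \<cdot> ((v2 \<cdot> t2) \<cdot> c) = \<theta> \<cdot> c"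
    "((v3 \<cdot> t3) \<cdot> t1) \<cdot> c = \<theta> \<cdot> c" "b3 \<cdot> ((v1 \<cdot> t1) \<cdot> c) = \<theta> \<cdot> c" "((b3 \<cdot> b1) \<cdot> v0) \<cdot> c = \<theta> \<cdot> c"
    using faces comp_assoc[OF c(3) comp_hom[OF t(1,3)] v(4)] comp_assoc[OF c(3) comp_hom[OF t(2) v(3)] b(4)]
      comp_assoc[OF c(3) comp_hom[OF t(1) v(2)] b(3)] by (simp_all add: \<theta>_def)
  have "compatible_chains M (postcompose M v3 (const_homotopy i0 i1 c (t3 \<cdot> t1)))
      (const_homotopy i0 i1 c ((v3 \<cdot> t4) \<cdot> t2)) (postcompose M b4 (const_homotopy i0 i1 c (v2 \<cdot> t2)))
      (const_homotopy i0 i1 c ((v3 \<cdot> t3) \<cdot> t1)) (postcompose M b3 (const_homotopy i0 i1 c (v1 \<cdot> t1)))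
      (const_homotopy i0 i1 c ((b3 \<cdot> b1) \<cdot> v0))"
    unfolding compatible_chains_def postcompose_def homotopy.simps hm
    using tr T0 \<theta> c(3) comp_hom[OF c(3) \<theta>]
    by (intro exI[of _ "Id M T0"] exI[of _ \<theta>]) (simp add: in_hom)
  then show ?thesis
    unfolding hcomm_cube_def
    using hcomm_square_const[OF cyl(1) bif(1-4) t eqs(1)] hcomm_square_const[OF cyl(4) bif(5-8) b eqs(2)]
      hcomm_square_const[OF cyl(1) bif(1,2,5,6) t(1) v(1,2) b(1) eqs(3)]
      hcomm_square_const[OF cyl(1) bif(1,3,5,7) t(2) v(1,3) b(2) eqs(4)]
      hcomm_square_const[OF cyl(2) bif(2,4,6,8) t(3) v(2,4) b(3) eqs(5)]
      hcomm_square_const[OF cyl(3) bif(3,4,7,8) t(4) v(3,4) b(4) eqs(6)]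
      precomposite_const[OF cyl(2,1) t(1) comp_hom[OF t(3) v(4)]]
      precomposite_const[OF cyl(3,1) t(2) comp_hom[OF t(4) v(4)]]
      precomposite_const[OF cyl(4,1) v(1) comp_hom[OF b(1,3)]]
    by blast
qed

text \<open>The square formed by the first projections of \<open>B0 \<times> Y\<close> and \<open>B1 \<times> Y\<close> is a homotopy pullback:
  factor the base map as a section \<open>n\<close> of a trivial fibration followed by a fibration \<open>N \<rightarrow> B1\<close>;
  the pullback is then trivially fibred over \<open>N \<times> Y\<close>, hence over \<open>B0 \<times> Y\<close>.\<close>

lemma homotopy_pullback_product:
  assumes cyl: "is_cylinder M T0 i0 i1 c"
    and bif: "bifibrant M T0" "bifibrant M T1" "bifibrant M B0" "bifibrant M B1"
    and x0: "x0 \<in> hom M T0 B0" "y0 \<in> hom M T0 Y" "pairing_in (Weq M) x0 y0"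
    and x1: "x1 \<in> hom M T1 B1" "y1 \<in> hom M T1 Y" "pairing_in tfib x1 y1"
    and f: "f \<in> hom M T0 T1" and b: "b \<in> hom M B0 B1" and eqs: "x1 \<cdot> f = b \<cdot> x0" "y1 \<cdot> f = y0"
  shows "homotopy_pullback M f x0 x1 b (const_homotopy i0 i1 c (x1 \<cdot> f))"
proof -
  note c = cylinder_typing[OF cyl]
  have o: "B0 \<in> Obj M" and fib: "fibrant M B0" "fibrant M B1"
    using bif bifibrant_obj by (auto simp: bifibrant_def)
  obtain N n s b' where n: "n \<in> hom M B0 N" "n \<in> tcof" and s: "s \<in> hom M N B0" "b' \<in> hom M N B1"
    "s \<cdot> n = Id M B0" "b' \<cdot> n = b" "pairing_in (Fib M) s b'"
    using pairing_factor_tcof[OF id_hom[OF o] b] .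
  have s_fib: "s \<in> Fib M" "b' \<in> Fib M"
    using pairing_fib_components(1)[OF s(1,2,5) fib(2)]
      pairing_fib_components(1)[OF s(2,1) pairing_sym[OF s(1,2,5)] fib(1)] .
  have s_tfib: "s \<in> tfib"
    using s_fib weq_section[OF n(1) s(1,3)] n(2) by simp
  obtain P p q where pb: "is_pullback M x1 b' p q" and pq: "p \<in> hom M P T1" "q \<in> hom M P N" "x1 \<cdot> p = b' \<cdot> q"
    using pullback_obtain[OF x1(1) s(2)] .
  have "x1 \<cdot> f = b' \<cdot> (n \<cdot> x0)"
    using comp_assoc[OF x0(1) n(1) s(2)] s(4) eqs(1) by simp
  then obtain u where u: "u \<in> hom M T0 P" "p \<cdot> u = f" "q \<cdot> u = n \<cdot> x0"
    using pullback_induced[OF pb pq(1,2) f comp_hom[OF x0(1) n(1)]] by blast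
  have sq: "s \<cdot> q \<in> hom M P B0" and yp: "y1 \<cdot> p \<in> hom M P Y"
    using comp_hom[OF pq(2) s(1)] comp_hom[OF pq(1) x1(2)] .
  have "pairing_in tfib (s \<cdot> q) (y1 \<cdot> p)"
  proof (rule pairing_tfibI[OF sq yp])
    fix E F i a v w assume i: "i \<in> hom M E F" "i \<in> Cof M" and a: "a \<in> hom M E P" and v: "v \<in> hom M F B0"
      and w: "w \<in> hom M F Y" and eq: "(s \<cdot> q) \<cdot> a = v \<cdot> i" "(y1 \<cdot> p) \<cdot> a = w \<cdot> i"
    have "s \<cdot> (q \<cdot> a) = v \<cdot> i" using comp_assoc[OF a pq(2) s(1)] eq by simp
    then obtain l where l: "l \<in> hom M F N" "l \<cdot> i = q \<cdot> a" "s \<cdot> l = v"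
      using lift_tfib[OF i s(1) s_tfib comp_hom[OF a pq(2)] v] by blast
    have "x1 \<cdot> (p \<cdot> a) = (b' \<cdot> l) \<cdot> i" "y1 \<cdot> (p \<cdot> a) = w \<cdot> i"
      using comp_assoc[OF a pq(1) x1(1)] comp_assoc[OF a pq(2) s(2)] comp_assoc[OF i(1) l(1) s(2)]
        comp_assoc[OF a pq(1) x1(2)] pq(3) l(2) eq by simp_all
    then obtain k where k: "k \<in> hom M F T1" "k \<cdot> i = p \<cdot> a" "x1 \<cdot> k = b' \<cdot> l" "y1 \<cdot> k = w"
      using pairing_tfib_lift[OF x1 i comp_hom[OF a pq(1)] comp_hom[OF l(1) s(2)] w] by blast
    obtain z where z: "z \<in> hom M F P" "p \<cdot> z = k" "q \<cdot> z = l"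
      using pullback_induced[OF pb pq(1,2) k(1) l(1) k(3)] .
    have "z \<cdot> i = a"
      by (rule pullback_ext[OF pb comp_hom[OF i(1) z(1)] a pq(1)])
        (use comp_assoc[OF i(1) z(1) pq(1)] comp_assoc[OF i(1) z(1) pq(2)] z k l in simp_all)
    then show "\<exists>z \<in> hom M F P. z \<cdot> i = a \<and> (s \<cdot> q) \<cdot> z = v \<and> (y1 \<cdot> p) \<cdot> z = w"
      using z k l comp_assoc[OF z(1) pq(2) s(1)] comp_assoc[OF z(1) pq(1) x1(2)] by auto
  qed
  then have "pairing_in (Weq M) (s \<cdot> q) (y1 \<cdot> p)"
    by (rule pairing_tfib_imp(1))
  moreover have "(s \<cdot> q) \<cdot> u = x0" "(y1 \<cdot> p) \<cdot> u = y0"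
    using comp_assoc[OF u(1) pq(2) s(1)] comp_assoc[OF x0(1) n(1) s(1)] comp_assoc[OF u(1) pq(1) x1(2)]
      u s(3) eqs id_comp[OF x0(1)] by simp_all
  ultimately have u_weq: "u \<in> Weq M"
    using pairing_weq_comp(1)[OF sq yp u(1)] x0(3) by simp
  define G where "G = (n \<cdot> x0) \<cdot> c"
  have nx: "n \<cdot> x0 \<in> hom M T0 N" by (rule comp_hom[OF x0(1) n(1)])
  have G: "G \<in> hom M (Dom M c) N" "G \<cdot> i0 = n \<cdot> x0" "G \<cdot> i1 = n \<cdot> x0" "b' \<cdot> G = (x1 \<cdot> f) \<cdot> c"
    unfolding G_def
    using comp_hom[OF c(3) nx] comp_assoc[OF c(1,3) nx] comp_assoc[OF c(2,3) nx] c(5,6) comp_id[OF nx]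
      comp_assoc[OF c(3) nx s(2)] comp_assoc[OF x0(1) n(1) s(2)] s(4) eqs(1) by simp_all
  have sq': "hcomm_square M f x0 x1 b (const_homotopy i0 i1 c (x1 \<cdot> f))"
    by (rule hcomm_square_const[OF cyl bif f x0(1) x1(1) b eqs(1)])
  have ends: "Cod M b' = Cod M b" "Dom M b = B0" "Dom M b' = N" "Dom M f = T0" "Dom M p = P"
    using s(2) b f pq(1) by (simp_all add: in_hom)
  have nu: "n \<in> hom M B0 N \<inter> Weq M" "u \<in> hom M T0 P \<inter> Weq M" "q \<cdot> u = G \<cdot> i0"
    using n u u_weq G(2) by auto
  show ?thesis
    unfolding homotopy_pullback_def homotopy.simps ends
    by (rule conjI[OF sq'], rule exI[of _ n], rule exI[of _ b'], rule exI[of _ G], rule exI[of _ p],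
        rule exI[of _ q], rule exI[of _ u], unfold ends, intro conjI)
      (fact s_fib s(4) G pb u(2) nu refl)+
qed

end

text \<open>\<open>S\<close> is the suspension of \<open>R\<close>, presented up to weak equivalence as the quotient \<open>SQ\<close> of a cone \<open>C\<close> by its base.\<close>

locale suspension_presentation = pointed_model_category M pt
  for M :: "('o, 'a) model_category" (structure) and pt :: 'o +
  fixes R C S SQ :: 'o and i \<kappa> \<kappa>0 \<psi> :: 'a
  assumes cube: "cube_axiom M"
    and bif: "bifibrant M R" "bifibrant M C" "bifibrant M S"
    and i: "i \<in> hom M R C" "i \<in> Cof M"
    and contractible: "zmap C pt \<in> tfib"
    and SQ: "is_pushout M i (zmap R pt) \<kappa> \<kappa>0" "\<kappa> \<in> hom M C SQ" "\<kappa>0 \<in> hom M pt SQ"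
    and \<psi>: "\<psi> \<in> hom M SQ S" "\<psi> \<in> Weq M"
begin

definition \<phi> :: 'a where "\<phi> = \<psi> \<cdot> \<kappa>"

lemma objs: "R \<in> Obj M" "C \<in> Obj M" "S \<in> Obj M" "SQ \<in> Obj M"
  using bif bifibrant_obj hom_objs[OF SQ(2)] by auto

lemma cofs: "cofibrant M R" "cofibrant M C" "cofibrant M S"
  using bif by (auto simp: bifibrant_def)

lemma \<phi>_hom: "\<phi> \<in> hom M C S"
  unfolding \<phi>_def by (rule comp_hom[OF SQ(2) \<psi>(1)])

lemma \<kappa>i: "\<kappa> \<cdot> i = zmap R SQ"
  using pushout_comm[OF SQ(1)] SQ(3) objs by (simp add: in_hom)

lemma \<phi>i: "\<phi> \<cdot> i = zmap R S"
  unfolding \<phi>_def using comp_assoc[OF i(1) SQ(2) \<psi>(1)] \<kappa>i \<psi>(1) objs by (simp add: in_hom)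

text \<open>The product with \<open>Y\<close> preserves the homotopy pushout of \<open>C \<leftarrow> R \<rightarrow> pt\<close>. The cube axiom is about
  bifibrant objects, whereas \<open>P0\<close>, \<open>P1\<close> and \<open>P3\<close> need not be fibrant. The cube is therefore built on a
  trivial fibration \<open>Q0 \<rightarrow> R \<times> Y\<close>, extended to \<open>Q1\<close> and \<open>Q3\<close> along cofibrations so that it commutes
  strictly, and compared with the given pushout by the gluing lemma.\<close>

lemma product_preserves_suspension:
  assumes Y: "bifibrant M Y" and P0: "cofibrant M P0"
    and x0: "x0 \<in> hom M P0 R" "y0 \<in> hom M P0 Y" "pairing_in (Weq M) x0 y0"
    and x1: "x1 \<in> hom M P1 C" "y1 \<in> hom M P1 Y" "pairing_in (Weq M) x1 y1"
    and f1: "f1 \<in> hom M P0 P1" "f1 \<in> Cof M" and eqs: "x1 \<cdot> f1 = i \<cdot> x0" "y1 \<cdot> f1 = y0"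
    and P3: "is_pushout M f1 y0 g1 g2" "g1 \<in> hom M P1 P3" "g2 \<in> hom M Y P3"
    and x3: "x3 \<in> hom M P3 S" "x3 \<cdot> g1 = \<phi> \<cdot> x1" "x3 \<cdot> g2 = zmap Y S"
    and y3: "y3 \<in> hom M P3 Y" "y3 \<cdot> g1 = y1" "y3 \<cdot> g2 = Id M Y"
  shows "pairing_in (Weq M) x3 y3"
proof -
  have Yo: "Y \<in> Obj M" and Yf: "fibrant M Y" "cofibrant M Y" and fib: "fibrant M R" "fibrant M C" "fibrant M S"
    using Y bif bifibrant_obj by (auto simp: bifibrant_def)
  have idY: "Id M Y \<in> hom M Y Y" "Id M Y \<in> Weq M" using Yo id_hom id_tcof by auto
  obtain Q0 j0 a0 b0 where Q0: "j0 \<in> hom M P0 Q0" "j0 \<in> Cof M" "a0 \<in> hom M Q0 R" "b0 \<in> hom M Q0 Y"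
    "a0 \<cdot> j0 = x0" "b0 \<cdot> j0 = y0" "pairing_in tfib a0 b0"
    using pairing_factor_cof[OF x0(1,2)] .
  have Q0w: "pairing_in (Weq M) a0 b0" "pairing_in (Fib M) a0 b0"
    using pairing_tfib_imp[OF Q0(7)] .
  have j0w: "j0 \<in> Weq M"
    using pairing_weq_comp(1)[OF Q0(3,4,1) Q0w(1)] Q0(5,6) x0(3) by simp
  have Q0_bif: "bifibrant M Q0"
    using cofibrant_cof[OF Q0(1,2) P0] pairing_fib_components(2)[OF Q0(3,4) Q0w(2) Yf(1) fib(1)]
    by (simp add: bifibrant_def)
  obtain N1 n1 m1 where N1: "is_pushout M f1 j0 n1 m1" "n1 \<in> hom M P1 N1" "m1 \<in> hom M Q0 N1" "n1 \<cdot> f1 = m1 \<cdot> j0"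
    using pushout_obtain[OF f1(1) Q0(1)] .
  have "x1 \<cdot> f1 = (i \<cdot> a0) \<cdot> j0" "y1 \<cdot> f1 = b0 \<cdot> j0"
    using comp_assoc[OF Q0(1,3) i(1)] Q0 eqs by simp_all
  then obtain a1' b1' where N1': "a1' \<in> hom M N1 C" "a1' \<cdot> n1 = x1" "a1' \<cdot> m1 = i \<cdot> a0"
    "b1' \<in> hom M N1 Y" "b1' \<cdot> n1 = y1" "b1' \<cdot> m1 = b0"
    using pushout_induced[OF N1(1,2,3) x1(1) comp_hom[OF Q0(3) i(1)]] pushout_induced[OF N1(1,2,3) x1(2) Q0(4)]
    by metis
  obtain Q1 j1 a1 b1 where Q1: "j1 \<in> hom M N1 Q1" "j1 \<in> Cof M" "a1 \<in> hom M Q1 C" "b1 \<in> hom M Q1 Y"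
    "a1 \<cdot> j1 = a1'" "b1 \<cdot> j1 = b1'" "pairing_in tfib a1 b1"
    using pairing_factor_cof[OF N1'(1,4)] .
  have Q1w: "pairing_in (Weq M) a1 b1" "pairing_in (Fib M) a1 b1"
    using pairing_tfib_imp[OF Q1(7)] .
  define t1 where "t1 = j1 \<cdot> m1"
  define r1 where "r1 = j1 \<cdot> n1"
  have t1: "t1 \<in> hom M Q0 Q1" "t1 \<in> Cof M" "a1 \<cdot> t1 = i \<cdot> a0" "b1 \<cdot> t1 = b0"
    unfolding t1_def
    using comp_hom[OF N1(3) Q1(1)] cof_comp[OF N1(3) Q1(1) cof_pushout[OF N1(1) f1(1) Q0(1) N1(2,3) f1(2)] Q1(2)]
      comp_assoc[OF N1(3) Q1(1,3)] comp_assoc[OF N1(3) Q1(1,4)] Q1 N1' by simp_all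
  have r1: "r1 \<in> hom M P1 Q1" "a1 \<cdot> r1 = x1" "b1 \<cdot> r1 = y1" "r1 \<cdot> f1 = t1 \<cdot> j0"
    unfolding r1_def t1_def
    using comp_hom[OF N1(2) Q1(1)] comp_assoc[OF N1(2) Q1(1,3)] comp_assoc[OF N1(2) Q1(1,4)]
      comp_assoc[OF f1(1) N1(2) Q1(1)] comp_assoc[OF Q0(1) N1(3) Q1(1)] Q1 N1' N1(4) by simp_all
  have r1w: "r1 \<in> Weq M"
    using pairing_weq_comp(1)[OF Q1(3,4) r1(1) Q1w(1)] r1 x1(3) by simp
  have Q1_bif: "bifibrant M Q1"
    using cofibrant_cof[OF t1(1,2)] Q0_bif pairing_fib_components(2)[OF Q1(3,4) Q1w(2) Yf(1) fib(2)]
    by (simp add: bifibrant_def)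
  obtain N3 h1 h2 where N3: "is_pushout M t1 b0 h1 h2" "h1 \<in> hom M Q1 N3" "h2 \<in> hom M Y N3" "h1 \<cdot> t1 = h2 \<cdot> b0"
    using pushout_obtain[OF t1(1) Q0(4)] .
  have "(\<phi> \<cdot> a1) \<cdot> t1 = zmap Y S \<cdot> b0"
    using comp_assoc[OF t1(1) Q1(3) \<phi>_hom] t1(3) comp_assoc[OF Q0(3) i(1) \<phi>_hom] \<phi>i Q0(3,4) objs Yo
    by (simp add: in_hom)
  then obtain a3' where a3': "a3' \<in> hom M N3 S" "a3' \<cdot> h1 = \<phi> \<cdot> a1" "a3' \<cdot> h2 = zmap Y S"
    using pushout_induced[OF N3(1,2,3) comp_hom[OF Q1(3) \<phi>_hom] zmap_hom[OF Yo objs(3)]] by blast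
  obtain b3' where b3': "b3' \<in> hom M N3 Y" "b3' \<cdot> h1 = b1" "b3' \<cdot> h2 = Id M Y"
    using pushout_induced[OF N3(1,2,3) Q1(4) idY(1)] t1(4) id_comp[OF Q0(4)] by auto
  obtain Q3 j3 a3 b3 where Q3: "j3 \<in> hom M N3 Q3" "j3 \<in> Cof M" "a3 \<in> hom M Q3 S" "b3 \<in> hom M Q3 Y"
    "a3 \<cdot> j3 = a3'" "b3 \<cdot> j3 = b3'" "pairing_in tfib a3 b3"
    using pairing_factor_cof[OF a3'(1) b3'(1)] .
  have Q3w: "pairing_in (Weq M) a3 b3" "pairing_in (Fib M) a3 b3"
    using pairing_tfib_imp[OF Q3(7)] .
  have N3c: "cofibrant M N3"
    using cofibrant_cof[OF N3(3) cof_pushout[OF N3(1) t1(1) Q0(4) N3(2,3) t1(2)] Yf(2)] .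
  have Q3_bif: "bifibrant M Q3"
    using cofibrant_cof[OF Q3(1,2) N3c] pairing_fib_components(2)[OF Q3(3,4) Q3w(2) Yf(1) fib(3)]
    by (simp add: bifibrant_def)
  define t3 where "t3 = j3 \<cdot> h1"
  define t4 where "t4 = j3 \<cdot> h2"
  have t3: "t3 \<in> hom M Q1 Q3" "a3 \<cdot> t3 = \<phi> \<cdot> a1" "b3 \<cdot> t3 = b1"
    unfolding t3_def
    using comp_hom[OF N3(2) Q3(1)] comp_assoc[OF N3(2) Q3(1,3)] comp_assoc[OF N3(2) Q3(1,4)] Q3 a3' b3' by simp_all
  have t4: "t4 \<in> hom M Y Q3" "a3 \<cdot> t4 = zmap pt S \<cdot> zmap Y pt" "b3 \<cdot> t4 = Id M Y" "t3 \<cdot> t1 = t4 \<cdot> b0"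
    unfolding t4_def t3_def
    using comp_hom[OF N3(3) Q3(1)] comp_assoc[OF N3(3) Q3(1,3)] comp_assoc[OF N3(3) Q3(1,4)]
      comp_assoc[OF t1(1) N3(2) Q3(1)] comp_assoc[OF Q0(4) N3(3) Q3(1)] Q3 a3' b3' N3(4) Yo objs by simp_all
  have base: "\<phi> \<cdot> i = zmap pt S \<cdot> zmap R pt" "zmap Y pt \<cdot> b0 = zmap R pt \<cdot> a0"
    using \<phi>i objs Yo Q0(3,4) by (simp_all add: in_hom)
  obtain i0 i1 c where cyl0: "is_cylinder M Q0 i0 i1 c" using cylinder_exists Q0_bif bifibrant_obj by blast
  obtain k0 k1 d where cyl1: "is_cylinder M Q1 k0 k1 d" using cylinder_exists Q1_bif bifibrant_obj by blast
  obtain l0 l1 e where cylY: "is_cylinder M Y l0 l1 e" using cylinder_exists Yo by blast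
  obtain o0 o1 g where cylR: "is_cylinder M R o0 o1 g" using cylinder_exists objs(1) by blast
  note z = zmap_hom[OF objs(1) pt_obj] zmap_hom[OF pt_obj objs(3)] zmap_hom[OF Yo pt_obj]
  have \<psi>\<kappa>0: "\<psi> \<cdot> \<kappa>0 = zmap pt S" by (rule eq_zmap(2)[OF comp_hom[OF SQ(3) \<psi>(1)]])
  have "hcomm_cube M t1 b0 t3 t4 (const_homotopy i0 i1 c (t3 \<cdot> t1)) i (zmap R pt) \<phi> (zmap pt S)
     (const_homotopy o0 o1 g (\<phi> \<cdot> i)) a0 a1 (zmap Y pt) a3
     (const_homotopy i0 i1 c (a1 \<cdot> t1)) (const_homotopy i0 i1 c (zmap Y pt \<cdot> b0))
     (const_homotopy k0 k1 d (a3 \<cdot> t3)) (const_homotopy l0 l1 e (a3 \<cdot> t4))"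
    by (rule strict_cube[OF cyl0 cyl1 cylY cylR Q0_bif Q1_bif Y Q3_bif bif(1,2) bifibrant_pt bif(3)
          t1(1) Q0(4) t3(1) t4(1) i(1) z(1) \<phi>_hom z(2) Q0(3) Q1(3) z(3) Q3(3) t4(4) base(1) t1(3) base(2) t3(2) t4(2)])
  moreover have "homotopy_pushout M i (zmap R pt) \<phi> (zmap pt S) (const_homotopy o0 o1 g (\<phi> \<cdot> i))"
    using homotopy_pushout_const_iff[OF cylR bif(1,2) bifibrant_pt bif(3) i z(1) \<phi>_hom z(2) base(1) SQ \<psi>(1)
        \<phi>_def[symmetric] \<psi>\<kappa>0] \<psi>(2) by simp
  moreover have "homotopy_pullback M t1 a0 a1 i (const_homotopy i0 i1 c (a1 \<cdot> t1))"
    by (rule homotopy_pullback_product[OF cyl0 Q0_bif Q1_bif bif(1,2) Q0(3,4) Q0w(1) Q1(3,4,7) t1(1) i(1) t1(3,4)])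
  moreover have "homotopy_pullback M b0 a0 (zmap Y pt) (zmap R pt) (const_homotopy i0 i1 c (zmap Y pt \<cdot> b0))"
    by (rule homotopy_pullback_product[OF cyl0 Q0_bif Y bif(1) bifibrant_pt Q0(3,4) Q0w(1) z(3) idY(1)
          pairing_zero_id[OF Yo] Q0(4) z(1) base(2) id_comp[OF Q0(4)]])
  moreover have "homotopy_pullback M t3 a1 a3 \<phi> (const_homotopy k0 k1 d (a3 \<cdot> t3))"
    by (rule homotopy_pullback_product[OF cyl1 Q1_bif Q3_bif bif(2,3) Q1(3,4) Q1w(1) Q3(3,4,7) t3(1) \<phi>_hom t3(2,3)])
  moreover have "homotopy_pullback M t4 (zmap Y pt) a3 (zmap pt S) (const_homotopy l0 l1 e (a3 \<cdot> t4))"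
    by (rule homotopy_pullback_product[OF cylY Y Q3_bif bifibrant_pt bif(3) z(3) idY(1)
          pairing_tfib_imp(1)[OF pairing_zero_id[OF Yo]] Q3(3,4,7) t4(1) z(2) t4(2,3)])
  ultimately have "homotopy_pushout M t1 b0 t3 t4 (const_homotopy i0 i1 c (t3 \<cdot> t1))"
    using cube unfolding cube_axiom_def by blast
  then have j3w: "j3 \<in> Weq M"
    using homotopy_pushout_const_iff[OF cyl0 Q0_bif Q1_bif Y Q3_bif t1(1,2) Q0(4) t3(1) t4(1,4) N3(1,2,3) Q3(1)
        t3_def[symmetric] t4_def[symmetric]] by simp
  then have N3w: "pairing_in (Weq M) a3' b3'"
    using pairing_weq_comp(2)[OF Q3(3,4,1)] Q3w Q3(5,6) by simp
  have "(h1 \<cdot> r1) \<cdot> f1 = h2 \<cdot> y0"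
    using comp_assoc[OF f1(1) r1(1) N3(2)] r1(4) comp_assoc[OF Q0(1) t1(1) N3(2)] N3(4) comp_assoc[OF Q0(1,4) N3(3)] Q0(6)
    by simp
  then obtain w where w: "w \<in> hom M P3 N3" "w \<cdot> g1 = h1 \<cdot> r1" "w \<cdot> g2 = h2"
    using pushout_induced[OF P3 comp_hom[OF r1(1) N3(2)] N3(3)] by blast
  have ww: "w \<in> Weq M"
    by (rule gluing[OF P3(1) f1(1) x0(2) P3(2,3) f1(2) N3(1) t1(1) Q0(4) N3(2,3) t1(2) P0 Yf(2) _ Yf(2)
          Q0(1) j0w r1(1) r1w idY r1(4) _ w(1,2)])
      (use Q0_bif Q0(6) id_comp[OF x0(2)] comp_id[OF N3(3)] w(3) in \<open>simp_all add: bifibrant_def\<close>)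
  have "a3' \<cdot> w = x3"
    by (rule pushout_ext[OF P3(1) comp_hom[OF w(1) a3'(1)] x3(1) P3(2)])
      (use comp_assoc[OF P3(2) w(1) a3'(1)] comp_assoc[OF P3(3) w(1) a3'(1)] comp_assoc[OF r1(1) N3(2) a3'(1)]
        comp_assoc[OF r1(1) Q1(3) \<phi>_hom] w a3' r1 x3 in simp_all)
  moreover have "b3' \<cdot> w = y3"
    by (rule pushout_ext[OF P3(1) comp_hom[OF w(1) b3'(1)] y3(1) P3(2)])
      (use comp_assoc[OF P3(2) w(1) b3'(1)] comp_assoc[OF P3(3) w(1) b3'(1)] comp_assoc[OF r1(1) N3(2) b3'(1)]
        w b3' r1 y3 in simp_all)
  ultimately show ?thesis
    using pairing_weq_comp(2)[OF a3'(1) b3'(1) w(1) ww] N3w by simp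
qed

end

section \<open>Attaching a cone\<close>

context pointed_model_category
begin

lemma quotient_induced:
  assumes po: "is_pushout M f (zmap Z pt) u v" and t: "f \<in> hom M Z A" "u \<in> hom M A P" "v \<in> hom M pt P"
    and x: "x \<in> hom M A T" "x \<cdot> f = zmap Z T"
  obtains w where "w \<in> hom M P T" "w \<cdot> u = x"
proof -
  have o: "Z \<in> Obj M" "T \<in> Obj M" using hom_objs[OF t(1)] hom_objs[OF x(1)] by auto
  have "x \<cdot> f = zmap pt T \<cdot> zmap Z pt" using o x by simp
  then show thesis
    using pushout_induced[OF po t(2,3) x(1) zmap_hom[OF pt_obj o(2)]] that by blast
qed

lemma quotient_ext:
  assumes po: "is_pushout M f (zmap Z pt) u v" and t: "u \<in> hom M A P" "v \<in> hom M pt P"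
    and w: "w \<in> hom M P T" "w' \<in> hom M P T" "w \<cdot> u = w' \<cdot> u"
  shows "w = w'"
  by (rule pushout_ext[OF po w(1,2) t(1) w(3)])
    (rule zmap_pt_unique(2)[OF comp_hom[OF t(2) w(1)] comp_hom[OF t(2) w(2)]])

text \<open>One stage of the strong relative category: \<open>T\<close> is obtained from \<open>Y0 \<simeq> Y\<close> by attaching a cone
  \<open>L\<close> along \<open>K \<rightarrow> Y0\<close>. The stage is given by a fibrant replacement \<open>Z\<close> of the coproduct of \<open>A\<close>
  and \<open>K\<close>, with \<open>\<rho> = (id, 0)\<close> and \<open>\<tau> = (\<iota>, k)\<close>: replacing \<open>A\<close> by the coproduct of \<open>A\<close> and \<open>L\<close> shows
  that the homotopy pushout of \<open>\<rho>\<close> and \<open>\<tau>\<close> attaches just the cone. The map \<open>A \<rightarrow> Z\<close> is a strict common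
  section.\<close>

lemma cone_stage:
  assumes bif: "bifibrant M A" "bifibrant M Y" "bifibrant M T" and \<iota>: "\<iota> \<in> hom M A Y"
    and Y0: "cofibrant M Y0" and y: "y \<in> hom M Y0 Y" "y \<in> Weq M"
    and K: "cofibrant M K" and j: "j \<in> hom M K L" "j \<in> Cof M" and L: "zmap L pt \<in> Weq M"
    and k0: "k0 \<in> hom M K Y0"
    and Q: "is_pushout M j k0 l0 u0" "l0 \<in> hom M L Q" "u0 \<in> hom M Y0 Q"
    and q: "q \<in> hom M Q T" "q \<in> Weq M" and \<chi>: "\<chi> \<in> hom M Y T" and qu: "q \<cdot> u0 = \<chi> \<cdot> y"
  shows "\<exists>Z \<rho> \<tau> h \<sigma>. \<rho> \<in> hom M Z A \<and> \<tau> \<in> hom M Z Y \<and> homotopy_pushout M \<rho> \<tau> (\<chi> \<cdot> \<iota>) \<chi> h \<and>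
    \<sigma> \<in> hom M A Z \<and> \<rho> \<cdot> \<sigma> = Id M A \<and> \<tau> \<cdot> \<sigma> = \<iota>"
proof -
  have o: "A \<in> Obj M" "Y \<in> Obj M" "T \<in> Obj M" "Y0 \<in> Obj M" "K \<in> Obj M" "L \<in> Obj M"
    using bif bifibrant_obj hom_objs[OF j(1)] hom_objs[OF y(1)] by auto
  have cof: "cofibrant M A" "cofibrant M Y" "cofibrant M L" and fib: "fibrant M A" "fibrant M Y" "fibrant M T"
    using bif cofibrant_cof[OF j K] by (auto simp: bifibrant_def)
  define k where "k = y \<cdot> k0"
  define l where "l = q \<cdot> l0"
  have k: "k \<in> hom M K Y" and l: "l \<in> hom M L T"
    unfolding k_def l_def using comp_hom[OF k0 y(1)] comp_hom[OF Q(2) q(1)] .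
  have lj: "l \<cdot> j = \<chi> \<cdot> k"
    unfolding k_def l_def
    using comp_assoc[OF j(1) Q(2) q(1)] comp_assoc[OF k0 Q(3) q(1)] comp_assoc[OF k0 y(1) \<chi>] qu pushout_comm[OF Q(1)]
    by simp
  obtain V vA vK where V: "is_pushout M (zmap pt A) (zmap pt K) vA vK" "is_coproduct M vA vK"
    "vA \<in> hom M A V" "vK \<in> hom M K V"
    using coproduct_obtain[OF o(1,5)] .
  have Vc: "cofibrant M V"
    using cofibrant_cof[OF V(3) coproduct_cof(2)[OF V(1,3,4) K] cof(1)] .
  have Vo: "V \<in> Obj M" using hom_objs[OF V(3)] by simp
  obtain Z z zp where Z: "z \<in> hom M V Z" "z \<in> tcof" "zp \<in> hom M Z pt" "zp \<in> Fib M"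
    using factor_tcof_fib[OF zmap_hom[OF Vo pt_obj]] by metis
  have Zo: "Z \<in> Obj M" using hom_objs[OF Z(1)] by simp
  have Z_bif: "bifibrant M Z"
    using cofibrant_cof[OF Z(1) _ Vc] Z(2,4) eq_zmap(1)[OF Z(3)] Zo by (simp add: bifibrant_def fibrant_iff)
  obtain \<rho>0 where \<rho>0: "\<rho>0 \<in> hom M V A" "\<rho>0 \<cdot> vA = Id M A" "\<rho>0 \<cdot> vK = zmap K A"
    using coproduct_induced[OF V(2,3,4) id_hom[OF o(1)] zmap_hom[OF o(5,1)]] .
  obtain \<rho> where \<rho>: "\<rho> \<in> hom M Z A" "\<rho> \<cdot> z = \<rho>0"
    using fibrant_extend[OF fib(1) Z(1,2) \<rho>0(1)] .
  obtain \<tau>0 where \<tau>0: "\<tau>0 \<in> hom M V Y" "\<tau>0 \<cdot> vA = \<iota>" "\<tau>0 \<cdot> vK = k"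
    using coproduct_induced[OF V(2,3,4) \<iota> k] .
  obtain \<tau> where \<tau>: "\<tau> \<in> hom M Z Y" "\<tau> \<cdot> z = \<tau>0"
    using fibrant_extend[OF fib(2) Z(1,2) \<tau>0(1)] .
  define \<sigma> where "\<sigma> = z \<cdot> vA"
  define zK where "zK = z \<cdot> vK"
  have \<sigma>: "\<sigma> \<in> hom M A Z" "\<rho> \<cdot> \<sigma> = Id M A" "\<tau> \<cdot> \<sigma> = \<iota>"
    unfolding \<sigma>_def using comp_hom[OF V(3) Z(1)] comp_assoc[OF V(3) Z(1) \<rho>(1)] comp_assoc[OF V(3) Z(1) \<tau>(1)] \<rho> \<rho>0 \<tau> \<tau>0
    by simp_all
  have zK: "zK \<in> hom M K Z" "\<rho> \<cdot> zK = zmap K A" "\<tau> \<cdot> zK = k"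
    unfolding zK_def using comp_hom[OF V(4) Z(1)] comp_assoc[OF V(4) Z(1) \<rho>(1)] comp_assoc[OF V(4) Z(1) \<tau>(1)] \<rho> \<rho>0 \<tau> \<tau>0
    by simp_all
  obtain N0 lN n0 where N0: "is_pushout M j zK lN n0" "lN \<in> hom M L N0" "n0 \<in> hom M Z N0" "lN \<cdot> j = n0 \<cdot> zK"
    using pushout_obtain[OF j(1) zK(1)] .
  have n0c: "n0 \<in> Cof M" by (rule cof_pushout[OF N0(1) j(1) zK(1) N0(2,3) j(2)])
  have "zmap L A \<cdot> j = \<rho> \<cdot> zK" using zK(2) j(1) o by (simp add: in_hom)
  then obtain \<pi>0 where \<pi>0: "\<pi>0 \<in> hom M N0 A" "\<pi>0 \<cdot> lN = zmap L A" "\<pi>0 \<cdot> n0 = \<rho>"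
    using pushout_induced[OF N0(1,2,3) zmap_hom[OF o(6,1)] \<rho>(1)] by blast
  define s0 where "s0 = n0 \<cdot> \<sigma>"
  have s0: "s0 \<in> hom M A N0" "\<pi>0 \<cdot> s0 = Id M A"
    unfolding s0_def using comp_hom[OF \<sigma>(1) N0(3)] comp_assoc[OF \<sigma>(1) N0(3) \<pi>0(1)] \<pi>0 \<sigma> by simp_all
  have "s0 \<in> tcof"
  proof (rule tcofI[OF s0(1)])
    fix E F p a b assume p: "p \<in> hom M E F" "p \<in> Fib M" and a: "a \<in> hom M A E" and b: "b \<in> hom M N0 F"
      and eq: "p \<cdot> a = b \<cdot> s0"
    have Eo: "E \<in> Obj M" "F \<in> Obj M" using hom_objs[OF p(1)] by auto
    have ptL: "zmap pt L \<in> tcof" by (rule contractible_tcof[OF cof(3) L])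
    have "p \<cdot> zmap pt E = (b \<cdot> lN) \<cdot> zmap pt L"
      using p(1) b N0(2) o Eo by (simp add: in_hom)
    then obtain aL where aL: "aL \<in> hom M L E" "p \<cdot> aL = b \<cdot> lN"
      using lift_tcof[OF zmap_hom[OF pt_obj o(6)] ptL p zmap_hom[OF pt_obj Eo(1)] comp_hom[OF N0(2) b]] by blast
    obtain aV where aV: "aV \<in> hom M V E" "aV \<cdot> vA = a" "aV \<cdot> vK = aL \<cdot> j"
      using coproduct_induced[OF V(2,3,4) a comp_hom[OF j(1) aL(1)]] .
    have "p \<cdot> aV = (b \<cdot> n0) \<cdot> z"
    proof (rule coproduct_ext[OF V(2,3,4) comp_hom[OF aV(1) p(1)] comp_hom[OF Z(1) comp_hom[OF N0(3) b]]])
      show "(p \<cdot> aV) \<cdot> vA = ((b \<cdot> n0) \<cdot> z) \<cdot> vA"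
        using comp_assoc[OF V(3) aV(1) p(1)] comp_assoc[OF V(3) Z(1) comp_hom[OF N0(3) b]] comp_assoc[OF \<sigma>(1) N0(3) b]
          aV(2) eq by (simp add: s0_def \<sigma>_def)
      show "(p \<cdot> aV) \<cdot> vK = ((b \<cdot> n0) \<cdot> z) \<cdot> vK"
        using comp_assoc[OF V(4) aV(1) p(1)] comp_assoc[OF V(4) Z(1) comp_hom[OF N0(3) b]] comp_assoc[OF zK(1) N0(3) b]
          comp_assoc[OF j(1) aL(1) p(1)] comp_assoc[OF j(1) N0(2) b] aV(3) aL(2) N0(4) by (simp add: zK_def)
    qed
    then obtain aZ where aZ: "aZ \<in> hom M Z E" "aZ \<cdot> z = aV" "p \<cdot> aZ = b \<cdot> n0"
      using lift_tcof[OF Z(1,2) p aV(1) comp_hom[OF N0(3) b]] by blast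
    have "aL \<cdot> j = aZ \<cdot> zK"
      unfolding zK_def using comp_assoc[OF V(4) Z(1) aZ(1)] aZ(2) aV(3) by simp
    then obtain aN where aN: "aN \<in> hom M N0 E" "aN \<cdot> lN = aL" "aN \<cdot> n0 = aZ"
      using pushout_induced[OF N0(1,2,3) aL(1) aZ(1)] by blast
    have "aN \<cdot> s0 = a"
      unfolding s0_def \<sigma>_def
      using comp_assoc[OF comp_hom[OF V(3) Z(1)] N0(3) aN(1)] comp_assoc[OF V(3) Z(1) aZ(1)] aN(3) aZ(2) aV(2) by simp
    moreover have "p \<cdot> aN = b"
      by (rule pushout_ext[OF N0(1) comp_hom[OF aN(1) p(1)] b N0(2)])
        (use comp_assoc[OF N0(2) aN(1) p(1)] comp_assoc[OF N0(3) aN(1) p(1)] aN aL aZ in simp_all)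
    ultimately show "\<exists>l \<in> hom M N0 E. l \<cdot> s0 = a \<and> p \<cdot> l = b" using aN(1) by blast
  qed
  then have \<pi>0w: "\<pi>0 \<in> Weq M" using weq_section[OF s0(1) \<pi>0(1) s0(2)] by simp
  obtain N m \<pi> where N: "m \<in> hom M N0 N" "m \<in> Cof M" "\<pi> \<in> hom M N A" "\<pi> \<in> tfib" "\<pi> \<cdot> m = \<pi>0"
    using factor_cof_tfib[OF \<pi>0(1)] .
  have mt: "m \<in> tcof" using two_of_three(3)[OF N(1,3)] N \<pi>0w by simp
  define n where "n = m \<cdot> n0"
  define s where "s = m \<cdot> s0"
  have n: "n \<in> hom M Z N" "n \<in> Cof M" "\<pi> \<cdot> n = \<rho>"
    unfolding n_def using comp_hom[OF N0(3) N(1)] cof_comp[OF N0(3) N(1) n0c N(2)] comp_assoc[OF N0(3) N(1,3)] N(5) \<pi>0(3)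
    by simp_all
  have s: "s \<in> hom M A N" "\<pi> \<cdot> s = Id M A"
    unfolding s_def using comp_hom[OF s0(1) N(1)] comp_assoc[OF s0(1) N(1,3)] N(5) s0(2) by simp_all
  have "l \<cdot> j = (\<chi> \<cdot> \<tau>) \<cdot> zK"
    using comp_assoc[OF zK(1) \<tau>(1) \<chi>] zK(3) lj by simp
  then obtain e0 where e0: "e0 \<in> hom M N0 T" "e0 \<cdot> lN = l" "e0 \<cdot> n0 = \<chi> \<cdot> \<tau>"
    using pushout_induced[OF N0(1,2,3) l comp_hom[OF \<tau>(1) \<chi>]] by blast
  obtain e where e: "e \<in> hom M N T" "e \<cdot> m = e0"
    using fibrant_extend[OF fib(3) N(1) mt e0(1)] .
  have en: "e \<cdot> n = \<chi> \<cdot> \<tau>"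
    unfolding n_def using comp_assoc[OF N0(3) N(1) e(1)] e e0 by simp
  have es: "e \<cdot> s = \<chi> \<cdot> \<iota>"
    unfolding s_def s0_def using comp_assoc[OF comp_hom[OF \<sigma>(1) N0(3)] N(1) e(1)] comp_assoc[OF \<sigma>(1) N0(3) e0(1)]
      comp_assoc[OF \<sigma>(1) \<tau>(1) \<chi>] e e0 \<sigma> by simp
  obtain Q2 a b where Q2: "is_pushout M n \<tau> a b" "a \<in> hom M N Q2" "b \<in> hom M Y Q2" "a \<cdot> n = b \<cdot> \<tau>"
    using pushout_obtain[OF n(1) \<tau>(1)] .
  obtain P lP uP where P: "is_pushout M j k lP uP" "lP \<in> hom M L P" "uP \<in> hom M Y P" "lP \<cdot> j = uP \<cdot> k"
    using pushout_obtain[OF j(1) k] .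
  have "lP \<cdot> j = (uP \<cdot> \<tau>) \<cdot> zK"
    using comp_assoc[OF zK(1) \<tau>(1) P(3)] zK(3) P(4) by simp
  then obtain w where w: "w \<in> hom M N0 P" "w \<cdot> lN = lP" "w \<cdot> n0 = uP \<cdot> \<tau>"
    using pushout_induced[OF N0(1,2,3) P(2) comp_hom[OF \<tau>(1) P(3)]] by blast
  have P': "is_pushout M n0 \<tau> w uP"
    by (rule pushout_cancel[OF N0(1) _ w(3) j(1) zK(1) N0(2,3) \<tau>(1) w(1) P(3)]) (use P(1) zK(3) w(2) in simp)
  have ids: "Id M Z \<in> hom M Z Z" "Id M Z \<in> Weq M" "Id M Y \<in> hom M Y Y" "Id M Y \<in> Weq M"
    "Id M K \<in> hom M K K" "Id M K \<in> Weq M" "Id M L \<in> hom M L L" "Id M L \<in> Weq M"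
    using id_hom id_tcof o Zo by auto
  have "(a \<cdot> m) \<cdot> n0 = b \<cdot> \<tau>"
    using comp_assoc[OF N0(3) N(1) Q2(2)] Q2(4) by (simp add: n_def)
  then obtain r where r: "r \<in> hom M P Q2" "r \<cdot> w = a \<cdot> m" "r \<cdot> uP = b"
    using pushout_induced[OF P' w(1) P(3) comp_hom[OF N(1) Q2(2)] Q2(3)] by blast
  have Zc: "cofibrant M Z" using Z_bif by (simp add: bifibrant_def)
  have rw: "r \<in> Weq M"
    by (rule gluing[OF P' N0(3) \<tau>(1) w(1) P(3) n0c Q2(1) n(1) \<tau>(1) Q2(2,3) n(2) Zc cof(2) Zc cof(2)
          ids(1,2) N(1) _ ids(3,4) _ _ r(1,2)])
      (use mt comp_id[OF n(1)] n_def id_comp[OF \<tau>(1)] comp_id[OF \<tau>(1)] comp_id[OF Q2(3)] r(3) in simp_all)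
  have "lP \<cdot> j = (uP \<cdot> y) \<cdot> k0"
    using comp_assoc[OF k0 y(1) P(3)] P(4) by (simp add: k_def)
  then obtain c where c: "c \<in> hom M Q P" "c \<cdot> l0 = lP" "c \<cdot> u0 = uP \<cdot> y"
    using pushout_induced[OF Q P(2) comp_hom[OF y(1) P(3)]] by blast
  have cw: "c \<in> Weq M"
    by (rule gluing[OF Q(1) j(1) k0 Q(2,3) j(2) P(1) j(1) k P(2,3) j(2) K Y0 K cof(2)
          ids(5,6,7,8) y _ _ c(1) _ c(3)])
      (use comp_id[OF j(1)] id_comp[OF j(1)] comp_id[OF k] k_def comp_id[OF P(2)] c(2) in simp_all)
  obtain t where t: "t \<in> hom M Q2 T" "t \<cdot> a = e" "t \<cdot> b = \<chi>"
    using pushout_induced[OF Q2(1,2,3) e(1) \<chi> en] .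
  have tr: "(t \<cdot> r) \<cdot> lP = l" "(t \<cdot> r) \<cdot> uP = \<chi>"
  proof -
    have "r \<cdot> lP = a \<cdot> (m \<cdot> lN)"
      using comp_assoc[OF N0(2) w(1) r(1)] comp_assoc[OF N0(2) N(1) Q2(2)] w(2) r(2) by simp
    then show "(t \<cdot> r) \<cdot> lP = l"
      using comp_assoc[OF P(2) r(1) t(1)] comp_assoc[OF comp_hom[OF N0(2) N(1)] Q2(2) t(1)] comp_assoc[OF N0(2) N(1) e(1)]
        t(2) e(2) e0(2) by simp
    show "(t \<cdot> r) \<cdot> uP = \<chi>"
      using comp_assoc[OF P(3) r(1) t(1)] r(3) t(3) by simp
  qed
  have tr_hom: "t \<cdot> r \<in> hom M P T" by (rule comp_hom[OF r(1) t(1)])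
  have "(t \<cdot> r) \<cdot> c = q"
  proof (rule pushout_ext[OF Q(1) comp_hom[OF c(1) tr_hom] q(1) Q(2)])
    show "((t \<cdot> r) \<cdot> c) \<cdot> l0 = q \<cdot> l0"
      using comp_assoc[OF Q(2) c(1) tr_hom] c(2) tr(1) by (simp add: l_def)
    show "((t \<cdot> r) \<cdot> c) \<cdot> u0 = q \<cdot> u0"
      using comp_assoc[OF Q(3) c(1) tr_hom] c(3) comp_assoc[OF y(1) P(3) tr_hom] tr(2) qu by simp
  qed
  then have "t \<cdot> r \<in> Weq M" using two_of_three(2)[OF c(1) tr_hom cw] q(2) by simp
  then have tw: "t \<in> Weq M" using two_of_three(2)[OF r(1) t(1) rw] by simp
  have "\<exists>h. homotopy_pushout M \<rho> \<tau> (e \<cdot> s) \<chi> h"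
    by (rule homotopy_pushoutI[OF Z_bif bif \<rho>(1) \<tau>(1) n(1,2) N(3,4) n(3) s e(1) \<chi> en Q2(1,2,3) t tw])
  then show ?thesis
    unfolding es using \<rho>(1) \<tau>(1) \<sigma> by blast
qed

end

section \<open>Decomposition of the square of a suspension\<close>

text \<open>The geometric meaning of the objects, all of them cofibrant and each given up to weak equivalence:
  \<open>A0\<close> is \<open>R \<times> R\<close>, \<open>A1\<close> is \<open>C \<times> R\<close>, \<open>E\<close> is \<open>S \<times> R\<close> (glued from \<open>C \<times> R\<close> and \<open>pt \<times> R\<close>), and \<open>B\<close> is
  \<open>S \<times> C\<close>. The join \<open>J\<close> of \<open>R\<close> with itself is the boundary \<open>C \<times> R \<union> R \<times> pt\<close> of the corner \<open>C \<times> pt\<close>,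
  and \<open>L\<close>, weakly equivalent to \<open>C\<close>, is the corner itself. In the complement \<open>D\<close> of the corner,
  the part \<open>pt \<times> R\<close> of \<open>S \<times> C\<close> is collapsed by the corner \<open>pt \<times> pt\<close>.\<close>

locale torus_decomposition = suspension_presentation M pt R C S SQ i \<kappa> \<kappa>0 \<psi>
  for M :: "('o, 'a) model_category" (structure) and pt R C S SQ :: 'o and i \<kappa> \<kappa>0 \<psi> :: 'a +
  fixes A0 A1 E B J L D :: 'o
    and a b f c e g1 g2 \<epsilon>S \<epsilon>R \<beta> bS bC j1 j2 j \<gamma> \<delta>B \<delta>0 :: 'a
  assumes A0: "cofibrant M A0" "a \<in> hom M A0 R" "b \<in> hom M A0 R" "pairing_in (Weq M) a b"
    and f: "f \<in> hom M A0 A1" "f \<in> Cof M"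
    and A1: "c \<in> hom M A1 C" "e \<in> hom M A1 R" "c \<cdot> f = i \<cdot> a" "e \<cdot> f = b" "pairing_in (Weq M) c e"
    and E: "is_pushout M f b g1 g2" "g1 \<in> hom M A1 E" "g2 \<in> hom M R E"
    and \<epsilon>: "\<epsilon>S \<in> hom M E S" "\<epsilon>S \<cdot> g1 = \<phi> \<cdot> c" "\<epsilon>S \<cdot> g2 = zmap R S"
      "\<epsilon>R \<in> hom M E R" "\<epsilon>R \<cdot> g1 = e" "\<epsilon>R \<cdot> g2 = Id M R"
    and \<beta>: "\<beta> \<in> hom M E B" "\<beta> \<in> Cof M"
    and B: "bS \<in> hom M B S" "bC \<in> hom M B C" "bS \<cdot> \<beta> = \<epsilon>S" "bC \<cdot> \<beta> = i \<cdot> \<epsilon>R" "pairing_in tfib bS bC"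
    and J: "is_pushout M f a j1 j2" "j1 \<in> hom M A1 J" "j2 \<in> hom M R J"
    and j: "j \<in> hom M J L" "j \<in> Cof M"
    and \<gamma>: "\<gamma> \<in> hom M L C" "\<gamma> \<in> tfib" "\<gamma> \<cdot> (j \<cdot> j1) = c" "\<gamma> \<cdot> (j \<cdot> j2) = i"
    and D: "is_pushout M (\<beta> \<cdot> g2) (zmap R pt) \<delta>B \<delta>0" "\<delta>B \<in> hom M B D" "\<delta>0 \<in> hom M pt D"
begin

lemma g2_cof: "g2 \<in> Cof M"
  by (rule cof_pushout[OF E(1) f(1) A0(3) E(2,3) f(2)])

lemma \<beta>g2: "\<beta> \<cdot> g2 \<in> hom M R B" "\<beta> \<cdot> g2 \<in> Cof M" "bS \<cdot> (\<beta> \<cdot> g2) = zmap R S" "bC \<cdot> (\<beta> \<cdot> g2) = i"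
  using comp_hom[OF E(3) \<beta>(1)] cof_comp[OF E(3) \<beta>(1) g2_cof \<beta>(2)] comp_assoc[OF E(3) \<beta>(1) B(1)]
    comp_assoc[OF E(3) \<beta>(1) B(2)] comp_assoc[OF E(3) \<epsilon>(4) i(1)] B(3,4) \<epsilon>(3,6) comp_id[OF i(1)] by simp_all

lemma jj: "j \<cdot> j1 \<in> hom M A1 L" "j \<cdot> j2 \<in> hom M R L" "j \<cdot> j2 \<in> Cof M"
  using comp_hom[OF J(2) j(1)] comp_hom[OF J(3) j(1)]
    cof_comp[OF J(3) j(1) cof_pushout[OF J(1) f(1) A0(2) J(2,3) f(2)] j(2)] .

lemma decomposition_objs: "A0 \<in> Obj M" "A1 \<in> Obj M" "E \<in> Obj M" "B \<in> Obj M" "J \<in> Obj M" "L \<in> Obj M" "D \<in> Obj M"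
  using hom_objs[OF f(1)] hom_objs[OF \<beta>(1)] hom_objs[OF j(1)] hom_objs[OF D(2)] by auto

lemma decomposition_cofibrant: "cofibrant M E" "cofibrant M B" "cofibrant M J" "cofibrant M L" "cofibrant M D" "cofibrant M SQ"
proof -
  show 1: "cofibrant M E" by (rule cofibrant_cof[OF E(3) g2_cof cofs(1)])
  show "cofibrant M B" by (rule cofibrant_cof[OF \<beta> 1])
  show 2: "cofibrant M J"
    by (rule cofibrant_cof[OF J(3) cof_pushout[OF J(1) f(1) A0(2) J(2,3) f(2)] cofs(1)])
  show "cofibrant M L" by (rule cofibrant_cof[OF j 2])
  have pt: "cofibrant M pt" using bifibrant_pt by (simp add: bifibrant_def)
  show "cofibrant M D"
    by (rule cofibrant_cof[OF D(3) cof_pushout[OF D(1) \<beta>g2(1) zmap_hom[OF objs(1) pt_obj] D(2,3) \<beta>g2(2)] pt])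
  show "cofibrant M SQ"
    by (rule cofibrant_cof[OF SQ(3) cof_pushout[OF SQ(1) i(1) zmap_hom[OF objs(1) pt_obj] SQ(2,3) i(2)] pt])
qed

lemma ids: "Id M R \<in> hom M R R" "Id M R \<in> Weq M" "Id M E \<in> hom M E E" "Id M E \<in> Weq M"
  "Id M B \<in> hom M B B" "Id M B \<in> Weq M" "Id M pt \<in> hom M pt pt" "Id M pt \<in> Weq M"
  using id_hom id_tcof objs decomposition_objs by auto

lemma E_product: "pairing_in (Weq M) \<epsilon>S \<epsilon>R"
  by (rule product_preserves_suspension[OF bif(1) A0 A1(1,2,5) f A1(3,4) E \<epsilon>(1,2,3) \<epsilon>(4,5,6)])

lemma bS_tfib: "bS \<in> tfib"
  by (rule pairing_contractible[OF B(1,2,5) contractible])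

text \<open>The graph \<open>(\<phi>, id)\<close> of \<open>\<phi>\<close> in \<open>S \<times> C\<close>. It sends the base of the cone to \<open>pt \<times> R\<close>, which \<open>D\<close>
  collapses, so that it induces a map from \<open>SQ\<close> to \<open>D\<close>; over \<open>S \<times> S\<close> this map is the diagonal.\<close>

lemma cone_graph:
  obtains cB where "cB \<in> hom M C B" "cB \<cdot> i = \<beta> \<cdot> g2" "bS \<cdot> cB = \<phi>" "bC \<cdot> cB = Id M C"
proof -
  have "bS \<cdot> (\<beta> \<cdot> g2) = \<phi> \<cdot> i" "bC \<cdot> (\<beta> \<cdot> g2) = Id M C \<cdot> i"
    using \<beta>g2 \<phi>i id_comp[OF i(1)] by simp_all
  then show thesis
    using pairing_tfib_lift[OF B(1,2,5) i \<beta>g2(1) \<phi>_hom id_hom[OF objs(2)]] that by blast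
qed

text \<open>By two applications of the product lemma, the pushout of \<open>B \<leftarrow> E \<rightarrow> S\<close> is weakly equivalent
  to \<open>S \<times> S\<close>. Here \<open>S\<close> may be replaced by the cone \<open>L\<close> with the part \<open>R\<close> of \<open>J\<close> collapsed. A map out of the resulting pushout is
  a map out of \<open>B\<close> that kills \<open>pt \<times> R\<close>, together with a map out of \<open>L\<close> that agrees with it on \<open>C \<times> R\<close>
  and kills \<open>R\<close>; this is also what a map out of the pushout of \<open>L \<leftarrow> J \<rightarrow> D\<close> is.\<close>

lemma second_cell:
  obtains k F x y \<xi>1 \<xi>2 where "k \<in> hom M J D" "is_pushout M j k x y" "x \<in> hom M L F" "y \<in> hom M D F"
    "\<xi>1 \<in> hom M F S" "\<xi>2 \<in> hom M F S" "\<xi>1 \<cdot> (y \<cdot> \<delta>B) = bS" "\<xi>2 \<cdot> (y \<cdot> \<delta>B) = \<phi> \<cdot> bC"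
    "pairing_in (Weq M) \<xi>1 \<xi>2"
proof -
  note zR = zmap_hom[OF objs(1) pt_obj]
  have idS: "Id M S \<in> hom M S S" using id_hom objs by simp
  \<comment> \<open>\<open>S \<times> S\<close> is \<open>S \<times> C\<close> and \<open>S\<close> glued along \<open>S \<times> R\<close>.\<close>
  obtain F0 k1 k2 where F0: "is_pushout M \<beta> \<epsilon>S k1 k2" "k1 \<in> hom M B F0" "k2 \<in> hom M S F0" "k1 \<cdot> \<beta> = k2 \<cdot> \<epsilon>S"
    using pushout_obtain[OF \<beta>(1) \<epsilon>(1)] .
  have "(\<phi> \<cdot> bC) \<cdot> \<beta> = zmap S S \<cdot> \<epsilon>S"
    using comp_assoc[OF \<beta>(1) B(2) \<phi>_hom] B(4) comp_assoc[OF \<epsilon>(4) i(1) \<phi>_hom] \<phi>i \<epsilon>(1,4) objs by (simp add: in_hom)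
  then obtain \<zeta>2 where \<zeta>2: "\<zeta>2 \<in> hom M F0 S" "\<zeta>2 \<cdot> k1 = \<phi> \<cdot> bC" "\<zeta>2 \<cdot> k2 = zmap S S"
    using pushout_induced[OF F0(1,2,3) comp_hom[OF B(2) \<phi>_hom] zmap_hom[OF objs(3,3)]] by blast
  have "bS \<cdot> \<beta> = Id M S \<cdot> \<epsilon>S" using B(3) id_comp[OF \<epsilon>(1)] by simp
  then obtain \<zeta>1 where \<zeta>1: "\<zeta>1 \<in> hom M F0 S" "\<zeta>1 \<cdot> k1 = bS" "\<zeta>1 \<cdot> k2 = Id M S"
    using pushout_induced[OF F0(1,2,3) B(1) idS] by blast
  have "pairing_in (Weq M) \<zeta>2 \<zeta>1"
    by (rule product_preserves_suspension[OF bif(3) decomposition_cofibrant(1) \<epsilon>(4,1)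
          pairing_sym[OF \<epsilon>(1,4) E_product] B(2,1) pairing_sym[OF B(1,2) pairing_tfib_imp(1)[OF B(5)]]
          \<beta> B(4,3) F0(1,2,3) \<zeta>2 \<zeta>1])
  then have \<zeta>: "pairing_in (Weq M) \<zeta>1 \<zeta>2"
    by (rule pairing_sym[OF \<zeta>2(1) \<zeta>1(1)])
  \<comment> \<open>Replace \<open>S\<close> by the weakly equivalent quotient \<open>S1\<close> of the cone \<open>L\<close> on \<open>J\<close>.\<close>
  obtain S1 s1 s0 where S1: "is_pushout M (j \<cdot> j2) (zmap R pt) s1 s0" "s1 \<in> hom M L S1" "s0 \<in> hom M pt S1"
    "s1 \<cdot> (j \<cdot> j2) = s0 \<cdot> zmap R pt"
    using pushout_obtain[OF jj(2) zR] .
  have S1o: "S1 \<in> Obj M" using hom_objs[OF S1(2)] by simp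
  have sj2: "s1 \<cdot> (j \<cdot> j2) = zmap R S1" using S1(3,4) objs by (simp add: in_hom)
  have \<kappa>\<gamma>: "\<kappa> \<cdot> \<gamma> \<in> hom M L SQ" "(\<kappa> \<cdot> \<gamma>) \<cdot> (j \<cdot> j2) = zmap R SQ" "(\<kappa> \<cdot> \<gamma>) \<cdot> (j \<cdot> j1) = \<kappa> \<cdot> c"
    using comp_hom[OF \<gamma>(1) SQ(2)] comp_assoc[OF jj(2) \<gamma>(1) SQ(2)] comp_assoc[OF jj(1) \<gamma>(1) SQ(2)] \<gamma>(3,4) \<kappa>i by simp_all
  obtain \<psi>1 where \<psi>1: "\<psi>1 \<in> hom M S1 SQ" "\<psi>1 \<cdot> s1 = \<kappa> \<cdot> \<gamma>"
    using quotient_induced[OF S1(1) jj(2) S1(2,3) \<kappa>\<gamma>(1,2)] .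
  have \<psi>1w: "\<psi>1 \<in> Weq M"
  proof (rule gluing[OF S1(1) jj(2) zR S1(2,3) jj(3) SQ(1) i(1) zR SQ(2,3) i(2) cofs(1) _ cofs(1) _ ids(1,2) \<gamma>(1) _ ids(7,8) _ _ \<psi>1])
    show "\<psi>1 \<cdot> s0 = \<kappa>0 \<cdot> Id M pt"
      using zmap_pt_unique(2)[OF comp_hom[OF S1(3) \<psi>1(1)] SQ(3)] comp_id[OF SQ(3)] by simp
    show "\<gamma> \<cdot> j \<cdot> j2 = i \<cdot> Id M R" using \<gamma>(4) comp_id[OF i(1)] by simp
    show "Id M pt \<cdot> zmap R pt = zmap R pt \<cdot> Id M R" using id_comp[OF zR] comp_id[OF zR] by simp
  qed (use \<gamma>(2) bifibrant_pt in \<open>simp_all add: bifibrant_def\<close>)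
  define \<omega> where "\<omega> = \<psi> \<cdot> \<psi>1"
  have \<omega>: "\<omega> \<in> hom M S1 S" "\<omega> \<in> Weq M" "\<omega> \<cdot> s1 = \<phi> \<cdot> \<gamma>"
    unfolding \<omega>_def using comp_hom[OF \<psi>1(1) \<psi>(1)] two_of_three(1)[OF \<psi>1(1) \<psi>(1) \<psi>1w \<psi>(2)]
      comp_assoc[OF S1(2) \<psi>1(1) \<psi>(1)] \<psi>1(2) comp_assoc[OF \<gamma>(1) SQ(2) \<psi>(1)] by (simp_all add: \<phi>_def)
  have sj1: "s1 \<cdot> (j \<cdot> j1) \<in> hom M A1 S1" by (rule comp_hom[OF jj(1) S1(2)])
  have jf: "(j \<cdot> j1) \<cdot> f = (j \<cdot> j2) \<cdot> a"
    using comp_assoc[OF f(1) J(2) j(1)] comp_assoc[OF A0(2) J(3) j(1)] pushout_comm[OF J(1)] by simp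
  have "(s1 \<cdot> (j \<cdot> j1)) \<cdot> f = zmap R S1 \<cdot> b"
    using comp_assoc[OF f(1) jj(1) S1(2)] jf comp_assoc[OF A0(2) jj(2) S1(2)] sj2 A0(2,3) S1o by (simp add: in_hom)
  then obtain \<epsilon>1 where \<epsilon>1: "\<epsilon>1 \<in> hom M E S1" "\<epsilon>1 \<cdot> g1 = s1 \<cdot> (j \<cdot> j1)" "\<epsilon>1 \<cdot> g2 = zmap R S1"
    using pushout_induced[OF E sj1 zmap_hom[OF objs(1) S1o]] by blast
  have \<omega>\<epsilon>1: "\<omega> \<cdot> \<epsilon>1 = \<epsilon>S"
  proof (rule pushout_ext[OF E(1) comp_hom[OF \<epsilon>1(1) \<omega>(1)] \<epsilon>(1) E(2)])
    show "(\<omega> \<cdot> \<epsilon>1) \<cdot> g1 = \<epsilon>S \<cdot> g1"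
      using comp_assoc[OF E(2) \<epsilon>1(1) \<omega>(1)] \<epsilon>1(2) comp_assoc[OF jj(1) S1(2) \<omega>(1)] \<omega>(3)
        comp_assoc[OF jj(1) \<gamma>(1) \<phi>_hom] \<gamma>(3) \<epsilon>(2) by simp
    show "(\<omega> \<cdot> \<epsilon>1) \<cdot> g2 = \<epsilon>S \<cdot> g2"
      using comp_assoc[OF E(3) \<epsilon>1(1) \<omega>(1)] \<epsilon>1(3) \<omega>(1) \<epsilon>(3) objs by (simp add: in_hom)
  qed
  obtain F u1 u2 where F: "is_pushout M \<beta> \<epsilon>1 u1 u2" "u1 \<in> hom M B F" "u2 \<in> hom M S1 F" "u1 \<cdot> \<beta> = u2 \<cdot> \<epsilon>1"
    using pushout_obtain[OF \<beta>(1) \<epsilon>1(1)] .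
  have "k1 \<cdot> \<beta> = (k2 \<cdot> \<omega>) \<cdot> \<epsilon>1"
    using comp_assoc[OF \<epsilon>1(1) \<omega>(1) F0(3)] \<omega>\<epsilon>1 F0(4) by simp
  then obtain h where h: "h \<in> hom M F F0" "h \<cdot> u1 = k1" "h \<cdot> u2 = k2 \<cdot> \<omega>"
    using pushout_induced[OF F(1,2,3) F0(2) comp_hom[OF \<omega>(1) F0(3)]] by blast
  have pt: "cofibrant M pt" using bifibrant_pt by (simp add: bifibrant_def)
  have S1c: "cofibrant M S1"
    by (rule cofibrant_cof[OF S1(3) cof_pushout[OF S1(1) jj(2) zR S1(2,3) jj(3)] pt])
  have hw: "h \<in> Weq M"
    by (rule gluing[OF F(1) \<beta>(1) \<epsilon>1(1) F(2,3) \<beta>(2) F0(1) \<beta>(1) \<epsilon>(1) F0(2,3) \<beta>(2) decomposition_cofibrant(1) S1c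
          decomposition_cofibrant(1) cofs(3) ids(3,4,5,6) \<omega>(1,2) _ _ h(1) _ h(3)])
      (use comp_id[OF \<beta>(1)] id_comp[OF \<beta>(1)] comp_id[OF \<epsilon>(1)] \<omega>\<epsilon>1 comp_id[OF F0(2)] h(2) in simp_all)
  define \<xi>1 where "\<xi>1 = \<zeta>1 \<cdot> h"
  define \<xi>2 where "\<xi>2 = \<zeta>2 \<cdot> h"
  have \<xi>: "\<xi>1 \<in> hom M F S" "\<xi>2 \<in> hom M F S" "\<xi>1 \<cdot> u1 = bS" "\<xi>2 \<cdot> u1 = \<phi> \<cdot> bC" "pairing_in (Weq M) \<xi>1 \<xi>2"
    unfolding \<xi>1_def \<xi>2_def
    using comp_hom[OF h(1) \<zeta>1(1)] comp_hom[OF h(1) \<zeta>2(1)] comp_assoc[OF F(2) h(1) \<zeta>1(1)] comp_assoc[OF F(2) h(1) \<zeta>2(1)]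
      h(2) \<zeta>1(2) \<zeta>2(2) pairing_weq_comp(2)[OF \<zeta>1(1) \<zeta>2(1) h(1) hw] \<zeta> by simp_all
  \<comment> \<open>The same object arises from \<open>D\<close> by attaching the cone \<open>L\<close> on \<open>J\<close>.\<close>
  have \<delta>\<beta>: "\<delta>B \<cdot> \<beta> \<in> hom M E D" "(\<delta>B \<cdot> \<beta>) \<cdot> g2 = zmap R D"
    using comp_hom[OF \<beta>(1) D(2)] comp_assoc[OF E(3) \<beta>(1) D(2)] pushout_comm[OF D(1)] D(3) objs by (simp_all add: in_hom)
  have "((\<delta>B \<cdot> \<beta>) \<cdot> g1) \<cdot> f = zmap R D \<cdot> a"
    using comp_assoc[OF f(1) E(2) \<delta>\<beta>(1)] pushout_comm[OF E(1)] comp_assoc[OF A0(3) E(3) \<delta>\<beta>(1)] \<delta>\<beta>(2) A0(2,3)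
      decomposition_objs by (simp add: in_hom)
  then obtain k where k: "k \<in> hom M J D" "k \<cdot> j1 = (\<delta>B \<cdot> \<beta>) \<cdot> g1" "k \<cdot> j2 = zmap R D"
    using pushout_induced[OF J comp_hom[OF E(2) \<delta>\<beta>(1)] zmap_hom[OF objs(1) decomposition_objs(7)]] by blast
  have "u1 \<cdot> (\<beta> \<cdot> g2) = zmap R F"
    using comp_assoc[OF E(3) \<beta>(1) F(2)] comp_assoc[OF E(3) \<epsilon>1(1) F(3)] F(3,4) \<epsilon>1(3) objs by (simp add: in_hom)
  then obtain y where y: "y \<in> hom M D F" "y \<cdot> \<delta>B = u1"
    using quotient_induced[OF D(1) \<beta>g2(1) D(2,3) F(2)] by blast
  define x where "x = u2 \<cdot> s1"
  have x: "x \<in> hom M L F" unfolding x_def by (rule comp_hom[OF S1(2) F(3)])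
  have Fo: "F \<in> Obj M" using hom_objs[OF x] by simp
  have po: "is_pushout M j k x y"
  proof (rule pushoutI[OF j(1) k(1) x y(1)])
    show "x \<cdot> j = y \<cdot> k"
    proof (rule pushout_ext[OF J(1) comp_hom[OF j(1) x] comp_hom[OF k(1) y(1)] J(2)])
      have "(x \<cdot> j) \<cdot> j1 = u2 \<cdot> (\<epsilon>1 \<cdot> g1)"
        using comp_assoc[OF J(2) j(1) x] comp_assoc[OF jj(1) S1(2) F(3)] \<epsilon>1(2) by (simp add: x_def)
      also have "\<dots> = u1 \<cdot> (\<beta> \<cdot> g1)"
        using comp_assoc[OF E(2) \<epsilon>1(1) F(3)] comp_assoc[OF E(2) \<beta>(1) F(2)] F(4) by simp
      also have "\<dots> = (y \<cdot> k) \<cdot> j1"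
        using comp_assoc[OF J(2) k(1) y(1)] k(2) comp_assoc[OF E(2) \<delta>\<beta>(1) y(1)] comp_assoc[OF \<beta>(1) D(2) y(1)] y(2)
          comp_assoc[OF E(2) \<beta>(1) F(2)] by simp
      finally show "(x \<cdot> j) \<cdot> j1 = (y \<cdot> k) \<cdot> j1" .
      show "(x \<cdot> j) \<cdot> j2 = (y \<cdot> k) \<cdot> j2"
        using comp_assoc[OF J(3) j(1) x] comp_assoc[OF jj(2) S1(2) F(3)] sj2 F(3) comp_assoc[OF J(3) k(1) y(1)] k(3) y(1) objs
        by (simp add: x_def in_hom)
    qed
  next
    fix T x' y' assume x': "x' \<in> hom M L T" and y': "y' \<in> hom M D T" and eq: "x' \<cdot> j = y' \<cdot> k"
    have To: "T \<in> Obj M" using hom_objs[OF x'] by simp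
    have eq1: "x' \<cdot> (j \<cdot> j1) = y' \<cdot> (k \<cdot> j1)" "x' \<cdot> (j \<cdot> j2) = y' \<cdot> (k \<cdot> j2)"
      using comp_assoc[OF J(2) j(1) x'] comp_assoc[OF J(2) k(1) y'] comp_assoc[OF J(3) j(1) x'] comp_assoc[OF J(3) k(1) y'] eq
      by simp_all
    have "x' \<cdot> (j \<cdot> j2) = zmap R T" using eq1(2) k(3) y' objs by (simp add: in_hom)
    then obtain z where z: "z \<in> hom M S1 T" "z \<cdot> s1 = x'"
      using quotient_induced[OF S1(1) jj(2) S1(2,3) x'] by blast
    have y\<delta>: "y' \<cdot> \<delta>B \<in> hom M B T" by (rule comp_hom[OF D(2) y'])
    have "(y' \<cdot> \<delta>B) \<cdot> \<beta> = z \<cdot> \<epsilon>1"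
    proof (rule pushout_ext[OF E(1) comp_hom[OF \<beta>(1) y\<delta>] comp_hom[OF \<epsilon>1(1) z(1)] E(2)])
      show "((y' \<cdot> \<delta>B) \<cdot> \<beta>) \<cdot> g1 = (z \<cdot> \<epsilon>1) \<cdot> g1"
        using comp_assoc[OF \<beta>(1) D(2) y'] comp_assoc[OF E(2) \<delta>\<beta>(1) y'] k(2) eq1(1) z(2) comp_assoc[OF jj(1) S1(2) z(1)]
          comp_assoc[OF E(2) \<epsilon>1(1) z(1)] \<epsilon>1(2) by simp
      show "((y' \<cdot> \<delta>B) \<cdot> \<beta>) \<cdot> g2 = (z \<cdot> \<epsilon>1) \<cdot> g2"
        using comp_assoc[OF \<beta>(1) D(2) y'] comp_assoc[OF E(3) \<delta>\<beta>(1) y'] \<delta>\<beta>(2) comp_assoc[OF E(3) \<epsilon>1(1) z(1)] \<epsilon>1(3)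
          y' z(1) objs by (simp add: in_hom)
    qed
    then obtain w where w: "w \<in> hom M F T" "w \<cdot> u1 = y' \<cdot> \<delta>B" "w \<cdot> u2 = z"
      using pushout_induced[OF F(1,2,3) y\<delta> z(1)] by blast
    have "w \<cdot> x = x'"
      unfolding x_def using comp_assoc[OF S1(2) F(3) w(1)] w(3) z(2) by simp
    moreover have "w \<cdot> y = y'"
      by (rule quotient_ext[OF D comp_hom[OF y(1) w(1)] y'])
        (use comp_assoc[OF D(2) y(1) w(1)] y(2) w(2) in simp)
    ultimately show "\<exists>w \<in> hom M F T. w \<cdot> x = x' \<and> w \<cdot> y = y'" using w(1) by blast
  next
    fix T w w' assume w: "w \<in> hom M F T" "w' \<in> hom M F T" and eq: "w \<cdot> x = w' \<cdot> x" "w \<cdot> y = w' \<cdot> y"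
    have "w \<cdot> u2 = w' \<cdot> u2"
      by (rule quotient_ext[OF S1(1,2,3) comp_hom[OF F(3) w(1)] comp_hom[OF F(3) w(2)]])
        (use comp_assoc[OF S1(2) F(3) w(1)] comp_assoc[OF S1(2) F(3) w(2)] eq(1) in \<open>simp add: x_def\<close>)
    moreover have "w \<cdot> u1 = w' \<cdot> u1"
      using comp_assoc[OF D(2) y(1) w(1)] comp_assoc[OF D(2) y(1) w(2)] y(2) eq(2) by simp
    ultimately show "w = w'" using pushout_ext[OF F(1) w F(2)] by blast
  qed
  show thesis
    by (rule that[OF k(1) po x y(1) \<xi>(1,2)]) (use y(2) \<xi>(3-5) in simp_all)
qed

text \<open>The wedge \<open>Q\<close> of two copies of \<open>SQ\<close> is obtained from the first copy by attaching a cone \<open>C\<close> by the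
  zero map, but also from the wedge \<open>V\<close> of the second copy and \<open>C\<close> by collapsing \<open>R\<close>. The latter description
  compares it with \<open>D\<close>, the quotient of \<open>B\<close> by \<open>R\<close>: as \<open>C\<close> is contractible, \<open>V \<rightarrow> B\<close> is a weak equivalence,
  namely the axis \<open>S\<close> on the copy of \<open>SQ\<close> and \<open>cB\<close> on \<open>C\<close>.\<close>

lemma first_cell:
  assumes cB: "cB \<in> hom M C B" "cB \<cdot> i = \<beta> \<cdot> g2"
    and \<delta>: "\<delta> \<in> hom M SQ D" "\<delta> \<cdot> \<kappa> = \<delta>B \<cdot> cB"
  obtains Q l u q where "is_pushout M i (zmap R SQ) l u" "l \<in> hom M C Q" "u \<in> hom M SQ Q"
    "q \<in> hom M Q D" "q \<in> Weq M" "q \<cdot> u = \<delta>"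
proof -
  note zR = zmap_hom[OF objs(1) pt_obj]
  have pt: "cofibrant M pt" using bifibrant_pt by (simp add: bifibrant_def)
  note SQc = decomposition_cofibrant(6)
  have \<kappa>0: "\<kappa>0 = zmap pt SQ" by (rule eq_zmap(2)[OF SQ(3)])
  obtain sB where sB: "sB \<in> hom M SQ B" "bS \<cdot> sB = \<psi>"
    using cofibrant_lift[OF SQc B(1) bS_tfib \<psi>(1)] .
  have sBw: "sB \<in> Weq M"
    using two_of_three(3)[OF sB(1) B(1)] bS_tfib sB(2) \<psi>(2) by simp
  obtain Q q1 q2 where Q: "is_pushout M (zmap pt SQ) (zmap pt SQ) q1 q2" "is_coproduct M q1 q2"
    "q1 \<in> hom M SQ Q" "q2 \<in> hom M SQ Q"
    using coproduct_obtain[OF objs(4,4)] .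
  have Qo: "Q \<in> Obj M" using hom_objs[OF Q(3)] by simp
  have po1: "is_pushout M i (zmap R SQ) (q2 \<cdot> \<kappa>) q1"
    using pushout_paste[OF SQ(1) pushout_sym[OF Q(1), folded \<kappa>0] i(1) zR SQ(2,3) SQ(3) Q(4,3)] \<kappa>0 objs by simp
  obtain V v1 v2 where V: "is_pushout M (zmap pt SQ) (zmap pt C) v1 v2" "is_coproduct M v1 v2"
    "v1 \<in> hom M SQ V" "v2 \<in> hom M C V"
    using coproduct_obtain[OF objs(4,2)] .
  have "zmap pt C \<in> tcof" using contractible_tcof[OF cofs(2)] contractible by simp
  then have v1w: "v1 \<in> Weq M"
    using tcof_pushout[OF pushout_sym[OF V(1)] zmap_hom[OF pt_obj objs(2)] zmap_hom[OF pt_obj objs(4)] V(4,3)] by simp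
  obtain \<nu> where \<nu>: "\<nu> \<in> hom M V B" "\<nu> \<cdot> v1 = sB" "\<nu> \<cdot> v2 = cB"
    using coproduct_induced[OF V(2,3,4) sB(1) cB(1)] .
  have \<nu>w: "\<nu> \<in> Weq M" using two_of_three(2)[OF V(3) \<nu>(1) v1w] \<nu>(2) sBw by simp
  have v2i: "v2 \<cdot> i \<in> hom M R V" "v2 \<cdot> i \<in> Cof M" "\<nu> \<cdot> (v2 \<cdot> i) = \<beta> \<cdot> g2"
    using comp_hom[OF i(1) V(4)] cof_comp[OF i(1) V(4) i(2) coproduct_cof(1)[OF V(1,3,4) SQc]]
      comp_assoc[OF i(1) V(4) \<nu>(1)] \<nu>(3) cB(2) by simp_all
  have q1\<kappa>: "q1 \<cdot> \<kappa> \<in> hom M C Q" by (rule comp_hom[OF SQ(2) Q(3)])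
  obtain \<mu> where \<mu>: "\<mu> \<in> hom M V Q" "\<mu> \<cdot> v1 = q2" "\<mu> \<cdot> v2 = q1 \<cdot> \<kappa>"
    using coproduct_induced[OF V(2,3,4) Q(4) q1\<kappa>] .
  have po2: "is_pushout M (v2 \<cdot> i) (zmap R pt) \<mu> (zmap pt Q)"
  proof (rule pushoutI[OF v2i(1) zR \<mu>(1) zmap_hom[OF pt_obj Qo]])
    show "\<mu> \<cdot> (v2 \<cdot> i) = zmap pt Q \<cdot> zmap R pt"
      using comp_assoc[OF i(1) V(4) \<mu>(1)] \<mu>(3) comp_assoc[OF i(1) SQ(2) Q(3)] \<kappa>i Q(3) Qo objs by (simp add: in_hom)
  next
    fix T x y assume x: "x \<in> hom M V T" and y: "y \<in> hom M pt T" and eq: "x \<cdot> (v2 \<cdot> i) = y \<cdot> zmap R pt"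
    have "(x \<cdot> v2) \<cdot> i = zmap R T"
      using comp_assoc[OF i(1) V(4) x] eq y objs by (simp add: in_hom)
    then obtain t where t: "t \<in> hom M SQ T" "t \<cdot> \<kappa> = x \<cdot> v2"
      using quotient_induced[OF SQ(1) i(1) SQ(2,3) comp_hom[OF V(4) x]] by blast
    obtain w where w: "w \<in> hom M Q T" "w \<cdot> q1 = t" "w \<cdot> q2 = x \<cdot> v1"
      using coproduct_induced[OF Q(2,3,4) t(1) comp_hom[OF V(3) x]] .
    have "w \<cdot> \<mu> = x"
      by (rule coproduct_ext[OF V(2,3,4) comp_hom[OF \<mu>(1) w(1)] x])
        (use comp_assoc[OF V(3) \<mu>(1) w(1)] comp_assoc[OF V(4) \<mu>(1) w(1)] comp_assoc[OF SQ(2) Q(3) w(1)] \<mu> w t in simp_all)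
    moreover have "w \<cdot> zmap pt Q = y"
      using zmap_pt_unique(2)[OF comp_hom[OF zmap_hom[OF pt_obj Qo] w(1)] y] .
    ultimately show "\<exists>w \<in> hom M Q T. w \<cdot> \<mu> = x \<and> w \<cdot> zmap pt Q = y" using w(1) by blast
  next
    fix T w w' assume w: "w \<in> hom M Q T" "w' \<in> hom M Q T" and eq: "w \<cdot> \<mu> = w' \<cdot> \<mu>"
    have 2: "w \<cdot> q2 = w' \<cdot> q2"
      using comp_assoc[OF V(3) \<mu>(1) w(1)] comp_assoc[OF V(3) \<mu>(1) w(2)] \<mu>(2) eq by simp
    have "w \<cdot> q1 = w' \<cdot> q1"
      by (rule quotient_ext[OF SQ comp_hom[OF Q(3) w(1)] comp_hom[OF Q(3) w(2)]])
        (use comp_assoc[OF V(4) \<mu>(1) w(1)] comp_assoc[OF V(4) \<mu>(1) w(2)] comp_assoc[OF SQ(2) Q(3) w(1)]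
          comp_assoc[OF SQ(2) Q(3) w(2)] \<mu>(3) eq in simp)
    with 2 show "w = w'" using coproduct_ext[OF Q(2,3,4) w] by blast
  qed
  have \<delta>sB: "\<delta>B \<cdot> sB \<in> hom M SQ D" by (rule comp_hom[OF sB(1) D(2)])
  obtain q where q: "q \<in> hom M Q D" "q \<cdot> q1 = \<delta>" "q \<cdot> q2 = \<delta>B \<cdot> sB"
    using coproduct_induced[OF Q(2,3,4) \<delta>(1) \<delta>sB] .
  have q\<mu>: "q \<cdot> \<mu> = \<delta>B \<cdot> \<nu>"
    by (rule coproduct_ext[OF V(2,3,4) comp_hom[OF \<mu>(1) q(1)] comp_hom[OF \<nu>(1) D(2)]])
      (use comp_assoc[OF V(3) \<mu>(1) q(1)] comp_assoc[OF V(4) \<mu>(1) q(1)] comp_assoc[OF SQ(2) Q(3) q(1)]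
        comp_assoc[OF V(3) \<nu>(1) D(2)] comp_assoc[OF V(4) \<nu>(1) D(2)] \<mu> q \<nu> \<delta>(2) in simp_all)
  have "q \<in> Weq M"
  proof (rule gluing[OF po2 v2i(1) zR \<mu>(1) zmap_hom[OF pt_obj Qo] v2i(2) D(1) \<beta>g2(1) zR D(2,3) \<beta>g2(2) cofs(1) pt cofs(1) pt
        ids(1,2) \<nu>(1) \<nu>w ids(7,8) _ _ q(1) q\<mu>])
    show "\<nu> \<cdot> v2 \<cdot> i = (\<beta> \<cdot> g2) \<cdot> Id M R" using v2i(3) comp_id[OF \<beta>g2(1)] by simp
    show "Id M pt \<cdot> zmap R pt = zmap R pt \<cdot> Id M R" using id_comp[OF zR] comp_id[OF zR] by simp
    show "q \<cdot> zmap pt Q = \<delta>0 \<cdot> Id M pt"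
      using zmap_pt_unique(2)[OF comp_hom[OF zmap_hom[OF pt_obj Qo] q(1)] D(3)] comp_id[OF D(3)] by simp
  qed
  then show thesis by (rule that[OF po1 comp_hom[OF SQ(2) Q(4)] Q(3) q(1) _ q(2)])
qed

section \<open>The complexity of a suspension\<close>

text \<open>The stages are \<open>X0\<close>, \<open>Df\<close> and \<open>W\<close>, bifibrant replacements of \<open>SQ\<close>, \<open>D\<close> and \<open>S \<times> S\<close>. The replacement of
  \<open>D\<close> is chosen fibred over \<open>S \<times> S\<close>, so that the map \<open>\<chi>0\<close> extending \<open>SQ \<rightarrow> D\<close> can be chosen to
  lie strictly over the diagonal. Two lifts of the diagonal along the trivial fibration \<open>w'\<close> are
  homotopic, which identifies the final map with \<open>d\<close>.\<close>

lemma relcat_diagonal: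
  assumes diag: "is_diagonal M S d"
  shows "relcat_at_length M d 2"
proof -
  have So: "S \<in> Obj M" and Sf: "fibrant M S" and Sc: "cofibrant M S"
    using bif bifibrant_obj by (auto simp: bifibrant_def)
  obtain p q w where pr: "is_product M p q" and cod: "Cod M p = S" "Cod M q = S" and w: "w \<in> Weq M" "Cod M w = Dom M p"
    and W_bif: "bifibrant M (Dom M w)" and d: "d \<in> hom M S (Dom M w)"
    and pd: "p \<cdot> (w \<cdot> d) = Id M S" and qd: "q \<cdot> (w \<cdot> d) = Id M S"
    using diag unfolding is_diagonal_def by auto
  define W where "W = Dom M w"
  define PP where "PP = Dom M p"
  have pq: "p \<in> hom M PP S" "q \<in> hom M PP S"
    using pr cod by (auto simp: is_product_def in_hom PP_def)
  have wt: "w \<in> hom M W PP" using w classes_arr by (auto simp: in_hom W_def PP_def)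
  have W: "bifibrant M W" "fibrant M W" "d \<in> hom M S W"
    using W_bif d by (auto simp: W_def bifibrant_def)
  \<comment> \<open>Replace \<open>w\<close> by a trivial fibration.\<close>
  obtain W' c' w' where W': "c' \<in> hom M W W'" "c' \<in> tcof" "w' \<in> hom M W' PP" "w' \<in> Fib M" "w' \<cdot> c' = w"
    using factor_tcof_fib[OF wt] .
  have w't: "w' \<in> tfib" using two_of_three(2)[OF W'(1,3)] W' w(1) by simp
  have Wo: "W \<in> Obj M" using hom_objs[OF W'(1)] by simp
  obtain r where r: "r \<in> hom M W' W" "r \<cdot> c' = Id M W"
    using fibrant_extend[OF W(2) W'(1,2) id_hom[OF Wo]] .
  have rw: "r \<in> Weq M" using weq_section[OF W'(1) r] W'(2) by simp
  \<comment> \<open>The diagonal on the cone, and its factorization through \<open>D\<close>.\<close>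
  obtain cB where cB: "cB \<in> hom M C B" "cB \<cdot> i = \<beta> \<cdot> g2" "bS \<cdot> cB = \<phi>" "bC \<cdot> cB = Id M C"
    using cone_graph .
  have \<delta>\<beta>: "\<delta>B \<cdot> (\<beta> \<cdot> g2) = zmap R D"
    using pushout_comm[OF D(1)] D(3) objs by (simp add: in_hom)
  have "(\<delta>B \<cdot> cB) \<cdot> i = zmap R D"
    using comp_assoc[OF i(1) cB(1) D(2)] cB(2) \<delta>\<beta> by simp
  then obtain \<delta> where \<delta>: "\<delta> \<in> hom M SQ D" "\<delta> \<cdot> \<kappa> = \<delta>B \<cdot> cB"
    using quotient_induced[OF SQ(1) i(1) SQ(2,3) comp_hom[OF cB(1) D(2)]] by blast
  have \<phi>bC: "\<phi> \<cdot> bC \<in> hom M B S" "(\<phi> \<cdot> bC) \<cdot> (\<beta> \<cdot> g2) = zmap R S"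
    using comp_hom[OF B(2) \<phi>_hom] comp_assoc[OF \<beta>g2(1) B(2) \<phi>_hom] \<beta>g2(4) \<phi>i by simp_all
  obtain dS where dS: "dS \<in> hom M D S" "dS \<cdot> \<delta>B = bS"
    using quotient_induced[OF D(1) \<beta>g2(1) D(2,3) B(1) \<beta>g2(3)] .
  obtain dC where dC: "dC \<in> hom M D S" "dC \<cdot> \<delta>B = \<phi> \<cdot> bC"
    using quotient_induced[OF D(1) \<beta>g2(1) D(2,3) \<phi>bC] .
  have dS\<delta>: "dS \<cdot> \<delta> = \<psi>"
    by (rule quotient_ext[OF SQ comp_hom[OF \<delta>(1) dS(1)] \<psi>(1)])
      (use comp_assoc[OF SQ(2) \<delta>(1) dS(1)] comp_assoc[OF cB(1) D(2) dS(1)] \<delta>(2) dS(2) cB(3) in \<open>simp add: \<phi>_def\<close>)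
  have dC\<delta>: "dC \<cdot> \<delta> = \<psi>"
    by (rule quotient_ext[OF SQ comp_hom[OF \<delta>(1) dC(1)] \<psi>(1)])
      (use comp_assoc[OF SQ(2) \<delta>(1) dC(1)] comp_assoc[OF cB(1) D(2) dC(1)] comp_assoc[OF cB(1) B(2) \<phi>_hom]
        comp_id[OF \<phi>_hom] \<delta>(2) dC(2) cB(4) in \<open>simp add: \<phi>_def\<close>)
  obtain Df \<eta> eS eC where Df: "\<eta> \<in> hom M D Df" "\<eta> \<in> tcof" "eS \<in> hom M Df S" "eC \<in> hom M Df S"
    "eS \<cdot> \<eta> = dS" "eC \<cdot> \<eta> = dC" "pairing_in (Fib M) eS eC"
    using pairing_factor_tcof[OF dS(1) dC(1)] .
  have Df_bif: "bifibrant M Df"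
    using cofibrant_cof[OF Df(1) _ decomposition_cofibrant(5)] Df(2)
      pairing_fib_components(2)[OF Df(3,4,7) Sf Sf] by (simp add: bifibrant_def)
  obtain X0 j0 \<psi>0 where X0: "j0 \<in> hom M SQ X0" "j0 \<in> Cof M" "\<psi>0 \<in> hom M X0 S" "\<psi>0 \<in> tfib" "\<psi>0 \<cdot> j0 = \<psi>"
    using factor_cof_tfib[OF \<psi>(1)] .
  have j0: "j0 \<in> tcof" using two_of_three(3)[OF X0(1,3)] X0 \<psi>(2) by simp
  have X0_bif: "bifibrant M X0"
    using cofibrant_cof[OF X0(1,2) decomposition_cofibrant(6)] fibrant_fib[OF X0(3) _ Sf] X0(4)
    by (simp add: bifibrant_def)
  obtain v where v: "v \<in> hom M S X0" "\<psi>0 \<cdot> v = Id M S"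
    using cofibrant_lift[OF Sc X0(3,4) id_hom[OF So]] .
  have "eS \<cdot> (\<eta> \<cdot> \<delta>) = \<psi>0 \<cdot> j0" "eC \<cdot> (\<eta> \<cdot> \<delta>) = \<psi>0 \<cdot> j0"
    using comp_assoc[OF \<delta>(1) Df(1,3)] comp_assoc[OF \<delta>(1) Df(1,4)] Df(5,6) dS\<delta> dC\<delta> X0(5) by simp_all
  then obtain \<chi>0 where \<chi>0: "\<chi>0 \<in> hom M X0 Df" "\<chi>0 \<cdot> j0 = \<eta> \<cdot> \<delta>" "eS \<cdot> \<chi>0 = \<psi>0" "eC \<cdot> \<chi>0 = \<psi>0"
    using pairing_fib_lift[OF Df(3,4,7) X0(1) j0 comp_hom[OF \<delta>(1) Df(1)] X0(3,3)] by blast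
  obtain m where m: "m \<in> hom M Df PP" "p \<cdot> m = eS" "q \<cdot> m = eC"
    using product_induced[OF pr pq Df(3,4)] .
  obtain \<Theta> where \<Theta>: "\<Theta> \<in> hom M Df W'" "w' \<cdot> \<Theta> = m"
    using cofibrant_lift[OF _ W'(3) w't m(1)] Df_bif by (auto simp: bifibrant_def)
  \<comment> \<open>First stage: from \<open>SQ\<close> to \<open>D\<close>.\<close>
  obtain Q l u q0 where Q: "is_pushout M i (zmap R SQ) l u" "l \<in> hom M C Q" "u \<in> hom M SQ Q"
    "q0 \<in> hom M Q D" "q0 \<in> Weq M" "q0 \<cdot> u = \<delta>"
    using first_cell[OF cB(1,2) \<delta>] .
  have \<eta>q: "\<eta> \<cdot> q0 \<in> hom M Q Df" "\<eta> \<cdot> q0 \<in> Weq M" "(\<eta> \<cdot> q0) \<cdot> u = \<chi>0 \<cdot> j0"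
    using comp_hom[OF Q(4) Df(1)] two_of_three(1)[OF Q(4) Df(1)] Df(2) Q(5) comp_assoc[OF Q(3,4) Df(1)] Q(6) \<chi>0(2)
    by simp_all
  have j0w: "j0 \<in> Weq M" and Cw: "zmap C pt \<in> Weq M" using j0 contractible by auto
  note stage0 = cone_stage[OF bif(3) X0_bif Df_bif v(1) decomposition_cofibrant(6) X0(1) j0w cofs(1) i Cw
    zmap_hom[OF objs(1,4)] Q(1-3) \<eta>q(1,2) \<chi>0(1) \<eta>q(3)]
  \<comment> \<open>Second stage: from \<open>D\<close> to \<open>S \<times> S\<close>.\<close>
  obtain k F x y \<xi>1 \<xi>2 where F: "k \<in> hom M J D" "is_pushout M j k x y" "x \<in> hom M L F" "y \<in> hom M D F"
    "\<xi>1 \<in> hom M F S" "\<xi>2 \<in> hom M F S" "\<xi>1 \<cdot> (y \<cdot> \<delta>B) = bS" "\<xi>2 \<cdot> (y \<cdot> \<delta>B) = \<phi> \<cdot> bC" "pairing_in (Weq M) \<xi>1 \<xi>2"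
    using second_cell .
  have \<xi>y: "\<xi>1 \<cdot> y = dS" "\<xi>2 \<cdot> y = dC"
  proof -
    show "\<xi>1 \<cdot> y = dS"
      by (rule quotient_ext[OF D comp_hom[OF F(4,5)] dS(1)]) (use comp_assoc[OF D(2) F(4,5)] F(7) dS(2) in simp)
    show "\<xi>2 \<cdot> y = dC"
      by (rule quotient_ext[OF D comp_hom[OF F(4,6)] dC(1)]) (use comp_assoc[OF D(2) F(4,6)] F(8) dC(2) in simp)
  qed
  obtain \<theta> where \<theta>: "\<theta> \<in> hom M F PP" "p \<cdot> \<theta> = \<xi>1" "q \<cdot> \<theta> = \<xi>2"
    using product_induced[OF pr pq F(5,6)] .
  have \<theta>w: "\<theta> \<in> Weq M" using pairing_iff(1)[OF pr pq \<theta>(1)] \<theta>(2,3) F(9) by simp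
  have \<Theta>\<eta>: "\<Theta> \<cdot> \<eta> \<in> hom M D W'" by (rule comp_hom[OF Df(1) \<Theta>(1)])
  have "w' \<cdot> (\<Theta> \<cdot> \<eta>) = \<theta> \<cdot> y"
  proof (rule product_ext[OF pr pq comp_hom[OF \<Theta>\<eta> W'(3)] comp_hom[OF F(4) \<theta>(1)]])
    have *: "w' \<cdot> (\<Theta> \<cdot> \<eta>) = m \<cdot> \<eta>" using comp_assoc[OF Df(1) \<Theta>(1) W'(3)] \<Theta>(2) by simp
    show "p \<cdot> (w' \<cdot> (\<Theta> \<cdot> \<eta>)) = p \<cdot> (\<theta> \<cdot> y)"
      unfolding * using comp_assoc[OF Df(1) m(1) pq(1)] comp_assoc[OF F(4) \<theta>(1) pq(1)] m \<theta> Df \<xi>y by simp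
    show "q \<cdot> (w' \<cdot> (\<Theta> \<cdot> \<eta>)) = q \<cdot> (\<theta> \<cdot> y)"
      unfolding * using comp_assoc[OF Df(1) m(1) pq(2)] comp_assoc[OF F(4) \<theta>(1) pq(2)] m \<theta> Df \<xi>y by simp
  qed
  then obtain q1 where q1: "q1 \<in> hom M F W'" "q1 \<cdot> y = \<Theta> \<cdot> \<eta>" "w' \<cdot> q1 = \<theta>"
    using lift_tfib[OF F(4) cof_pushout[OF F(2) j(1) F(1,3,4) j(2)] W'(3) w't \<Theta>\<eta> \<theta>(1)] by blast
  have q1w: "q1 \<in> Weq M" using two_of_three(3)[OF q1(1) W'(3)] w't q1(3) \<theta>w by simp
  define \<chi>1 where "\<chi>1 = r \<cdot> \<Theta>"
  have \<chi>1: "\<chi>1 \<in> hom M Df W" unfolding \<chi>1_def by (rule comp_hom[OF \<Theta>(1) r(1)])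
  have rq: "r \<cdot> q1 \<in> hom M F W" "r \<cdot> q1 \<in> Weq M" "(r \<cdot> q1) \<cdot> y = \<chi>1 \<cdot> \<eta>"
    using comp_hom[OF q1(1) r(1)] two_of_three(1)[OF q1(1) r(1) q1w rw] comp_assoc[OF F(4) q1(1) r(1)] q1(2)
      comp_assoc[OF Df(1) \<Theta>(1) r(1)] by (simp_all add: \<chi>1_def)
  have Lw: "zmap L pt \<in> Weq M"
    using two_of_three(1)[OF \<gamma>(1) zmap_hom[OF objs(2) pt_obj]] \<gamma>(1,2) Cw by (simp add: in_hom)
  have \<eta>w: "\<eta> \<in> Weq M" using Df(2) by simp
  have \<chi>v: "\<chi>0 \<cdot> v \<in> hom M S Df" by (rule comp_hom[OF v(1) \<chi>0(1)])
  note stage1 = cone_stage[OF bif(3) Df_bif W(1) \<chi>v decomposition_cofibrant(5) Df(1) \<eta>w decomposition_cofibrant(3) j Lw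
    F(1-4) rq(1,2) \<chi>1 rq(3)]
  \<comment> \<open>The map obtained after the two stages and \<open>d\<close> both lift the diagonal of \<open>S\<close>.\<close>
  have final: "homotopic M (\<chi>1 \<cdot> (\<chi>0 \<cdot> v)) d"
  proof -
    have l: "\<Theta> \<cdot> (\<chi>0 \<cdot> v) \<in> hom M S W'" and cd: "c' \<cdot> d \<in> hom M S W'"
      using comp_hom[OF \<chi>v \<Theta>(1)] comp_hom[OF W(3) W'(1)] .
    have "w' \<cdot> (\<Theta> \<cdot> (\<chi>0 \<cdot> v)) = w' \<cdot> (c' \<cdot> d)"
    proof (rule product_ext[OF pr pq comp_hom[OF l W'(3)] comp_hom[OF cd W'(3)]])
      have 1: "w' \<cdot> (\<Theta> \<cdot> (\<chi>0 \<cdot> v)) = m \<cdot> (\<chi>0 \<cdot> v)" using comp_assoc[OF \<chi>v \<Theta>(1) W'(3)] \<Theta>(2) by simp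
      have 2: "w' \<cdot> (c' \<cdot> d) = w \<cdot> d" using comp_assoc[OF W(3) W'(1,3)] W'(5) by simp
      show "p \<cdot> (w' \<cdot> (\<Theta> \<cdot> (\<chi>0 \<cdot> v))) = p \<cdot> (w' \<cdot> (c' \<cdot> d))"
        unfolding 1 2 pd using comp_assoc[OF \<chi>v m(1) pq(1)] comp_assoc[OF v(1) \<chi>0(1) Df(3)] m(2) \<chi>0(3) v(2) by simp
      show "q \<cdot> (w' \<cdot> (\<Theta> \<cdot> (\<chi>0 \<cdot> v))) = q \<cdot> (w' \<cdot> (c' \<cdot> d))"
        unfolding 1 2 qd using comp_assoc[OF \<chi>v m(1) pq(2)] comp_assoc[OF v(1) \<chi>0(1) Df(4)] m(3) \<chi>0(4) v(2) by simp
    qed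
    then have "homotopic M (r \<cdot> (\<Theta> \<cdot> (\<chi>0 \<cdot> v))) (r \<cdot> (c' \<cdot> d))"
      using homotopic_postcompose[OF homotopic_lifts[OF W'(3) w't l cd] l r(1)] by blast
    moreover have "r \<cdot> (\<Theta> \<cdot> (\<chi>0 \<cdot> v)) = \<chi>1 \<cdot> (\<chi>0 \<cdot> v)"
      unfolding \<chi>1_def using comp_assoc[OF \<chi>v \<Theta>(1) r(1)] by simp
    moreover have "r \<cdot> (c' \<cdot> d) = d"
      using comp_assoc[OF W(3) W'(1) r(1)] r(2) id_comp[OF W(3)] by simp
    ultimately show ?thesis by simp
  qed
  have inv: "has_homotopy_inverse M v"
  proof -
    have v\<psi>: "v \<cdot> \<psi>0 \<in> hom M X0 X0" "Id M X0 \<in> hom M X0 X0"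
      using comp_hom[OF X0(3) v(1)] id_hom bifibrant_obj[OF X0_bif] by auto
    have "\<psi>0 \<cdot> (v \<cdot> \<psi>0) = \<psi>0 \<cdot> Id M X0"
      using comp_assoc[OF X0(3) v(1) X0(3)] v(2) id_comp[OF X0(3)] comp_id[OF X0(3)] by simp
    then have "homotopic M (v \<cdot> \<psi>0) (Id M X0)"
      using homotopic_lifts[OF X0(3,4) v\<psi>] by blast
    moreover have "homotopic M (\<psi>0 \<cdot> v) (Id M S)"
      using homotopic_refl[OF id_hom[OF So]] v(2) by simp
    moreover have "Dom M v = S" "Cod M v = X0" using v(1) by (simp_all add: in_hom)
    ultimately show ?thesis using X0(3) unfolding has_homotopy_inverse_def by auto
  qed
  have hS: "homotopic M (Id M S) (Id M S)" by (rule homotopic_refl[OF id_hom[OF So]])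
  define X where "X = (\<lambda>n :: nat. if n = 0 then X0 else if n = 1 then Df else W)"
  define \<iota> where "\<iota> = (\<lambda>n :: nat. if n = 0 then v else if n = 1 then \<chi>0 \<cdot> v else \<chi>1 \<cdot> (\<chi>0 \<cdot> v))"
  have domd: "Dom M d = S" "Cod M d = W" "d \<in> Arr M" using W(3) by (simp_all add: in_hom)
  show ?thesis
    unfolding relcat_at_length_def domd
  proof (intro exI[of _ X] exI[of _ \<iota>] conjI allI impI)
    fix n :: nat assume "n \<le> 2"
    then show "bifibrant M (X n)" "\<iota> n \<in> hom M S (X n)"
      using X0_bif Df_bif W(1) v(1) \<chi>v comp_hom[OF \<chi>v \<chi>1] by (auto simp: X_def \<iota>_def)
  next
    fix n :: nat assume "n < 2"
    then consider "n = 0" | "n = 1" by linarith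
    then show "\<exists>Z \<rho> \<tau> \<chi> h \<sigma>. \<rho> \<in> hom M Z S \<and> \<tau> \<in> hom M Z (X n) \<and> \<chi> \<in> hom M (X n) (X (Suc n)) \<and>
      homotopy_pushout M \<rho> \<tau> (\<iota> (Suc n)) \<chi> h \<and> \<sigma> \<in> hom M S Z \<and>
      homotopic M (\<rho> \<cdot> \<sigma>) (Id M S) \<and> homotopic M (\<tau> \<cdot> \<sigma>) (\<iota> n)"
    proof cases
      case 1
      obtain Z \<rho> \<tau> h \<sigma> where s: "\<rho> \<in> hom M Z S" "\<tau> \<in> hom M Z X0" "homotopy_pushout M \<rho> \<tau> (\<chi>0 \<cdot> v) \<chi>0 h"
        "\<sigma> \<in> hom M S Z" "\<rho> \<cdot> \<sigma> = Id M S" "\<tau> \<cdot> \<sigma> = v"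
        using stage0 by blast
      have "X n = X0" "X (Suc n) = Df" "\<iota> n = v" "\<iota> (Suc n) = \<chi>0 \<cdot> v"
        using 1 by (simp_all add: X_def \<iota>_def)
      then show ?thesis
        using s \<chi>0(1) hS homotopic_refl[OF v(1)] by metis
    next
      case 2
      obtain Z \<rho> \<tau> h \<sigma> where s: "\<rho> \<in> hom M Z S" "\<tau> \<in> hom M Z Df" "homotopy_pushout M \<rho> \<tau> (\<chi>1 \<cdot> (\<chi>0 \<cdot> v)) \<chi>1 h"
        "\<sigma> \<in> hom M S Z" "\<rho> \<cdot> \<sigma> = Id M S" "\<tau> \<cdot> \<sigma> = \<chi>0 \<cdot> v"
        using stage1 by blast
      have "X n = Df" "X (Suc n) = W" "\<iota> n = \<chi>0 \<cdot> v" "\<iota> (Suc n) = \<chi>1 \<cdot> (\<chi>0 \<cdot> v)"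
        using 2 by (simp_all add: X_def \<iota>_def)
      then show ?thesis
        using s \<chi>1 hS homotopic_refl[OF \<chi>v] by metis
    qed
  qed (use domd bif inv final in \<open>simp_all add: X_def \<iota>_def\<close>)
qed

end

context suspension_presentation
begin

lemma relcat_diagonal_suspension:
  assumes diag: "is_diagonal M S d"
  shows "relcat_at_length M d 2"
proof -
  have pt: "cofibrant M pt" using bifibrant_pt by (simp add: bifibrant_def)
  have zR: "zmap pt R \<in> hom M pt R" by (rule zmap_hom[OF pt_obj objs(1)])
  have idR: "Id M R \<in> hom M R R" by (rule id_hom[OF objs(1)])
  obtain A0 a' a b where A0: "a' \<in> hom M pt A0" "a' \<in> Cof M" "a \<in> hom M A0 R" "b \<in> hom M A0 R"
    "a \<cdot> a' = zmap pt R" "b \<cdot> a' = zmap pt R" "pairing_in tfib a b"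
    using pairing_factor_cof[OF zR zR] .
  obtain A1 f c e where A1: "f \<in> hom M A0 A1" "f \<in> Cof M" "c \<in> hom M A1 C" "e \<in> hom M A1 R"
    "c \<cdot> f = i \<cdot> a" "e \<cdot> f = b" "pairing_in tfib c e"
    using pairing_factor_cof[OF comp_hom[OF A0(3) i(1)] A0(4)] .
  obtain E g1 g2 where E: "is_pushout M f b g1 g2" "g1 \<in> hom M A1 E" "g2 \<in> hom M R E" "g1 \<cdot> f = g2 \<cdot> b"
    using pushout_obtain[OF A1(1) A0(4)] .
  have "(\<phi> \<cdot> c) \<cdot> f = zmap R S \<cdot> b"
    using comp_assoc[OF A1(1,3) \<phi>_hom] A1(5) comp_assoc[OF A0(3) i(1) \<phi>_hom] \<phi>i A0(3,4) objs by (simp add: in_hom)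
  then obtain \<epsilon>S where \<epsilon>S: "\<epsilon>S \<in> hom M E S" "\<epsilon>S \<cdot> g1 = \<phi> \<cdot> c" "\<epsilon>S \<cdot> g2 = zmap R S"
    using pushout_induced[OF E(1,2,3) comp_hom[OF A1(3) \<phi>_hom] zmap_hom[OF objs(1,3)]] by blast
  obtain \<epsilon>R where \<epsilon>R: "\<epsilon>R \<in> hom M E R" "\<epsilon>R \<cdot> g1 = e" "\<epsilon>R \<cdot> g2 = Id M R"
    using pushout_induced[OF E(1,2,3) A1(4) idR] A1(6) id_comp[OF A0(4)] by auto
  obtain B \<beta> bS bC where B: "\<beta> \<in> hom M E B" "\<beta> \<in> Cof M" "bS \<in> hom M B S" "bC \<in> hom M B C"
    "bS \<cdot> \<beta> = \<epsilon>S" "bC \<cdot> \<beta> = i \<cdot> \<epsilon>R" "pairing_in tfib bS bC"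
    using pairing_factor_cof[OF \<epsilon>S(1) comp_hom[OF \<epsilon>R(1) i(1)]] .
  obtain J j1 j2 where J: "is_pushout M f a j1 j2" "j1 \<in> hom M A1 J" "j2 \<in> hom M R J" "j1 \<cdot> f = j2 \<cdot> a"
    using pushout_obtain[OF A1(1) A0(3)] .
  obtain \<gamma>J where \<gamma>J: "\<gamma>J \<in> hom M J C" "\<gamma>J \<cdot> j1 = c" "\<gamma>J \<cdot> j2 = i"
    using pushout_induced[OF J(1,2,3) A1(3) i(1) A1(5)] .
  obtain L j \<gamma> where L: "j \<in> hom M J L" "j \<in> Cof M" "\<gamma> \<in> hom M L C" "\<gamma> \<in> tfib" "\<gamma> \<cdot> j = \<gamma>J"
    using factor_cof_tfib[OF \<gamma>J(1)] .
  have \<gamma>j: "\<gamma> \<cdot> (j \<cdot> j1) = c" "\<gamma> \<cdot> (j \<cdot> j2) = i"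
    using comp_assoc[OF J(2) L(1,3)] comp_assoc[OF J(3) L(1,3)] L(5) \<gamma>J(2,3) by simp_all
  obtain D \<delta>B \<delta>0 where D: "is_pushout M (\<beta> \<cdot> g2) (zmap R pt) \<delta>B \<delta>0" "\<delta>B \<in> hom M B D" "\<delta>0 \<in> hom M pt D"
    using pushout_obtain[OF comp_hom[OF E(3) B(1)] zmap_hom[OF objs(1) pt_obj]] by metis
  have "torus_decomposition M pt R C S SQ i \<kappa> \<kappa>0 \<psi> A0 A1 E B J L D a b f c e g1 g2 \<epsilon>S \<epsilon>R \<beta> bS bC j1 j2 j \<gamma> \<delta>B \<delta>0"
    by unfold_locales
      (fact A0(3,4) A1(1-6) E(1-3) \<epsilon>S \<epsilon>R B J(1-3) L(1-4) \<gamma>j D cofibrant_cof[OF A0(1,2) pt]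
        pairing_tfib_imp(1)[OF A0(7)] pairing_tfib_imp(1)[OF A1(7)])+
  then show ?thesis by (rule torus_decomposition.relcat_diagonal[OF _ diag])
qed

lemma diagonal_exists: "\<exists>d. is_diagonal M S d"
proof -
  have Sf: "fibrant M S" "cofibrant M S" "cofibrant M pt"
    using bif bifibrant_pt by (auto simp: bifibrant_def)
  obtain PP p q where pr: "is_product M p q" "p \<in> hom M PP S" "q \<in> hom M PP S"
    using product_obtain[OF objs(3,3)] .
  obtain \<Delta> where \<Delta>: "\<Delta> \<in> hom M S PP" "p \<cdot> \<Delta> = Id M S" "q \<cdot> \<Delta> = Id M S"
    using product_induced[OF pr id_hom[OF objs(3)] id_hom[OF objs(3)]] .
  obtain W k w where w: "k \<in> hom M pt W" "k \<in> Cof M" "w \<in> hom M W PP" "w \<in> tfib"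
    using factor_cof_tfib[OF zmap_hom[OF pt_obj hom_objs(1)[OF pr(2)]]] by metis
  have "pairing_in (Fib M) (p \<cdot> w) (q \<cdot> w)"
    using pairing_iff(2)[OF pr w(3)] w(4) by simp
  then have W: "bifibrant M W"
    using pairing_fib_components(2)[OF comp_hom[OF w(3) pr(2)] comp_hom[OF w(3) pr(3)]] Sf cofibrant_cof[OF w(1,2)]
    by (simp add: bifibrant_def)
  obtain d where d: "d \<in> hom M S W" "w \<cdot> d = \<Delta>"
    using cofibrant_lift[OF Sf(2) w(3,4) \<Delta>(1)] .
  have ends: "Cod M p = S" "Cod M q = S" "Cod M w = Dom M p" "Dom M w = W"
    using pr w(3) by (simp_all add: in_hom)
  have ww: "w \<in> Weq M" using w(4) by simp
  have "p \<cdot> (w \<cdot> d) = Id M S" "q \<cdot> (w \<cdot> d) = Id M S"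
    unfolding d(2) by (fact \<Delta>)+
  then have "is_diagonal M S d"
    unfolding is_diagonal_def using pr(1) ends ww bif(3) W d(1) by metis
  then show ?thesis by blast
qed

lemma Compl_le_2: "Compl M S \<le> 2"
proof -
  have "relcat_at_length M (SOME d. is_diagonal M S d) 2"
    by (rule relcat_diagonal_suspension[OF someI_ex[OF diagonal_exists]])
  then have "Relcat M (SOME d. is_diagonal M S d) \<le> enat 2"
    unfolding Relcat_def by (intro Inf_lower) blast
  then show ?thesis
    unfolding Compl_def by (metis numeral_eq_enat)
qed

end

text \<open>The double mapping cylinder of \<open>f\<close> and \<open>g\<close> is the mapping cylinder of \<open>f\<close> with its front end
  collapsed. As the codomain of \<open>f\<close> is a zero object, this mapping cylinder is contractible, and a
  fibrant replacement of it serves as the cone \<open>C\<close>.\<close>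

lemma (in closed_model_category) suspension_presentation_exists:
  assumes cube: "cube_axiom M" and po: "homotopy_pushout M f g a b h"
    and zero: "is_zero M (Cod M f)" "is_zero M (Cod M g)"
  shows "\<exists>C SQ i \<kappa> \<kappa>0 \<psi>. suspension_presentation M (Cod M g) (Dom M f) C (Cod M a) SQ i \<kappa> \<kappa>0 \<psi>"
proof -
  define pt where "pt = Cod M g"
  define R where "R = Dom M f"
  define S where "S = Cod M a"
  define A where "A = Cod M f"
  interpret pointed_model_category M pt
    by unfold_locales (use zero(2) in \<open>simp add: pt_def\<close>)
  obtain k l m n u where sq: "hcomm_square M f g a b h" and k: "is_pushout M (end0 h) f k l"
    and m: "is_pushout M (k \<cdot> end1 h) g m n" and u: "u \<in> hom M (Cod M m) S" "u \<in> Weq M"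
    and eqs: "u \<cdot> (m \<cdot> l) = a" "u \<cdot> n = b" "u \<cdot> (m \<cdot> k) = hmap h"
    using po unfolding homotopy_pushout_def S_def by auto
  have t: "f \<in> hom M R A" "g \<in> hom M R pt" "a \<in> hom M A S" "b \<in> hom M pt S"
    and bif: "bifibrant M R" "bifibrant M A" "bifibrant M S" and h: "is_homotopy M h (a \<cdot> f) (b \<cdot> g)"
    using sq by (auto simp: hcomm_square_def in_hom R_def A_def S_def pt_def)
  note cyl = homotopy_typing(1)[OF h comp_hom[OF t(1,3)]]
  note c = cylinder_typing[OF cyl]
  have cof: "cofibrant M R" "cofibrant M A" "fibrant M S" and o: "R \<in> Obj M" "A \<in> Obj M" "S \<in> Obj M"
    using bif bifibrant_obj by (auto simp: bifibrant_def)
  define C0 where "C0 = Cod M k"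
  define P where "P = Cod M m"
  note kt = pushout_typing[OF k c(1) t(1), folded C0_def]
  define i0 where "i0 = k \<cdot> end1 h"
  have i0: "i0 \<in> hom M R C0" "i0 \<in> Cof M" and l: "l \<in> tcof"
    using mapping_cylinder[OF cyl cof(1,2) t(1) k kt] comp_hom[OF c(2) kt(1)] by (simp_all add: i0_def)
  have m': "is_pushout M i0 g m n" and u': "u \<in> hom M P S"
    using m u(1) by (simp_all add: i0_def P_def)
  note mt = pushout_typing[OF m' i0(1) t(2), folded P_def]
  have C0o: "C0 \<in> Obj M" using hom_objs[OF kt(2)] by simp
  have "zmap A pt \<in> Weq M"
  proof -
    have "\<exists>!z. z \<in> hom M A A"
      using zero(1) o(2) unfolding is_zero_def is_terminal_def A_def[symmetric] by simp
    then have "zmap pt A \<cdot> zmap A pt = Id M A"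
      using comp_hom[OF zmap_hom[OF o(2) pt_obj] zmap_hom[OF pt_obj o(2)]] id_hom[OF o(2)] by blast
    moreover have "zmap A pt \<cdot> zmap pt A = Id M pt"
      using zmap_pt_unique(1)[OF comp_hom[OF zmap_hom[OF pt_obj o(2)] zmap_hom[OF o(2) pt_obj]] id_hom[OF pt_obj]] .
    ultimately show ?thesis
      using iso_tfib[OF zmap_hom[OF o(2) pt_obj] zmap_hom[OF pt_obj o(2)]] by simp
  qed
  then have C0w: "zmap C0 pt \<in> Weq M"
    using two_of_three(2)[OF kt(2) zmap_hom[OF C0o pt_obj]] l kt(2) by (simp add: in_hom)
  obtain C ic pc where C: "ic \<in> hom M C0 C" "ic \<in> tcof" "pc \<in> hom M C pt" "pc \<in> Fib M" "pc \<cdot> ic = zmap C0 pt"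
    using factor_tcof_fib[OF zmap_hom[OF C0o pt_obj]] .
  have Co: "C \<in> Obj M" using hom_objs[OF C(1)] by simp
  have pc: "pc = zmap C pt" by (rule eq_zmap(1)[OF C(3)])
  have contractible: "zmap C pt \<in> tfib"
    using two_of_three(2)[OF C(1,3)] C C0w pc by simp
  have C_bif: "bifibrant M C"
    using cofibrant_cof[OF C(1)] C(2) cofibrant_cof[OF i0 cof(1)] contractible Co
    by (simp add: bifibrant_def fibrant_iff)
  define i where "i = ic \<cdot> i0"
  have i: "i \<in> hom M R C" "i \<in> Cof M"
    unfolding i_def using comp_hom[OF i0(1) C(1)] cof_comp[OF i0(1) C(1) i0(2)] C(2) by auto
  note zR = zmap_hom[OF o(1) pt_obj]
  have g: "g = zmap R pt" by (rule eq_zmap(1)[OF t(2)])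
  obtain SQ \<kappa> \<kappa>0 where SQ: "is_pushout M i (zmap R pt) \<kappa> \<kappa>0" "\<kappa> \<in> hom M C SQ" "\<kappa>0 \<in> hom M pt SQ"
    "\<kappa> \<cdot> i = \<kappa>0 \<cdot> zmap R pt"
    using pushout_obtain[OF i(1) zR] .
  have um: "u \<cdot> m \<in> hom M C0 S" by (rule comp_hom[OF mt(1) u'])
  obtain \<phi> where \<phi>: "\<phi> \<in> hom M C S" "\<phi> \<cdot> ic = u \<cdot> m"
    using fibrant_extend[OF cof(3) C(1,2) um] .
  have "\<phi> \<cdot> i = (u \<cdot> m) \<cdot> i0"
    unfolding i_def using comp_assoc[OF i0(1) C(1) \<phi>(1)] \<phi>(2) by simp
  also have "\<dots> = u \<cdot> (n \<cdot> g)"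
    using comp_assoc[OF i0(1) mt(1) u'] pushout_comm[OF m'] by simp
  also have "\<dots> = zmap R S"
    unfolding g using mt(2) u' o by (simp add: in_hom)
  finally obtain \<psi> where \<psi>: "\<psi> \<in> hom M SQ S" "\<psi> \<cdot> \<kappa> = \<phi>"
    using quotient_induced[OF SQ(1) i(1) SQ(2,3) \<phi>(1)] by blast
  have \<kappa>i: "(\<kappa> \<cdot> ic) \<cdot> i0 = \<kappa>0 \<cdot> g"
    using comp_assoc[OF i0(1) C(1) SQ(2)] SQ(4) by (simp add: i_def g)
  obtain w where w: "w \<in> hom M P SQ" "w \<cdot> m = \<kappa> \<cdot> ic" "w \<cdot> n = \<kappa>0"
    using pushout_induced[OF m' mt comp_hom[OF C(1) SQ(2)] SQ(3) \<kappa>i] .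
  have ids: "Id M R \<in> hom M R R" "Id M R \<in> Weq M" "Id M pt \<in> hom M pt pt" "Id M pt \<in> Weq M"
    using id_hom id_tcof o by auto
  have pt: "cofibrant M pt" using bifibrant_pt by (simp add: bifibrant_def)
  have "w \<in> Weq M"
    by (rule gluing[OF m' i0(1) t(2) mt i0(2) SQ(1) i(1) zR SQ(2,3) i(2) cof(1) pt cof(1) pt ids(1,2) C(1) _ ids(3,4) _ _ w(1,2)])
      (use C(2) comp_id[OF i(1)] i_def id_comp[OF t(2)] comp_id[OF zR] g comp_id[OF SQ(3)] w(3) in simp_all)
  moreover have "\<psi> \<cdot> w = u"
  proof (rule pushout_ext[OF m' comp_hom[OF w(1) \<psi>(1)] u' mt(1)])
    show "(\<psi> \<cdot> w) \<cdot> m = u \<cdot> m"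
      using comp_assoc[OF mt(1) w(1) \<psi>(1)] w(2) comp_assoc[OF C(1) SQ(2) \<psi>(1)] \<psi>(2) \<phi>(2) by simp
    show "(\<psi> \<cdot> w) \<cdot> n = u \<cdot> n"
      by (rule zmap_pt_unique(2)[OF comp_hom[OF mt(2) comp_hom[OF w(1) \<psi>(1)]] comp_hom[OF mt(2) u']])
  qed
  ultimately have \<psi>w: "\<psi> \<in> Weq M" using two_of_three(2)[OF w(1) \<psi>(1)] u(2) by simp
  have "suspension_presentation M pt R C S SQ i \<kappa> \<kappa>0 \<psi>"
    by unfold_locales (fact cube bif C_bif i contractible SQ(1-3) \<psi>(1) \<psi>w)+
  then show ?thesis unfolding pt_def R_def S_def by blast
qed

theorem theorem43:
  fixes M :: "('o, 'a) model_category" and X S :: 'o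
  assumes "closed_model_category M"
    and "cube_axiom M"
    and "pointed M"
    and "X \<in> Obj M"
    and "is_suspension M X S"
  shows "Compl M S \<le> 2"
proof -
  obtain R f g a b h where "homotopy_pushout M f g a b h" "is_zero M (Cod M f)" "is_zero M (Cod M g)" "Cod M a = S"
    using assms(5) unfolding is_suspension_def by blast
  then obtain C SQ i \<kappa> \<kappa>0 \<psi> where "suspension_presentation M (Cod M g) (Dom M f) C S SQ i \<kappa> \<kappa>0 \<psi>"
    using closed_model_category.suspension_presentation_exists[OF assms(1,2)] by blast
  then show ?thesis
    by (rule suspension_presentation.Compl_le_2)
qed

end
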